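(* Let $L_0 \in \Lambda$ be a Lagrangian subspace of $H$. Then the Fredholm Lagrangian-Grassmannian $\mathscr{F}_{L_0}(\Lambda)$ is homotopy equivalent to $U(\infty)/O(\infty)$.
   Context: $H$ is a real separable infinite-dimensional Hilbert space with a bounded operator $J$ on $H$ such that $J^2=-I$, $J^*=-J$, and with the symplectic form $\omega(\cdot,\cdot)=\langle J\cdot,\cdot\rangle$. A closed subspace $L\subset H$ is Lagrangian if $J(L)=L^\perp$. $\Lambda$ is the space of all Lagrangian subspaces of $H$, topologized by the metric $(L,L')\mapsto\|P_L-P_{L'}\|$, where $P_M$ is the orthogonal projection onto the closed subspace $M$ (this is the topology underlying its real-analytic Banach manifold structure). A pair $(L,L')$ of Lagrangians is a Fredholm pair if $\dim(L\cap L')<\infty$ and $L+L'$ is closed of finite codimension in $H$. $\mathscr{F}_{L_0}(\Lambda)$ is the set of all $L\in\Lambda$ such that $(L,L_0)$ is a Fredholm pair, with the subspace topology (it is open in $\Lambda$). $U(\infty)/O(\infty)$ is the quotient of the stable unitary group $U(\infty)=\varinjlim U(n)$ by the stable orthogonal group $O(\infty)=\varinjlim O(n)$. *)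

theory Defs
  imports "HOL-Analysis.Analysis"
begin

section \<open>Linear algebra in a real Hilbert space\<close>

text \<open>The library's \<^term>\<open>dim\<close> is \<open>0\<close> on infinite-dimensional subspaces, so finiteness of the
  dimension is expressed through finite spanning sets.\<close>

definition fin_dim :: "'a::real_vector set \<Rightarrow> bool"
  where "fin_dim V \<longleftrightarrow> (\<exists>B. finite B \<and> span B = V)"

text \<open>The quotient of the whole space by \<open>V\<close> is spanned by the classes of a finite set.\<close>

definition fin_codim :: "'a::real_vector set \<Rightarrow> bool"
  where "fin_codim V \<longleftrightarrow> (\<exists>B. finite B \<and> (\<forall>x. \<exists>b\<in>span B. x - b \<in> V))"

definition orth_proj :: "'a::real_inner set \<Rightarrow> 'a \<Rightarrow>\<^sub>L 'a"
  where "orth_proj M = (THE P. \<forall>x. blinfun_apply P x \<in> M \<and> x - blinfun_apply P x \<in> M\<^sup>\<bottom>)"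

lemma orthogonal_decomposition:
  fixes M :: "'a::{real_inner, complete_space} set"
  assumes "closed M" "subspace M"
  shows "\<exists>y\<in>M. x - y \<in> M\<^sup>\<bottom>"
proof -
  define D where "D = (INF y\<in>M. (norm (x - y))\<^sup>2)"
  have bdd: "bdd_below ((\<lambda>y. (norm (x - y))\<^sup>2) ` M)"
    by (rule bdd_belowI[of _ 0]) auto
  have ne: "M \<noteq> {}" using assms(2) subspace_0 by blast
  have D_le: "D \<le> (norm (x - y))\<^sup>2" if "y \<in> M" for y
    unfolding D_def by (rule cINF_lower[OF bdd that])
  have "\<exists>y\<in>M. (norm (x - y))\<^sup>2 < D + inverse (real (Suc n))" for n
  proof (rule ccontr)
    assume "\<not> ?thesis"
    then have "D + inverse (real (Suc n)) \<le> D"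
      unfolding D_def by (intro cINF_greatest ne) (auto simp: not_less D_def)
    then show False by simp
  qed
  then obtain Y where Y: "\<And>n. Y n \<in> M"
    and YD: "\<And>n. (norm (x - Y n))\<^sup>2 < D + inverse (real (Suc n))" by metis
  have close: "(norm (Y m - Y n))\<^sup>2 \<le> 2 * inverse (real (Suc m)) + 2 * inverse (real (Suc n))" for m n
  proof -
    have "(1/2) *\<^sub>R (Y m + Y n) \<in> M"
      using assms(2) Y by (simp add: subspace_add subspace_scale)
    from D_le[OF this] have "4 * D \<le> 4 * (norm (x - (1/2) *\<^sub>R (Y m + Y n)))\<^sup>2" by simp
    also have "\<dots> = 2 * (norm (x - Y m))\<^sup>2 + 2 * (norm (x - Y n))\<^sup>2 - (norm (Y m - Y n))\<^sup>2"
      by (simp add: power2_norm_eq_inner inner_diff_left inner_diff_right inner_add_left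
          inner_add_right inner_commute algebra_simps)
    finally show ?thesis using YD[of m] YD[of n] by linarith
  qed
  have "Cauchy Y"
  proof (rule metric_CauchyI)
    fix e :: real assume "e > 0"
    then obtain N where N: "inverse (real (Suc N)) < e\<^sup>2 / 4"
      using reals_Archimedean[of "e\<^sup>2 / 4"] by auto
    show "\<exists>N. \<forall>m\<ge>N. \<forall>n\<ge>N. dist (Y m) (Y n) < e"
    proof (intro exI allI impI)
      fix m n assume "N \<le> m" "N \<le> n"
      then have "inverse (real (Suc m)) \<le> inverse (real (Suc N))"
        "inverse (real (Suc n)) \<le> inverse (real (Suc N))"
        by (simp_all add: field_simps)
      with N close[of m n] have "(norm (Y m - Y n))\<^sup>2 < e\<^sup>2" by linarith
      then show "dist (Y m) (Y n) < e"
        using \<open>e > 0\<close> by (simp add: dist_norm power2_less_imp_less)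
    qed
  qed
  then obtain y where lim: "Y \<longlonglongrightarrow> y"
    using Cauchy_convergent convergent_def by blast
  have "y \<in> M" using closed_sequentially[OF assms(1)] Y lim by blast
  have "(\<lambda>n. (norm (x - Y n))\<^sup>2) \<longlonglongrightarrow> (norm (x - y))\<^sup>2"
    by (intro tendsto_intros lim)
  moreover have "(\<lambda>n. D + inverse (real (Suc n))) \<longlonglongrightarrow> D + 0"
    by (intro tendsto_intros LIMSEQ_inverse_real_of_nat)
  ultimately have yD: "(norm (x - y))\<^sup>2 \<le> D"
    using LIMSEQ_le YD less_imp_le by (metis (no_types, lifting) add_0_right)
  have "inner m (x - y) = 0" if "m \<in> M" for m
  proof (cases "m = 0")
    case False
    define t where "t = inner m (x - y) / (norm m)\<^sup>2"
    have "y + t *\<^sub>R m \<in> M"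
      using assms(2) \<open>y \<in> M\<close> that by (simp add: subspace_add subspace_scale)
    then have "(norm (x - y))\<^sup>2 \<le> (norm (x - (y + t *\<^sub>R m)))\<^sup>2"
      using D_le yD order_trans by blast
    also have "x - (y + t *\<^sub>R m) = (x - y) - t *\<^sub>R m" by simp
    also have "(norm ((x - y) - t *\<^sub>R m))\<^sup>2 =
        (norm (x - y))\<^sup>2 - 2 * t * inner m (x - y) + t\<^sup>2 * (norm m)\<^sup>2"
      unfolding power2_norm_eq_inner
      by (simp add: inner_diff_left inner_diff_right inner_commute algebra_simps power2_eq_square)
    also have "t\<^sup>2 * (norm m)\<^sup>2 = t * inner m (x - y)"
      using False by (simp add: t_def power2_eq_square)
    finally have "t * inner m (x - y) \<le> 0" by simp
    then have "(inner m (x - y))\<^sup>2 \<le> 0"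
      using False by (simp add: t_def power2_eq_square divide_le_0_iff) (simp add: mult_le_0_iff)
    then show ?thesis by simp
  qed simp
  then show ?thesis
    using \<open>y \<in> M\<close> by (auto simp: orthogonal_comp_def orthogonal_def)
qed

lemma orthogonal_decomposition_unique:
  assumes "subspace M" "y \<in> M" "x - y \<in> M\<^sup>\<bottom>" "z \<in> M" "x - z \<in> M\<^sup>\<bottom>"
  shows "y = z"
proof -
  have "y - z \<in> M" using assms by (simp add: subspace_diff)
  moreover have "(x - z) - (x - y) \<in> M\<^sup>\<bottom>"
    using assms subspace_orthogonal_comp subspace_diff by blast
  ultimately have "inner (y - z) (y - z) = 0"
    by (auto simp: orthogonal_comp_def orthogonal_def)
  then show ?thesis by simp
qed

lemma orth_proj:
  fixes M :: "'a::{real_inner, complete_space} set"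
  assumes "closed M" "subspace M"
  shows "blinfun_apply (orth_proj M) x \<in> M" "x - blinfun_apply (orth_proj M) x \<in> M\<^sup>\<bottom>"
proof -
  obtain p where p: "\<And>x. p x \<in> M" "\<And>x. x - p x \<in> M\<^sup>\<bottom>"
    using orthogonal_decomposition[OF assms] by metis
  note uniq = orthogonal_decomposition_unique[OF assms(2)]
  have "bounded_linear p"
  proof (rule bounded_linear_intro[where K = 1])
    fix x y :: 'a and r :: real
    have "(x + y) - (p x + p y) \<in> M\<^sup>\<bottom>"
      using subspace_add[OF subspace_orthogonal_comp p(2) p(2)] by (metis add_diff_add)
    then show "p (x + y) = p x + p y"
      by (meson uniq p assms(2) subspace_add)
    have "r *\<^sub>R x - r *\<^sub>R p x \<in> M\<^sup>\<bottom>"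
      using subspace_scale[OF subspace_orthogonal_comp p(2)] by (metis scaleR_right_diff_distrib)
    then show "p (r *\<^sub>R x) = r *\<^sub>R p x"
      by (meson uniq p assms(2) subspace_scale)
    have "inner (p x) (x - p x) = 0"
      using p by (auto simp: orthogonal_comp_def orthogonal_def)
    then have "(norm (p x))\<^sup>2 = inner (p x) x"
      by (simp add: inner_diff_right power2_norm_eq_inner)
    also have "\<dots> \<le> norm (p x) * norm x" by (rule norm_cauchy_schwarz)
    finally show "norm (p x) \<le> norm x * 1"
      by (cases "p x = 0") (auto simp: power2_eq_square)
  qed
  then have *: "\<forall>x. blinfun_apply (Blinfun p) x \<in> M \<and> x - blinfun_apply (Blinfun p) x \<in> M\<^sup>\<bottom>"
    using p by (simp add: bounded_linear_Blinfun_apply)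
  have "\<forall>x. blinfun_apply (orth_proj M) x \<in> M \<and> x - blinfun_apply (orth_proj M) x \<in> M\<^sup>\<bottom>"
    unfolding orth_proj_def
  proof (rule theI[where P = "\<lambda>P. \<forall>x. blinfun_apply P x \<in> M \<and> x - blinfun_apply P x \<in> M\<^sup>\<bottom>", OF *])
    fix Q :: "'a \<Rightarrow>\<^sub>L 'a"
    assume "\<forall>x. blinfun_apply Q x \<in> M \<and> x - blinfun_apply Q x \<in> M\<^sup>\<bottom>"
    with * show "Q = Blinfun p" by (intro blinfun_eqI) (meson uniq)
  qed
  then show "blinfun_apply (orth_proj M) x \<in> M" "x - blinfun_apply (orth_proj M) x \<in> M\<^sup>\<bottom>"
    by auto
qed

lemma orth_proj_fixes_iff:
  fixes M :: "'a::{real_inner, complete_space} set"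
  assumes "closed M" "subspace M"
  shows "blinfun_apply (orth_proj M) x = x \<longleftrightarrow> x \<in> M"
proof
  assume "x \<in> M"
  then show "blinfun_apply (orth_proj M) x = x"
    using orthogonal_decomposition_unique[OF assms(2) orth_proj[OF assms] \<open>x \<in> M\<close>, of x]
      subspace_0[OF subspace_orthogonal_comp, of M] by simp
qed (metis orth_proj(1)[OF assms])


section \<open>The Fredholm Lagrangian-Grassmannian\<close>

definition lagrangian :: "('a \<Rightarrow> 'a) \<Rightarrow> 'a::real_inner set \<Rightarrow> bool"
  where "lagrangian J L \<longleftrightarrow> subspace L \<and> closed L \<and> J ` L = L\<^sup>\<bottom>"

definition proj_dist :: "'a::real_inner set \<Rightarrow> 'a set \<Rightarrow> real"
  where "proj_dist L L' = norm (orth_proj L - orth_proj L')"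

definition lagrangian_topology :: "('a \<Rightarrow> 'a) \<Rightarrow> 'a::real_inner set topology"
  where "lagrangian_topology J = Metric_space.mtopology {L. lagrangian J L} proj_dist"

lemma Metric_space_lagrangian:
  fixes J :: "'a::{real_inner, complete_space} \<Rightarrow> 'a"
  shows "Metric_space {L. lagrangian J L} proj_dist"
proof
  fix L L' L'' :: "'a set"
  show "0 \<le> proj_dist L L'" by (simp add: proj_dist_def)
  show "proj_dist L L' = proj_dist L' L" by (simp add: proj_dist_def norm_minus_commute)
  show "proj_dist L L'' \<le> proj_dist L L' + proj_dist L' L''"
    unfolding proj_dist_def using norm_triangle_ineq[of "orth_proj L - orth_proj L'" "orth_proj L' - orth_proj L''"]
    by simp
  assume "L \<in> {L. lagrangian J L}" "L' \<in> {L. lagrangian J L}"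
  then have *: "closed L" "subspace L" "closed L'" "subspace L'"
    by (auto simp: lagrangian_def)
  show "proj_dist L L' = 0 \<longleftrightarrow> L = L'"
    using orth_proj_fixes_iff[OF *(1,2)] orth_proj_fixes_iff[OF *(3,4)]
    by (auto simp: proj_dist_def)
qed

definition fredholm_pair :: "'a::real_normed_vector set \<Rightarrow> 'a set \<Rightarrow> bool"
  where "fredholm_pair L L' \<longleftrightarrow>
    fin_dim (L \<inter> L') \<and>
    closed {x + y |x y. x \<in> L \<and> y \<in> L'} \<and>
    fin_codim {x + y |x y. x \<in> L \<and> y \<in> L'}"

definition fredholm_lagrangian_grassmannian :: "('a \<Rightarrow> 'a) \<Rightarrow> 'a::real_inner set \<Rightarrow> 'a set topology"
  where "fredholm_lagrangian_grassmannian J L\<^sub>0 =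
    subtopology (lagrangian_topology J) {L. lagrangian J L \<and> fredholm_pair L L\<^sub>0}"


section \<open>The quotient of the stable unitary group by the stable orthogonal group\<close>

text \<open>An \<open>n \<times> n\<close> matrix \<open>A\<close> is represented by its stabilisation, the infinite matrix
  \<open>A \<oplus> 1\<close>. The inclusions \<open>U(n) \<rightarrow> U(n + 1)\<close>, \<open>A \<mapsto> A \<oplus> 1\<close>, thereby become
  inclusions of sets.\<close>

type_synonym 'r imat = "nat \<Rightarrow> nat \<Rightarrow> 'r"

definition imat_one :: "'r::comm_ring_1 imat"
  where "imat_one = (\<lambda>i j. if i = j then 1 else 0)"

text \<open>The sums are finite for matrices satisfying \<open>stable n\<close> below, the only ones to which the product
  is applied.\<close>

definition imat_mult :: "'r::comm_ring_1 imat \<Rightarrow> 'r imat \<Rightarrow> 'r imat"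
  where "imat_mult A B = (\<lambda>i j. \<Sum>k | A i k * B k j \<noteq> 0. A i k * B k j)"

definition stable :: "nat \<Rightarrow> 'r::comm_ring_1 imat \<Rightarrow> bool"
  where "stable n A \<longleftrightarrow> (\<forall>i j. i \<ge> n \<or> j \<ge> n \<longrightarrow> A i j = imat_one i j)"

definition unitary_group :: "nat \<Rightarrow> complex imat set"
  where "unitary_group n = {A. stable n A \<and>
    imat_mult (\<lambda>i j. cnj (A j i)) A = imat_one \<and> imat_mult A (\<lambda>i j. cnj (A j i)) = imat_one}"

definition orthogonal_group :: "nat \<Rightarrow> real imat set"
  where "orthogonal_group n = {A. stable n A \<and>
    imat_mult (\<lambda>i j. A j i) A = imat_one \<and> imat_mult A (\<lambda>i j. A j i) = imat_one}"

lemma imat_mult_stable: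
  assumes "stable n A" "stable n B" "i < n" "j < n"
  shows "imat_mult A B i j = (\<Sum>k<n. A i k * B k j)"
  unfolding imat_mult_def
proof (rule sum.mono_neutral_left)
  show "{k. A i k * B k j \<noteq> 0} \<subseteq> {..<n}"
  proof
    fix k assume "k \<in> {k. A i k * B k j \<noteq> 0}"
    then have "A i k \<noteq> 0" by auto
    moreover have "A i k = 0" if "\<not> k < n"
      using assms(1,3) that unfolding stable_def imat_one_def by (metis leI)
    ultimately show "k \<in> {..<n}" by auto
  qed
qed auto

lemma unitary_group_mono: "m \<le> n \<Longrightarrow> unitary_group m \<subseteq> unitary_group n"
  by (auto simp: unitary_group_def stable_def)

text \<open>Direct limit topology of an increasing sequence of spaces.\<close>

definition colimit_topology :: "(nat \<Rightarrow> 'a topology) \<Rightarrow> 'a topology"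
  where "colimit_topology X = topology (\<lambda>W. W \<subseteq> (\<Union>n. topspace (X n)) \<and>
    (\<forall>n. openin (X n) (W \<inter> topspace (X n))))"

lemma openin_colimit_topology:
  "openin (colimit_topology X) W \<longleftrightarrow>
    W \<subseteq> (\<Union>n. topspace (X n)) \<and> (\<forall>n. openin (X n) (W \<inter> topspace (X n)))"
proof -
  have "istopology (\<lambda>W. W \<subseteq> (\<Union>n. topspace (X n)) \<and>
      (\<forall>n. openin (X n) (W \<inter> topspace (X n))))"
    unfolding istopology_def
  proof (rule conjI; clarify)
    fix S T
    assume "\<forall>n. openin (X n) (S \<inter> topspace (X n))" "\<forall>n. openin (X n) (T \<inter> topspace (X n))"
      "S \<subseteq> (\<Union>n. topspace (X n))"
    moreover have "S \<inter> T \<inter> topspace (X n) = (S \<inter> topspace (X n)) \<inter> (T \<inter> topspace (X n))" for n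
      by auto
    ultimately show "S \<inter> T \<subseteq> (\<Union>n. topspace (X n)) \<and>
        (\<forall>n. openin (X n) (S \<inter> T \<inter> topspace (X n)))"
      by (auto simp: openin_Int)
  next
    fix K
    assume K: "\<forall>S\<in>K. S \<subseteq> (\<Union>n. topspace (X n)) \<and> (\<forall>n. openin (X n) (S \<inter> topspace (X n)))"
    have "\<Union>K \<inter> topspace (X n) = (\<Union>S\<in>K. S \<inter> topspace (X n))" for n by auto
    then have "\<forall>n. openin (X n) (\<Union>K \<inter> topspace (X n))"
      using K by (metis (no_types, lifting) imageE openin_Union)
    then show "\<Union>K \<subseteq> (\<Union>n. topspace (X n)) \<and> (\<forall>n. openin (X n) (\<Union>K \<inter> topspace (X n)))"
      using K by blast
  qed
  then show ?thesis by (simp add: colimit_topology_def)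
qed

definition quotient_topology :: "'a topology \<Rightarrow> ('a \<Rightarrow> 'b) \<Rightarrow> 'b topology"
  where "quotient_topology X q = topology (\<lambda>V. V \<subseteq> q ` topspace X \<and>
    openin X {x \<in> topspace X. q x \<in> V})"

lemma openin_quotient_topology:
  "openin (quotient_topology X q) V \<longleftrightarrow>
    V \<subseteq> q ` topspace X \<and> openin X {x \<in> topspace X. q x \<in> V}"
proof -
  have "istopology (\<lambda>V. V \<subseteq> q ` topspace X \<and> openin X {x \<in> topspace X. q x \<in> V})"
    unfolding istopology_def
  proof (rule conjI; clarify)
    fix S T
    assume "openin X {x \<in> topspace X. q x \<in> S}" "openin X {x \<in> topspace X. q x \<in> T}"
      "S \<subseteq> q ` topspace X"
    moreover have "{x \<in> topspace X. q x \<in> S \<inter> T} =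
        {x \<in> topspace X. q x \<in> S} \<inter> {x \<in> topspace X. q x \<in> T}" by auto
    ultimately show "S \<inter> T \<subseteq> q ` topspace X \<and> openin X {x \<in> topspace X. q x \<in> S \<inter> T}"
      by (auto simp: openin_Int)
  next
    fix K
    assume K: "\<forall>S\<in>K. S \<subseteq> q ` topspace X \<and> openin X {x \<in> topspace X. q x \<in> S}"
    have "{x \<in> topspace X. q x \<in> \<Union>K} = (\<Union>S\<in>K. {x \<in> topspace X. q x \<in> S})" by auto
    then have "openin X {x \<in> topspace X. q x \<in> \<Union>K}"
      using K by (metis (no_types, lifting) imageE openin_Union)
    then show "\<Union>K \<subseteq> q ` topspace X \<and> openin X {x \<in> topspace X. q x \<in> \<Union>K}"
      using K by blast
  qed
  then show ?thesis by (simp add: quotient_topology_def)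
qed

lemma quotient_map_quotient_topology: "quotient_map X (quotient_topology X q) q"
proof -
  have "openin (quotient_topology X q) (q ` topspace X)"
    unfolding openin_quotient_topology
    by (metis (mono_tags, lifting) Collect_cong Collect_mem_eq imageI openin_topspace subset_refl)
  then have "topspace (quotient_topology X q) = q ` topspace X"
    by (metis openin_quotient_topology openin_subset openin_topspace subset_antisym)
  then show ?thesis
    by (simp add: quotient_map_def openin_quotient_topology)
qed

text \<open>The type \<^typ>\<open>complex imat\<close> carries the product topology of its entries, which induces on
  \<open>unitary_group n\<close> the Euclidean topology since only finitely many entries vary there.\<close>

definition U_inf :: "complex imat topology"
  where "U_inf = colimit_topology (\<lambda>n. top_of_set (unitary_group n))"

definition O_inf :: "complex imat set"
  where "O_inf = (\<Union>n. (\<lambda>A i j. complex_of_real (A i j)) ` orthogonal_group n)"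

definition U_inf_mod_O_inf :: "complex imat set topology"
  where "U_inf_mod_O_inf = quotient_topology U_inf (\<lambda>A. imat_mult A ` O_inf)"

end

theory Submission
  imports Defs
begin

text \<open>Let \<open>c\<close> be the conjugation of \<open>H\<close> that fixes \<open>L\<^sub>0\<close>. A Lagrangian \<open>L\<close> is encoded by the
  antilinear symmetric operator \<open>B = P\<^sub>L - (1 - P\<^sub>0)\<close>, and \<open>(L, L\<^sub>0)\<close> is a Fredholm pair iff
  \<open>\<parallel>Q\<^sub>n B\<parallel> < 1\<close> for some \<open>n\<close>, where \<open>Q\<^sub>n\<close> projects away from the first \<open>n\<close> complex coordinates of an
  orthonormal basis of \<open>L\<^sub>0\<close>. A real diagonal contraction \<open>D\<close> acts on Lagrangians by sending
  the graph of \<open>A\<close> to the graph of \<open>D A D\<close>, that is,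
  \<open>B \<mapsto> D B (1 - (1 - D\<^sup>2) c B)\<^sup>-\<^sup>1 D\<close>, which makes sense whenever \<open>\<parallel>(1 - D\<^sup>2) B\<parallel> < 1\<close>; for finite rank \<open>D\<close>
  this is symplectic reduction. Choosing \<open>D\<close> continuously in \<open>B\<close>, of locally bounded finite rank,
  and joining it linearly to the identity retracts the Fredholm Grassmannian up to homotopy onto the
  union of its finite-dimensional stages with the colimit topology. No contractibility of
  infinite-dimensional groups is needed, since all of the essential spectrum is pushed to one point.
  By Takagi's factorisation the stages are the spaces \<open>U(n)/O(n)\<close>.\<close>

section \<open>Hilbert space preliminaries\<close>

text \<open>If \<open>A\<close> is diagonal with real entry a, then c B is multiplication by a / (a
  + i), half of a Cayley transform, and compression with entry d turns it into d^2 a / (d^2 a + i).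
  The modulus of a / (a + i) is below 1 except at the pole a = infinity, whose value is 1. So a norm
  below 1 on a tail says that B stays away from the pole up to finite rank. Two obstacles shape the
  choice of D. The denominator 1 - (1 - D^2) c B degenerates at a pole with d = 0, so D has to be
  the identity on enough coordinates for the remaining tail of B to be a strict contraction. And the
  colimit topology on the union of the stages is finer than the norm topology, so the retraction has
  to land, locally, in one single stage. On the way from D to the identity the rank is infinite; the
  Fredholm property then survives because D is a scalar on a tail.\<close>

definition orthonormal :: "'a::real_inner set \<Rightarrow> bool"
  where "orthonormal C \<longleftrightarrow> (\<forall>x\<in>C. \<forall>y\<in>C. inner x y = (if x = y then 1 else 0))"

lemma orthonormal_expansion:
  assumes "finite C" "orthonormal C" "x \<in> span C"
  shows "x = (\<Sum>b\<in>C. inner x b *\<^sub>R b)"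
proof -
  from assms(1,3) obtain u where u: "x = (\<Sum>b\<in>C. u b *\<^sub>R b)"
    by (auto simp: span_finite)
  have "inner x b = u b" if "b \<in> C" for b
  proof -
    have "inner x b = (\<Sum>a\<in>C. u a * (if a = b then 1 else 0))"
      using assms(2) that unfolding u inner_sum_left orthonormal_def by (intro sum.cong) auto
    also have "\<dots> = u b" using assms(1) that by (simp add: if_distrib cong: if_cong)
    finally show ?thesis .
  qed
  with u show ?thesis by simp
qed

lemma orthonormal_independent:
  assumes "orthonormal C"
  shows "independent C"
proof (rule pairwise_orthogonal_independent)
  show "pairwise orthogonal C" using assms by (simp add: orthonormal_def pairwise_def orthogonal_def)
  show "0 \<notin> C" using assms unfolding orthonormal_def by (metis inner_zero_left zero_neq_one)
qed

lemma orthonormal_basis_of_span: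
  assumes "finite B"
  obtains C :: "'a::real_inner set" where "finite C" "orthonormal C" "span C = span B"
proof -
  obtain D where D: "finite D" "span D = span B" "pairwise orthogonal D"
    using basis_orthogonal[OF assms] by blast
  let ?C = "(\<lambda>x. x /\<^sub>R norm x) ` (D - {0})"
  have "orthonormal ?C"
    unfolding orthonormal_def
  proof (intro ballI)
    fix x y assume "x \<in> ?C" "y \<in> ?C"
    then obtain a b where ab: "a \<in> D" "b \<in> D" "a \<noteq> 0" "b \<noteq> 0"
      "x = a /\<^sub>R norm a" "y = b /\<^sub>R norm b" by auto
    show "inner x y = (if x = y then 1 else 0)"
    proof (cases "a = b")
      case True
      then show ?thesis using ab by (simp add: power2_norm_eq_inner[symmetric] power2_eq_square)
    next
      case False
      then have o: "inner x y = 0"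
        using D(3) ab by (auto simp: pairwise_def orthogonal_def)
      have "inner x x \<noteq> 0" using ab by simp
      then have "x \<noteq> y" using o by metis
      then show ?thesis using o by simp
    qed
  qed
  moreover have "span ?C = span B"
  proof -
    have "span ?C = span (D - {0})"
      using D(1) by (intro span_image_scale) auto
    then show ?thesis using D(2) by (simp add: span_delete_0)
  qed
  ultimately show thesis using D(1) by (intro that[of ?C]) auto
qed

lemma finite_spanning_set_subspace:
  fixes V :: "'a::real_vector set"
  assumes "subspace V" "V \<subseteq> span B" "finite B"
  shows "fin_dim V"
proof -
  obtain C where C: "C \<subseteq> V" "independent C" "V \<subseteq> span C"
    using maximal_independent_subset by blast
  have "finite C"
    using independent_span_bound[OF assms(3) C(2)] C(1) assms(2) by blast
  moreover have "span C = V"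
    using C assms(1) by (simp add: span_minimal subset_antisym)
  ultimately show ?thesis unfolding fin_dim_def by blast
qed

lemma fin_dim_orthonormal_basis:
  assumes "fin_dim V"
  obtains C :: "'a::real_inner set" where "finite C" "orthonormal C" "span C = V"
  using assms orthonormal_basis_of_span unfolding fin_dim_def by metis

lemma fin_codim_kernel:
  fixes f :: "'a::real_vector \<Rightarrow> 'b::real_vector"
  assumes f: "linear f" and "range f \<subseteq> span G" "finite G"
  shows "fin_codim {x. f x = 0}"
proof -
  have "fin_dim (range f)"
    using finite_spanning_set_subspace[OF _ assms(2,3)] linear_subspace_image[OF f] subspace_UNIV by blast
  then obtain R where R: "finite R" "span R = range f" unfolding fin_dim_def by blast
  then have "R \<subseteq> range f" using span_superset by blast
  then obtain G' where G': "finite G'" "f ` G' = R"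
    using R(1) finite_subset_image by metis
  have "\<exists>b\<in>span G'. x - b \<in> {x. f x = 0}" for x
  proof -
    have "f x \<in> f ` span G'"
      using R(2) G'(2) by (simp add: linear_span_image[OF f, symmetric])
    then obtain b where "b \<in> span G'" "f x = f b" by auto
    then show ?thesis by (auto simp: linear_diff[OF f] intro!: bexI[of _ b])
  qed
  then show ?thesis unfolding fin_codim_def using G'(1) by blast
qed

lemma fin_codim_mono:
  assumes "fin_codim C" "C \<subseteq> M"
  shows "fin_codim M"
proof -
  obtain G where "finite G" "\<And>x. \<exists>b\<in>span G. x - b \<in> C"
    using assms(1) unfolding fin_codim_def by auto
  then show ?thesis using assms(2) unfolding fin_codim_def by (meson subsetD)
qed

text \<open>A subspace of finite codimension need not be closed; this one is because it contains a
  closed one. With \<open>N\<close> an orthonormal basis of the part of \<open>M\<close> orthogonal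
  to \<open>C\<close>, which is finite-dimensional, \<open>M\<close> is the preimage of
  \<open>C\<close> under the continuous map that removes the components along
  \<open>N\<close>.\<close>

lemma closed_of_fin_codim_subspace:
  fixes C :: "'a::{real_inner, complete_space} set"
  assumes C: "closed C" "subspace C" "fin_codim C" and M: "C \<subseteq> M" "subspace M"
  shows "closed M"
proof -
  let ?p = "blinfun_apply (orth_proj C)"
  note p = orth_proj[OF C(1,2)]
  obtain G where G: "finite G" "\<And>x. \<exists>b\<in>span G. x - b \<in> C"
    using C(3) unfolding fin_codim_def by blast
  let ?V = "{x - ?p x |x. True} \<inter> M"
  have lin: "linear (\<lambda>x. x - ?p x)"
    by (intro linear_compose_sub linear_ident blinfun.bounded_linear_right[THEN bounded_linear.linear])
  have ran: "{x - ?p x |x. True} = range (\<lambda>x. x - ?p x)" by auto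
  have "subspace ?V"
    unfolding ran using linear_subspace_image[OF lin subspace_UNIV] M(2) by (rule subspace_inter)
  moreover have "?V \<subseteq> span ((\<lambda>x. x - ?p x) ` G)"
  proof clarify
    fix x
    obtain b where b: "b \<in> span G" "x - b \<in> C" using G(2) by blast
    then have "?p (x - b) = x - b" using orth_proj_fixes_iff[OF C(1,2)] by blast
    then have "x - ?p x = b - ?p b" by (simp add: blinfun.diff_right algebra_simps)
    then show "x - ?p x \<in> span ((\<lambda>x. x - ?p x) ` G)"
      using b(1) by (simp add: linear_span_image[OF lin])
  qed
  ultimately have "fin_dim ?V" using finite_spanning_set_subspace G(1) by blast
  then obtain N where N: "finite N" "orthonormal N" "span N = ?V"
    by (rule fin_dim_orthonormal_basis)
  have NM: "N \<subseteq> M" "\<And>b. b \<in> N \<Longrightarrow> \<exists>x. b = x - ?p x" using N(3) span_superset[of N] by auto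
  have "M = {x. x - (\<Sum>b\<in>N. inner x b *\<^sub>R b) \<in> C}"
  proof (intro equalityI subsetI CollectI)
    fix x assume x: "x \<in> M"
    have "x - ?p x \<in> span N" unfolding N(3) using x p(1) M by (auto intro: subspace_diff)
    from orthonormal_expansion[OF N(1,2) this]
    have "x - ?p x = (\<Sum>b\<in>N. inner (x - ?p x) b *\<^sub>R b)" .
    also have "\<dots> = (\<Sum>b\<in>N. inner x b *\<^sub>R b)"
    proof (rule sum.cong[OF refl])
      fix b assume "b \<in> N"
      then have "b \<in> C\<^sup>\<bottom>" using NM(2) p(2) by metis
      then have "inner (?p x) b = 0" using p(1) by (auto simp: orthogonal_comp_def orthogonal_def)
      then show "inner (x - ?p x) b *\<^sub>R b = inner x b *\<^sub>R b" by (simp add: inner_diff_left)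
    qed
    finally have "x - (\<Sum>b\<in>N. inner x b *\<^sub>R b) = ?p x" by (metis diff_eq_eq add.commute)
    then show "x - (\<Sum>b\<in>N. inner x b *\<^sub>R b) \<in> C" using p(1)[of x] by simp
  next
    fix x assume "x \<in> {x. x - (\<Sum>b\<in>N. inner x b *\<^sub>R b) \<in> C}"
    then have "x - (\<Sum>b\<in>N. inner x b *\<^sub>R b) \<in> M" using M by auto
    moreover have "(\<Sum>b\<in>N. inner x b *\<^sub>R b) \<in> M"
      using NM M(2) by (intro subspace_sum subspace_scale) auto
    ultimately show "x \<in> M" using subspace_add[OF M(2)] by fastforce
  qed
  moreover have "closed {x. x - (\<Sum>b\<in>N. inner x b *\<^sub>R b) \<in> C}"
    by (rule closed_vimage[OF C(1), unfolded vimage_def]) (intro continuous_intros)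
  ultimately show ?thesis by simp
qed

text \<open>Hellinger and Toeplitz: the sets \<open>{x \<in> V. \<forall>y\<in>V. \<bar>\<langle>x, y\<rangle>\<bar> \<le> k \<parallel>T y\<parallel>}\<close> are closed and, because
  \<open>T\<close> is symmetric and onto \<open>V\<close>, exhaust \<open>V\<close>; so Baire's theorem applies without the open mapping
  theorem.\<close>

lemma symmetric_surjection_bounded_below:
  fixes T :: "'a::{real_inner, complete_space} \<Rightarrow>\<^sub>L 'a"
  assumes V: "closed V" "subspace V"
    and sym: "\<And>x y. inner (T x) y = inner x (T y)"
    and surj: "\<And>x. x \<in> V \<Longrightarrow> \<exists>y\<in>V. T y = x"
  obtains \<delta> where "\<delta> > 0" "\<And>x. x \<in> V \<Longrightarrow> \<delta> * norm x \<le> norm (T x)"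
proof -
  define C where "C k = {x\<in>V. \<forall>y\<in>V. \<bar>inner x y\<bar> \<le> real k * norm (T y)}" for k
  have "\<exists>k. x \<in> C k" if xV: "x \<in> V" for x
  proof -
    obtain w where w: "w \<in> V" "T w = x" using surj[OF xV] by blast
    obtain k where k: "norm w \<le> real k" using real_arch_simple by blast
    have "\<bar>inner x y\<bar> \<le> real k * norm (T y)" for y
    proof -
      have "\<bar>inner x y\<bar> = \<bar>inner w (T y)\<bar>" using w sym by metis
      also have "\<dots> \<le> norm w * norm (T y)" by (rule Cauchy_Schwarz_ineq2)
      also have "\<dots> \<le> real k * norm (T y)" using k by (simp add: mult_right_mono)
      finally show ?thesis .
    qed
    then show ?thesis using xV unfolding C_def by auto
  qed
  then have un: "\<Union>(range C) = V" by (auto simp: C_def)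
  have cl: "closed (C k)" for k
  proof -
    have "C k = V \<inter> (\<Inter>y\<in>V. {x. \<bar>inner x y\<bar> \<le> real k * norm (T y)})" by (auto simp: C_def)
    also have "closed \<dots>"
      using V(1) by (intro closed_Int closed_INT ballI closed_Collect_le continuous_intros)
    finally show ?thesis .
  qed
  have "\<not> (\<forall>T\<in>range C. closedin (top_of_set V) T \<and> (top_of_set V) interior_of T = {})"
  proof
    assume "\<forall>T\<in>range C. closedin (top_of_set V) T \<and> (top_of_set V) interior_of T = {}"
    moreover have "completely_metrizable_space (top_of_set V)"
      using V(1) completely_metrizable_space_closedin completely_metrizable_space_euclidean
        closed_closedin by blast
    ultimately have "(top_of_set V) interior_of \<Union>(range C) = {}"
      by (intro Baire_category_alt) auto
    moreover have "(top_of_set V) interior_of V = V"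
      using interior_of_topspace[of "top_of_set V"] by simp
    ultimately show False using un V(2) subspace_0 by auto
  qed
  then obtain k where "(top_of_set V) interior_of C k \<noteq> {}"
    using cl closed_subset[of "C _" V] un by blast
  then obtain x0 U where U: "x0 \<in> U" "openin (top_of_set V) U" "U \<subseteq> C k"
    by (auto simp: interior_of_def)
  then have x0: "x0 \<in> V" using openin_imp_subset by blast
  obtain r where r: "r > 0" "\<And>x. x \<in> V \<Longrightarrow> dist x x0 < r \<Longrightarrow> x \<in> C k"
    using U unfolding openin_euclidean_subtopology_iff by (meson subsetD)
  have x0C: "x0 \<in> C k" using r x0 by auto
  have main: "r / 2 * norm y \<le> 2 * real k * norm (T y)" if y: "y \<in> V" for y
  proof (cases "y = 0")
    case False
    \<comment> \<open>Half the radius keeps \<open>x0 + h\<close> inside the ball; the direction of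
      \<open>y\<close> makes \<open>inner h y\<close> a multiple of \<open>norm y\<close>.\<close>
    define h where "h = (r / (2 * norm y)) *\<^sub>R y"
    have "h \<in> V" using y V(2) by (simp add: h_def subspace_scale)
    moreover have "norm h = r / 2" using False r(1) by (simp add: h_def)
    ultimately have "x0 + h \<in> C k" using r(1) x0 V(2)
      by (intro r(2) subspace_add) (auto simp: dist_norm)
    then have "\<bar>inner (x0 + h) y\<bar> \<le> real k * norm (T y)" "\<bar>inner x0 y\<bar> \<le> real k * norm (T y)"
      using x0C y by (auto simp: C_def)
    then have "\<bar>inner h y\<bar> \<le> 2 * real k * norm (T y)" by (simp add: inner_add_left)
    moreover have "inner h y = r / 2 * norm y"
      using False by (simp add: h_def power2_norm_eq_inner[symmetric] power2_eq_square)
    ultimately show ?thesis by simp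
  qed simp
  show thesis
  proof (rule that[of "r / (4 * (real k + 1))"])
    \<comment> \<open>\<open>k\<close> may be 0, hence the summand 1.\<close>
    show "0 < r / (4 * (real k + 1))" using r(1) by simp
    fix y assume y: "y \<in> V"
    have "r * norm y \<le> 4 * (real k * norm (T y))" using main[OF y] by simp
    also have "\<dots> \<le> 4 * ((real k + 1) * norm (T y))" by (simp add: mult_right_mono)
    finally show "r / (4 * (real k + 1)) * norm y \<le> norm (T y)"
      by (simp add: field_simps)
  qed
qed

section \<open>Orthonormal bases in a separable space\<close>

lemma separated_set_countable:
  fixes E :: "'a::metric_space set"
  assumes "separable_space (euclidean :: 'a topology)" "d > 0"
    and sep: "\<And>x y. x \<in> E \<Longrightarrow> y \<in> E \<Longrightarrow> x \<noteq> y \<Longrightarrow> d \<le> dist x y"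
  shows "countable E"
proof -
  obtain D :: "'a set" where D: "countable D" "closure D = UNIV"
    using assms(1) unfolding separable_space_def by auto
  have "\<exists>a\<in>D. dist a x < d / 2" for x
    using D(2) closure_approachable[of x D] assms(2) by (metis UNIV_I half_gt_zero)
  then obtain f where f: "\<And>x. f x \<in> D" "\<And>x. dist (f x) x < d / 2" by metis
  have "inj_on f E"
  proof (rule inj_onI, rule ccontr)
    fix x y assume xy: "x \<in> E" "y \<in> E" "f x = f y" "x \<noteq> y"
    have "dist x y \<le> dist (f x) x + dist (f x) y" by metric
    also have "\<dots> < d" using f(2)[of x] f(2)[of y] xy(3) by simp
    finally show False using sep xy by fastforce
  qed
  moreover have "countable (f ` E)" using D(1) f(1) by (meson countable_subset image_subsetI)
  ultimately show ?thesis using countable_image_inj_on by blast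
qed

lemma subspace_closure:
  fixes S :: "'a::real_normed_vector set"
  assumes S: "subspace S"
  shows "subspace (closure S)"
proof (rule subspaceI)
  show "0 \<in> closure S" using subspace_0[OF S] closure_subset by blast
next
  fix x y assume "x \<in> closure S" "y \<in> closure S"
  then obtain X Y where "\<And>n. X n \<in> S" "X \<longlonglongrightarrow> x" "\<And>n. Y n \<in> S" "Y \<longlonglongrightarrow> y"
    unfolding closure_sequential by blast
  then show "x + y \<in> closure S"
    unfolding closure_sequential by (intro exI[of _ "\<lambda>n. X n + Y n"] conjI allI tendsto_add subspace_add[OF S]) auto
next
  fix c x assume "x \<in> closure S"
  then obtain X where "\<And>n. X n \<in> S" "X \<longlonglongrightarrow> x"
    unfolding closure_sequential by blast
  then show "c *\<^sub>R x \<in> closure S"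
    unfolding closure_sequential
    by (intro exI[of _ "\<lambda>n. c *\<^sub>R X n"] conjI allI tendsto_scaleR tendsto_const subspace_scale[OF S]) auto
qed

text \<open>A maximal orthonormal subset of \<open>M\<close> spans a dense subspace. Its elements
  are at distance sqrt 2 from one another, so separability makes it countable; if it were finite,
  its span would be closed, hence all of \<open>M\<close>.\<close>

lemma orthonormal_basis_sequence:
  fixes M :: "'a::{real_inner, complete_space} set"
  assumes sep: "separable_space (euclidean :: 'a topology)"
    and M: "closed M" "subspace M" "\<not> fin_dim M"
  obtains e :: "nat \<Rightarrow> 'a" where "\<And>i j. inner (e i) (e j) = (if i = j then 1 else 0)"
    "closure (span (range e)) = M"
proof -
  let ?A = "{E. E \<subseteq> M \<and> orthonormal E}"
  have "\<exists>E\<in>?A. \<forall>X\<in>?A. E \<subseteq> X \<longrightarrow> X = E"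
  proof (rule subset_Zorn')
    fix \<C> assume ch: "subset.chain ?A \<C>"
    have "orthonormal (\<Union>\<C>)"
      unfolding orthonormal_def
    proof (intro ballI)
      fix x y assume "x \<in> \<Union>\<C>" "y \<in> \<Union>\<C>"
      then obtain X Y where XY: "X \<in> \<C>" "Y \<in> \<C>" "x \<in> X" "y \<in> Y" by auto
      then have "X \<subseteq> Y \<or> Y \<subseteq> X" using ch by (auto simp: subset_chain_def)
      then obtain Z where "Z \<in> \<C>" "x \<in> Z" "y \<in> Z" using XY by auto
      then show "inner x y = (if x = y then 1 else 0)"
        using ch by (auto simp: subset_chain_def orthonormal_def)
    qed
    then show "\<Union>\<C> \<in> ?A" using ch by (auto simp: subset_chain_def)
  qed
  then obtain E where "E \<in> ?A" and E': "\<forall>X\<in>?A. E \<subseteq> X \<longrightarrow> X = E" by (rule bexE)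
  then have E: "E \<subseteq> M" "orthonormal E" by simp_all
  have mx: "X = E" if "X \<subseteq> M" "orthonormal X" "E \<subseteq> X" for X
    using E' that by simp
  have N: "closed (closure (span E))" "subspace (closure (span E))" by (auto intro: subspace_closure)
  have NM: "closure (span E) \<subseteq> M" using E(1) M by (simp add: closure_minimal span_minimal)
  have dense: "closure (span E) = M"
  proof (rule ccontr)
    assume "closure (span E) \<noteq> M"
    then obtain x where x: "x \<in> M" "x \<notin> closure (span E)" using NM by blast
    define y where "y = x - orth_proj (closure (span E)) x"
    have y0: "y \<noteq> 0" using x(2) orth_proj(1)[OF N, of x] by (auto simp: y_def)
    have yM: "y \<in> M" using x(1) orth_proj(1)[OF N, of x] NM M(2) by (auto simp: y_def intro: subspace_diff)
    have yo: "inner b y = 0" if "b \<in> E" for b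
      using orth_proj(2)[OF N, of x] that span_superset[of E] closure_subset[of "span E"]
      by (auto simp: y_def orthogonal_comp_def orthogonal_def)
    define z where "z = y /\<^sub>R norm y"
    have z: "inner z z = 1" using y0 by (simp add: z_def dot_square_norm power2_eq_square)
    have zo: "inner b z = 0" "inner z b = 0" if "b \<in> E" for b
      using yo[OF that] by (auto simp: z_def inner_commute)
    have "z \<notin> E" using z zo(1)[of z] by auto
    then have "orthonormal (insert z E)"
      using E(2) z zo unfolding orthonormal_def by (metis insertE)
    moreover have "insert z E \<subseteq> M" using E(1) yM M(2) by (auto simp: z_def intro: subspace_scale)
    ultimately have "insert z E = E" using mx by blast
    then show False using \<open>z \<notin> E\<close> by blast
  qed
  have "countable E"
  proof (rule separated_set_countable[OF sep zero_less_one])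
    fix x y assume "x \<in> E" "y \<in> E" "x \<noteq> y"
    then have "inner x x = 1" "inner y y = 1" "inner x y = 0" using E(2) by (auto simp: orthonormal_def)
    then have "(dist x y)\<^sup>2 = 2"
      by (simp add: dist_norm power2_norm_eq_inner inner_diff_left inner_diff_right inner_commute)
    then show "1 \<le> dist x y" by (smt (verit) one_power2 power2_le_imp_le zero_le_dist)
  qed
  moreover have "infinite E"
  proof
    assume fin: "finite E"
    have "closed (span E)"
    proof -
      have "span E = {x. x - (\<Sum>b\<in>E. inner x b *\<^sub>R b) \<in> {0}}"
      proof (intro equalityI subsetI CollectI)
        fix x assume "x \<in> span E"
        then show "x - (\<Sum>b\<in>E. inner x b *\<^sub>R b) \<in> {0}"
          using orthonormal_expansion[OF fin E(2)] by simp
      next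
        fix x assume "x \<in> {x. x - (\<Sum>b\<in>E. inner x b *\<^sub>R b) \<in> {0}}"
        then have "x = (\<Sum>b\<in>E. inner x b *\<^sub>R b)" by simp
        then show "x \<in> span E" by (metis (no_types, lifting) span_base span_scale span_sum)
      qed
      also have "closed \<dots>" by (rule closed_vimage[OF closed_singleton, unfolded vimage_def]) (intro continuous_intros)
      finally show ?thesis .
    qed
    then have "span E = M" using dense by simp
    then show False using M(3) fin unfolding fin_dim_def by blast
  qed
  ultimately have bij: "bij_betw (from_nat_into E) UNIV E" by (rule bij_betw_from_nat_into)
  show thesis
  proof (rule that[of "from_nat_into E"])
    show "inner (from_nat_into E i) (from_nat_into E j) = (if i = j then 1 else 0)" for i j
    proof -
      have "from_nat_into E i \<in> E" "from_nat_into E j \<in> E"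
        using bij by (auto simp: bij_betw_def)
      moreover have "from_nat_into E i = from_nat_into E j \<longleftrightarrow> i = j"
        using bij by (auto simp: bij_betw_def inj_on_def)
      ultimately show ?thesis using E(2) unfolding orthonormal_def by simp
    qed
    show "closure (span (range (from_nat_into E))) = M" using bij dense by (simp add: bij_betw_def)
  qed
qed

section \<open>Neumann series\<close>

text \<open>The inverse of 1 - T, taken as an inverse function so that no series has to be summed.
  The lemmas below treat it for \<open>norm T < 1\<close>.\<close>

definition neumann :: "('a::{real_inner, complete_space} \<Rightarrow>\<^sub>L 'a) \<Rightarrow> 'a \<Rightarrow>\<^sub>L 'a"
  where "neumann T = Blinfun (inv (\<lambda>x. x - T x))"

lemma one_minus_contraction_bound:
  fixes T :: "'a::real_normed_vector \<Rightarrow>\<^sub>L 'a"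
  shows "(1 - norm T) * norm x \<le> norm (x - T x)"
  using norm_triangle_ineq2[of x "T x"] norm_blinfun[of T x] by (simp add: algebra_simps)

text \<open>Surjectivity of 1 - T is Banach's fixed point theorem for y -> x + T y; injectivity and
  the norm bound come from \<open>one_minus_contraction_bound\<close>.\<close>

lemma
  fixes T :: "'a::{real_inner, complete_space} \<Rightarrow>\<^sub>L 'a"
  assumes T: "norm T < 1"
  shows neumann_right: "neumann T x - T (neumann T x) = x"
    and neumann_left: "neumann T (x - T x) = x"
    and norm_neumann: "norm (neumann T) \<le> 1 / (1 - norm T)"
proof -
  let ?f = "\<lambda>x. x - T x"
  have inj: "inj ?f"
  proof (rule injI)
    fix x y assume "x - T x = y - T y"
    then have "(x - y) - T (x - y) = 0" by (simp add: blinfun.diff_right algebra_simps)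
    then have "(1 - norm T) * norm (x - y) \<le> 0" using one_minus_contraction_bound[of T "x - y"] by simp
    then have "norm (x - y) \<le> 0" using T by (auto simp: mult_le_0_iff)
    then show "x = y" by simp
  qed
  have "\<exists>!y. x + T y = y" for x
    by (rule banach_fix_type[OF norm_ge_zero T])
      (auto simp: dist_norm blinfun.diff_right[symmetric] norm_blinfun)
  then have surj: "\<exists>y. ?f y = x" for x by (metis add_diff_cancel_right')
  have r: "?f (inv ?f x) = x" for x
    using someI_ex[OF surj[of x]] by (simp add: inv_def)
  have l: "inv ?f (?f x) = x" for x by (rule inv_f_f[OF inj])
  have le: "norm (inv ?f x) \<le> norm x * (1 / (1 - norm T))" for x
    using one_minus_contraction_bound[of T "inv ?f x"] r[of x] T by (simp add: field_simps)
  have "bounded_linear (inv ?f)"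
  proof (rule bounded_linear_intro[OF _ _ le])
    fix x y :: 'a and c :: real
    have "?f (inv ?f x + inv ?f y) = ?f (inv ?f x) + ?f (inv ?f y)"
      by (simp add: blinfun.add_right)
    then have "?f (inv ?f x + inv ?f y) = x + y" by (simp only: r)
    then show "inv ?f (x + y) = inv ?f x + inv ?f y" by (metis l)
    have "?f (c *\<^sub>R inv ?f x) = c *\<^sub>R ?f (inv ?f x)"
      by (simp add: blinfun.scaleR_right scaleR_diff_right)
    then have "?f (c *\<^sub>R inv ?f x) = c *\<^sub>R x" by (simp only: r)
    then show "inv ?f (c *\<^sub>R x) = c *\<^sub>R inv ?f x" by (metis l)
  qed
  then have n: "blinfun_apply (neumann T) = inv ?f"
    unfolding neumann_def by (rule bounded_linear_Blinfun_apply)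
  show "neumann T x - T (neumann T x) = x" using r by (simp add: n)
  show "neumann T (x - T x) = x" using l by (simp add: n)
  show "norm (neumann T) \<le> 1 / (1 - norm T)"
    using T le by (intro norm_blinfun_bound) (auto simp: n mult.commute)
qed

text \<open>Resolvent identity: the difference of the inverses at \<open>S\<close> and
  \<open>T\<close> is the inverse at \<open>S\<close>, times S - T, times the inverse at
  \<open>T\<close>. The bound \<open>norm_neumann\<close> then forces convergence.\<close>

lemma continuous_on_neumann:
  "continuous_on {T :: 'a::{real_inner, complete_space} \<Rightarrow>\<^sub>L 'a. norm T < 1} neumann"
  unfolding continuous_on_def
proof safe
  fix T :: "'a \<Rightarrow>\<^sub>L 'a" assume T: "norm T < 1"
  let ?F = "at T within {T. norm T < 1}"
  have "norm (neumann S - neumann T) \<le> (1 / (1 - norm S)) * (norm (S - T) * (1 / (1 - norm T)))"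
    if S: "norm S < 1" for S
  proof -
    have "neumann S - neumann T = neumann S o\<^sub>L ((S - T) o\<^sub>L neumann T)"
    proof (rule blinfun_eqI)
      fix x
      let ?y = "neumann T x"
      have "x = ?y - T ?y" by (simp add: neumann_right[OF T])
      moreover have "?y - T ?y = (?y - S ?y) + (S - T) ?y" by (simp add: blinfun.diff_left)
      ultimately have "neumann S x = neumann S ((?y - S ?y) + (S - T) ?y)" by metis
      also have "\<dots> = ?y + neumann S ((S - T) ?y)"
        by (simp add: blinfun.add_right neumann_left[OF S])
      finally show "blinfun_apply (neumann S - neumann T) x = (neumann S o\<^sub>L ((S - T) o\<^sub>L neumann T)) x"
        by (simp add: blinfun.diff_left)
    qed
    also have "norm \<dots> \<le> norm (neumann S) * (norm (S - T) * norm (neumann T))"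
      by (meson mult_left_mono norm_blinfun_compose norm_ge_zero order_trans)
    also have "\<dots> \<le> (1 / (1 - norm S)) * (norm (S - T) * (1 / (1 - norm T)))"
      using norm_neumann[OF S] norm_neumann[OF T] S T by (intro mult_mono mult_nonneg_nonneg) auto
    finally show ?thesis .
  qed
  then have ev: "\<forall>\<^sub>F S in ?F. dist (neumann S) (neumann T)
      \<le> (1 / (1 - norm S)) * (norm (S - T) * (1 / (1 - norm T)))"
    by (auto simp: eventually_at_filter dist_norm)
  have "((\<lambda>S. (1 / (1 - norm S)) * (norm (S - T) * (1 / (1 - norm T)))) \<longlongrightarrow>
      (1 / (1 - norm T)) * (norm (T - T) * (1 / (1 - norm T)))) ?F"
    using T by (intro tendsto_intros) auto
  then have "((\<lambda>S. (1 / (1 - norm S)) * (norm (S - T) * (1 / (1 - norm T)))) \<longlongrightarrow> 0) ?F" by simp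
  then show "(neumann \<longlongrightarrow> neumann T) ?F"
    unfolding tendsto_dist_iff[of neumann]
    by (intro tendsto_sandwich[OF _ ev tendsto_const]) auto
qed

section \<open>Colimit topologies\<close>

lemma topspace_colimit_topology: "topspace (colimit_topology X) = (\<Union>n. topspace (X n))"
proof (rule antisym)
  show "topspace (colimit_topology X) \<subseteq> (\<Union>n. topspace (X n))"
    using openin_colimit_topology[of X "topspace (colimit_topology X)"] by auto
  have "(\<Union>n. topspace (X n)) \<inter> topspace (X m) = topspace (X m)" for m by auto
  then have "openin (colimit_topology X) (\<Union>n. topspace (X n))"
    unfolding openin_colimit_topology by simp
  then show "(\<Union>n. topspace (X n)) \<subseteq> topspace (colimit_topology X)" by (rule openin_subset)
qed

lemma continuous_map_into_colimit:
  assumes "continuous_map Y (X n) f"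
  shows "continuous_map Y (colimit_topology X) f"
  unfolding continuous_map_def
proof (intro conjI allI impI)
  show "f \<in> topspace Y \<rightarrow> topspace (colimit_topology X)"
    using continuous_map_image_subset_topspace[OF assms] by (auto simp: topspace_colimit_topology)
  fix W assume "openin (colimit_topology X) W"
  then have "openin Y {x \<in> topspace Y. f x \<in> W \<inter> topspace (X n)}"
    using assms unfolding openin_colimit_topology continuous_map_def by blast
  also have "{x \<in> topspace Y. f x \<in> W \<inter> topspace (X n)} = {x \<in> topspace Y. f x \<in> W}"
    using continuous_map_image_subset_topspace[OF assms] by auto
  finally show "openin Y {x \<in> topspace Y. f x \<in> W}" .
qed

lemma continuous_map_from_colimit:
  assumes "\<And>n. continuous_map (X n) Y f"
  shows "continuous_map (colimit_topology X) Y f"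
  unfolding continuous_map_def
proof (intro conjI allI impI)
  show "f \<in> topspace (colimit_topology X) \<rightarrow> topspace Y"
    using assms by (auto simp: topspace_colimit_topology continuous_map_def)
  fix W assume W: "openin Y W"
  have "{x \<in> topspace (colimit_topology X). f x \<in> W} \<inter> topspace (X n) = {x \<in> topspace (X n). f x \<in> W}" for n
    by (auto simp: topspace_colimit_topology)
  moreover have "openin (X n) {x \<in> topspace (X n). f x \<in> W}" for n
    using assms W by (auto simp: continuous_map_def)
  ultimately show "openin (colimit_topology X) {x \<in> topspace (colimit_topology X). f x \<in> W}"
    by (auto simp: openin_colimit_topology topspace_colimit_topology)
qed

text \<open>A product with an interval is compatible with the colimit because the interval is
  locally compact. Near (s, y) take a compact interval \<open>K\<close> around \<open>s\<close> that
  \<open>h\<close> sends into \<open>W\<close> along \<open>y\<close>, and let \<open>V\<close>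
  consist of all points with this property. In each \<open>X n\<close> the complement of
  \<open>V\<close> is the projection along the compact \<open>K\<close> of a closed set, hence
  closed, so \<open>V\<close> is open in the colimit.\<close>

lemma continuous_map_homotopy_from_colimit:
  fixes h :: "real \<times> 'a \<Rightarrow> 'b"
  assumes h: "\<And>n. continuous_map (prod_topology (top_of_set {0..1}) (X n)) Y h"
  shows "continuous_map (prod_topology (top_of_set {0..1}) (colimit_topology X)) Y h"
proof -
  let ?I = "top_of_set {0..1::real}" and ?C = "colimit_topology X"
  have im: "h (s, y) \<in> topspace Y" if sy: "s \<in> {0..1}" "y \<in> topspace ?C" for s y
  proof -
    obtain n where n: "y \<in> topspace (X n)" using sy(2) by (auto simp: topspace_colimit_topology)
    then have "h \<in> topspace (prod_topology ?I (X n)) \<rightarrow> topspace Y"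
      using h by (simp add: continuous_map_def)
    moreover have "(s, y) \<in> topspace (prod_topology ?I (X n))" using n sy by simp
    ultimately show ?thesis by blast
  qed
  show ?thesis
    unfolding continuous_map_def
  proof (intro conjI allI impI)
    show "h \<in> topspace (prod_topology ?I ?C) \<rightarrow> topspace Y" using im by auto
    fix W assume W: "openin Y W"
    show "openin (prod_topology ?I ?C) {x \<in> topspace (prod_topology ?I ?C). h x \<in> W}"
    proof (subst openin_subopen, safe)
      fix s y assume sy: "(s, y) \<in> topspace (prod_topology ?I ?C)" "h (s, y) \<in> W"
      then obtain n0 where n0: "y \<in> topspace (X n0)" by (auto simp: topspace_colimit_topology)
      have s: "s \<in> {0..1}" using sy by simp
      have "continuous_map ?I Y (\<lambda>s. h (s, y))"
        using continuous_map_compose[OF _ h[of n0], of ?I "\<lambda>s. (s, y)"] n0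
        by (simp add: continuous_map_paired o_def)
      then have "openin ?I {s \<in> {0..1}. h (s, y) \<in> W}"
        using W by (auto simp: continuous_map_def)
      then obtain d where d: "d > 0" "\<And>t. t \<in> {0..1} \<Longrightarrow> dist t s < d \<Longrightarrow> h (t, y) \<in> W"
        using s sy(2) unfolding openin_euclidean_subtopology_iff by blast
      \<comment> \<open>The closed ball of radius d / 2 stays inside the open one of radius
        d.\<close>
      define K where "K = {0..1} \<inter> cball s (d / 2)"
      define V where "V = {y' \<in> topspace ?C. \<forall>t\<in>K. h (t, y') \<in> W}"
      have K: "compact K" by (simp add: K_def compact_Int)
      have KI: "K \<subseteq> {0..1}" by (auto simp: K_def)
      have "openin (X n) (V \<inter> topspace (X n))" for n
      proof -
        have hK: "continuous_map (prod_topology (top_of_set K) (X n)) Y h"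
          using continuous_map_from_subtopology[OF h[of n], of "K \<times> topspace (X n)"] KI
          by (simp add: subtopology_Times subtopology_subtopology Int_absorb1 inf.absorb2)
        have "closedin (prod_topology (top_of_set K) (X n))
            {p \<in> topspace (prod_topology (top_of_set K) (X n)). h p \<in> topspace Y - W}"
          using hK W by (intro closedin_continuous_map_preimage) auto
        moreover have "closed_map (prod_topology (top_of_set K) (X n)) (X n) snd"
          using K by (intro closed_map_snd) (simp add: compact_space_subtopology)
        ultimately have "closedin (X n) (snd `
            {p \<in> topspace (prod_topology (top_of_set K) (X n)). h p \<in> topspace Y - W})"
          by (simp add: closed_map_def)
        moreover have "V \<inter> topspace (X n) = topspace (X n) - snd `
            {p \<in> topspace (prod_topology (top_of_set K) (X n)). h p \<in> topspace Y - W}"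
        proof (intro equalityI subsetI)
          fix z assume "z \<in> V \<inter> topspace (X n)"
          then show "z \<in> topspace (X n) - snd `
            {p \<in> topspace (prod_topology (top_of_set K) (X n)). h p \<in> topspace Y - W}"
            by (auto simp: V_def)
        next
          fix z assume z: "z \<in> topspace (X n) - snd `
            {p \<in> topspace (prod_topology (top_of_set K) (X n)). h p \<in> topspace Y - W}"
          then have zC: "z \<in> topspace ?C" by (auto simp: topspace_colimit_topology)
          have "h (t, z) \<in> W" if t: "t \<in> K" for t
          proof (rule ccontr)
            assume "h (t, z) \<notin> W"
            then have "h (t, z) \<in> topspace Y - W" using im zC t KI by blast
            moreover have "(t, z) \<in> topspace (prod_topology (top_of_set K) (X n))" using t z by simp
            ultimately show False using z by (metis (mono_tags, lifting) DiffD2 image_eqI mem_Collect_eq snd_conv)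
          qed
          then show "z \<in> V \<inter> topspace (X n)" using z zC by (auto simp: V_def)
        qed
        ultimately show ?thesis by auto
      qed
      then have "openin ?C V"
        unfolding openin_colimit_topology by (auto simp: V_def topspace_colimit_topology)
      moreover have "openin ?I ({0..1} \<inter> ball s (d / 2))" by (simp add: openin_open_Int)
      ultimately have "openin (prod_topology ?I ?C) (({0..1} \<inter> ball s (d / 2)) \<times> V)"
        by (simp add: openin_prod_Times_iff)
      moreover have "(s, y) \<in> ({0..1} \<inter> ball s (d / 2)) \<times> V"
        using d sy by (auto simp: V_def K_def dist_commute)
      moreover have "({0..1} \<inter> ball s (d / 2)) \<times> V \<subseteq> {x \<in> topspace (prod_topology ?I ?C). h x \<in> W}"
        by (auto simp: V_def K_def)
      ultimately show "\<exists>T. openin (prod_topology ?I ?C) T \<and> (s, y) \<in> T \<and>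
          T \<subseteq> {x \<in> topspace (prod_topology ?I ?C). h x \<in> W}" by blast
    qed
  qed
qed

lemma homeomorphic_space_of_quotient_maps:
  assumes q: "quotient_map X Y q" and s: "quotient_map X Z s"
    and fib: "\<And>x y. x \<in> topspace X \<Longrightarrow> y \<in> topspace X \<Longrightarrow> q x = q y \<longleftrightarrow> s x = s y"
  shows "Y homeomorphic_space Z"
proof -
  have "continuous_map X Z s" "continuous_map X Y q"
    using q s quotient_imp_continuous_map by auto
  note c = this
  obtain f where f: "continuous_map Y Z f" "\<And>x. x \<in> topspace X \<Longrightarrow> f (q x) = s x"
    by (rule quotient_map_lift_exists[OF q c(1) fib[THEN iffD1]]) (assumption | rule that)+
  obtain g where g: "continuous_map Z Y g" "\<And>x. x \<in> topspace X \<Longrightarrow> g (s x) = q x"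
    by (rule quotient_map_lift_exists[OF s c(2) fib[THEN iffD2]]) (assumption | rule that)+
  have "q ` topspace X = topspace Y" "s ` topspace X = topspace Z"
    using q s by (auto simp: quotient_map_def)
  then have "homeomorphic_maps Y Z f g"
    using f g unfolding homeomorphic_maps_def by (metis (no_types, lifting) imageE)
  then show ?thesis unfolding homeomorphic_space_def by blast
qed

section \<open>Lagrangian subspaces as operators\<close>

definition rank_one :: "'a::real_inner \<Rightarrow> 'a \<Rightarrow> 'a \<Rightarrow>\<^sub>L 'a"
  where "rank_one u v = blinfun_scaleR_left u o\<^sub>L blinfun_inner_right v"

lemma rank_one_apply [simp]: "rank_one u v x = inner v x *\<^sub>R u"
  by (simp add: rank_one_def blinfun_inner_right.rep_eq)

text \<open>This follows from |S x|^2 = <x, T S x>. It turns a bound for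
  \<open>B o\<^sub>L tail n\<close> into one for \<open>tail n o\<^sub>L B\<close>.\<close>

lemma norm_le_of_adjoint:
  fixes S T :: "'a::real_inner \<Rightarrow>\<^sub>L 'a"
  assumes "\<And>x y. inner (S x) y = inner x (T y)"
  shows "norm S \<le> norm T"
proof (rule norm_blinfun_bound[OF norm_ge_zero])
  fix x
  have "norm (S x) * norm (S x) = inner x (T (S x))"
    by (simp add: assms[symmetric] dot_square_norm power2_eq_square)
  also have "\<dots> \<le> norm x * norm (T (S x))" by (rule norm_cauchy_schwarz)
  also have "\<dots> \<le> norm x * (norm T * norm (S x))" by (intro mult_left_mono norm_blinfun) simp
  finally have "norm (S x) * norm (S x) \<le> (norm T * norm x) * norm (S x)" by (simp add: algebra_simps)
  then show "norm (S x) \<le> norm T * norm x"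
    by (cases "S x = 0") (auto dest: mult_right_le_imp_le)
qed

text \<open>\<open>J\<close> maps \<open>L\<close> onto its orthogonal complement and, as J^2 = -1,
  the complement onto \<open>L\<close>. So it conjugates the projection into the complementary one,
  which is the second equation.\<close>

lemma lagrangian_orth_proj:
  fixes J :: "'a::{real_inner, complete_space} \<Rightarrow>\<^sub>L 'a"
  assumes J_J: "\<And>x. J (J x) = - x" and L: "lagrangian J L"
  shows "inner (orth_proj L x) y = inner x (orth_proj L y)"
    and "orth_proj L (J x) = J x - J (orth_proj L x)"
    and "orth_proj L (orth_proj L x) = orth_proj L x"
    and "orth_proj L x = x \<longleftrightarrow> x \<in> L"
    and "orth_proj L x \<in> L"
proof -
  have cs: "closed L" "subspace L" using L by (auto simp: lagrangian_def)
  let ?P = "orth_proj L"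
  note p = orth_proj[OF cs]
  have o: "inner (?P u) (v - ?P v) = 0" for u v
    using p by (auto simp: orthogonal_comp_def orthogonal_def)
  have "inner (?P x) y = inner (?P x) (?P y)" for x y
    using o[of x y] by (simp add: inner_diff_right)
  then show "inner (?P x) y = inner x (?P y)" by (metis inner_commute)
  show fix_iff: "?P x = x \<longleftrightarrow> x \<in> L" for x by (rule orth_proj_fixes_iff[OF cs])
  then show idem: "?P (?P x) = ?P x" for x using p(1) by blast
  show "?P x \<in> L" by (rule p)
  have JL: "J ` L = L\<^sup>\<bottom>" using L by (simp add: lagrangian_def)
  have "J x - J (?P x) \<in> L"
  proof -
    have "x - ?P x \<in> J ` L" using p(2) JL by simp
    then obtain l where "l \<in> L" "x - ?P x = J l" by auto
    then have "J x - J (?P x) = - l" by (metis J_J blinfun.diff_right)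
    then show ?thesis using \<open>l \<in> L\<close> cs(2) by (simp add: subspace_neg)
  qed
  moreover have "J x - (J x - J (?P x)) \<in> L\<^sup>\<bottom>" using p(1) JL by auto
  ultimately show "?P (J x) = J x - J (?P x)"
    using orthogonal_decomposition_unique[OF cs(2) p] by blast
qed

text \<open>\<open>P\<^sub>0\<close> is the projection onto the fixed Lagrangian
  \<open>L\<^sub>0\<close>, recorded through its algebraic identities only; \<open>e\<close> is an
  orthonormal basis of \<open>L\<^sub>0\<close>, hence a complex one of the whole space when
  \<open>J\<close> is read as multiplication by i.\<close>

locale lagrangian_setting =
  fixes J P\<^sub>0 :: "'a::{real_inner, complete_space} \<Rightarrow>\<^sub>L 'a" and e :: "nat \<Rightarrow> 'a"
  assumes J_J [simp]: "J (J x) = - x"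
    and J_skew: "inner (J x) y = - inner x (J y)"
    and P0_sym: "inner (P\<^sub>0 x) y = inner x (P\<^sub>0 y)"
    and P0_idem [simp]: "P\<^sub>0 (P\<^sub>0 x) = P\<^sub>0 x"
    and P0_J: "P\<^sub>0 (J x) = J x - J (P\<^sub>0 x)"
    and e_ortho: "inner (e i) (e j) = (if i = j then 1 else 0)"
    and P0_e [simp]: "P\<^sub>0 (e i) = e i"
    and e_dense: "P\<^sub>0 x = x \<Longrightarrow> x \<in> closure (span (range e))"
begin

section \<open>Conjugation, coordinate lines and diagonal contractions\<close>

lemma inner_J_J [simp]: "inner (J x) (J y) = inner x y"
  by (simp add: J_skew)

lemma norm_J [simp]: "norm (J x) = norm x"
  by (simp add: norm_eq_sqrt_inner)

lemma P0_J_e [simp]: "P\<^sub>0 (J (e i)) = 0"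
  by (simp add: P0_J)

lemma inner_e_J_e [simp]: "inner (e i) (J (e j)) = 0" "inner (J (e i)) (e j) = 0"
  using P0_sym[of "e i" "J (e j)"] J_skew[of "e i" "e j"] by simp_all

definition conjg :: "'a \<Rightarrow>\<^sub>L 'a"
  where "conjg = 2 *\<^sub>R P\<^sub>0 - id_blinfun"

lemma conjg_apply: "conjg x = 2 *\<^sub>R P\<^sub>0 x - x"
  by (simp add: conjg_def blinfun.bilinear_simps)

lemma conjg_conjg [simp]: "conjg (conjg x) = x"
  by (simp add: conjg_apply blinfun.bilinear_simps algebra_simps scaleR_2)

lemma conjg_sym: "inner (conjg x) y = inner x (conjg y)"
  by (simp add: conjg_apply P0_sym inner_diff_left inner_diff_right)

lemma inner_conjg_conjg [simp]: "inner (conjg x) (conjg y) = inner x y"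
  by (simp add: conjg_sym)

lemma norm_conjg [simp]: "norm (conjg x) = norm x"
  by (simp add: norm_eq_sqrt_inner)

lemma conjg_J: "conjg (J x) = - J (conjg x)"
  by (simp add: conjg_apply P0_J blinfun.bilinear_simps algebra_simps scaleR_2)

text \<open>The orthogonal projection onto the complex line through \<open>e k\<close>.\<close>

definition coord_proj :: "nat \<Rightarrow> 'a \<Rightarrow>\<^sub>L 'a"
  where "coord_proj k = rank_one (e k) (e k) + rank_one (J (e k)) (J (e k))"

lemma coord_proj_apply:
  "coord_proj k x = inner (e k) x *\<^sub>R e k + inner (J (e k)) x *\<^sub>R J (e k)"
  by (simp add: coord_proj_def blinfun.bilinear_simps)

lemma coord_proj_sym: "inner (coord_proj k x) y = inner x (coord_proj k y)"
  by (simp add: coord_proj_apply inner_add_left inner_add_right inner_commute)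

lemma coord_proj_coord_proj: "coord_proj i (coord_proj j x) = (if i = j then coord_proj i x else 0)"
  by (simp add: coord_proj_apply inner_add_right e_ortho)

lemma coord_proj_J: "coord_proj k (J x) = J (coord_proj k x)"
  using J_skew[of "e k" x] by (simp add: coord_proj_apply blinfun.bilinear_simps)

lemma coord_proj_P0: "coord_proj k (P\<^sub>0 x) = P\<^sub>0 (coord_proj k x)"
  by (simp add: coord_proj_apply blinfun.bilinear_simps P0_sym[symmetric])

text \<open>The basis does not enter: what matters for compression is self-adjointness, complex
  linearity, reality (commuting with the conjugation) and the norm bound.\<close>

definition diagonal :: "('a \<Rightarrow>\<^sub>L 'a) \<Rightarrow> bool"
  where "diagonal D \<longleftrightarrow> (\<forall>x y. inner (D x) y = inner x (D y)) \<and> (\<forall>x. D (J x) = J (D x)) \<and>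
    (\<forall>x. D (P\<^sub>0 x) = P\<^sub>0 (D x)) \<and> norm D \<le> 1"

lemma diagonalD:
  assumes "diagonal D"
  shows "inner (D x) y = inner x (D y)" "D (J x) = J (D x)" "D (P\<^sub>0 x) = P\<^sub>0 (D x)"
    "D (conjg x) = conjg (D x)" "norm D \<le> 1" "norm (D x) \<le> norm x"
proof -
  show "inner (D x) y = inner x (D y)" "D (J x) = J (D x)" "D (P\<^sub>0 x) = P\<^sub>0 (D x)" "norm D \<le> 1"
    using assms by (auto simp: diagonal_def)
  then show "D (conjg x) = conjg (D x)" by (simp add: conjg_apply blinfun.bilinear_simps)
  show "norm (D x) \<le> norm x"
    using norm_blinfun[of D x] \<open>norm D \<le> 1\<close> mult_right_mono[of "norm D" 1 "norm x"] by simp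
qed

text \<open>By orthogonality of the coordinate lines, weights of modulus at most 1 only shrink the
  norm; there remains the case of all weights 1, which is Bessel's inequality.\<close>

lemma diagonal_coord_sum:
  assumes r: "\<And>k. k < n \<Longrightarrow> \<bar>r k\<bar> \<le> 1"
  shows "diagonal (\<Sum>k<n. r k *\<^sub>R coord_proj k)" (is "diagonal ?D")
proof -
  have ap: "?D x = (\<Sum>k<n. r k *\<^sub>R coord_proj k x)" for x
    by (simp add: blinfun.bilinear_simps)
  have pyth: "(norm (\<Sum>k<n. s k *\<^sub>R coord_proj k x))\<^sup>2 = (\<Sum>k<n. (s k)\<^sup>2 * (norm (coord_proj k x))\<^sup>2)"
    for s :: "nat \<Rightarrow> real" and x
  proof -
    have "(norm (\<Sum>k<n. s k *\<^sub>R coord_proj k x))\<^sup>2 = (\<Sum>k<n. (norm (s k *\<^sub>R coord_proj k x))\<^sup>2)"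
      by (rule norm_sum_Pythagorean)
        (auto simp: pairwise_def orthogonal_def coord_proj_sym coord_proj_coord_proj)
    then show ?thesis by (simp add: power_mult_distrib)
  qed
  have le: "norm (?D x) \<le> norm (\<Sum>k<n. 1 *\<^sub>R coord_proj k x)" for x
  proof (rule power2_le_imp_le)
    show "(norm (?D x))\<^sup>2 \<le> (norm (\<Sum>k<n. 1 *\<^sub>R coord_proj k x))\<^sup>2"
      unfolding ap pyth using r
      by (intro sum_mono mult_right_mono) (auto simp: abs_square_le_1)
  qed simp
  have le1: "norm (\<Sum>k<n. 1 *\<^sub>R coord_proj k x) \<le> norm x" for x
  proof -
    let ?y = "\<Sum>k<n. 1 *\<^sub>R coord_proj k x"
    have "inner ?y ?y = (\<Sum>k<n. inner (coord_proj k x) ?y)" by (simp add: inner_sum_left)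
    also have "\<dots> = (\<Sum>k<n. inner x (coord_proj k x))"
    proof (rule sum.cong[OF refl])
      fix k assume "k \<in> {..<n}"
      then have "coord_proj k ?y = coord_proj k x"
        by (simp add: blinfun.bilinear_simps coord_proj_coord_proj)
      then show "inner (coord_proj k x) ?y = inner x (coord_proj k x)"
        by (simp only: coord_proj_sym)
    qed
    also have "\<dots> = inner x ?y" by (simp add: inner_sum_right)
    finally have "norm ?y * norm ?y \<le> norm x * norm ?y"
      using norm_cauchy_schwarz[of x ?y] by (simp add: dot_square_norm power2_eq_square)
    then show ?thesis by (cases "?y = 0") (auto dest: mult_right_le_imp_le)
  qed
  have "norm ?D \<le> 1" using le le1 by (intro norm_blinfun_bound) (auto intro: order_trans)
  then show ?thesis
    unfolding diagonal_def
    by (simp add: ap inner_sum_left inner_sum_right coord_proj_sym coord_proj_J coord_proj_P0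
        blinfun.bilinear_simps)
qed

lemma diagonal_convex:
  assumes D: "diagonal D" and s: "0 \<le> s" "s \<le> 1"
  shows "diagonal ((1 - s) *\<^sub>R D + s *\<^sub>R id_blinfun)"
proof -
  have "norm ((1 - s) *\<^sub>R D + s *\<^sub>R id_blinfun) \<le> 1"
  proof (rule norm_blinfun_bound)
    fix x
    have "norm (((1 - s) *\<^sub>R D + s *\<^sub>R id_blinfun) x) \<le> (1 - s) * norm (D x) + s * norm x"
      using s by (simp add: blinfun.bilinear_simps order_trans[OF norm_triangle_ineq])
    also have "\<dots> \<le> (1 - s) * norm x + s * norm x"
      using diagonalD(6)[OF D] s by (intro add_right_mono mult_left_mono) auto
    finally show "norm (((1 - s) *\<^sub>R D + s *\<^sub>R id_blinfun) x) \<le> 1 * norm x" by (simp add: algebra_simps)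
  qed simp
  then show ?thesis
    using diagonalD[OF D] unfolding diagonal_def
    by (simp add: blinfun.bilinear_simps inner_add_left inner_add_right)
qed

text \<open>1 - D^2 lies between 0 and 1, as \<open>D\<close> is a self-adjoint contraction. For the
  idempotent \<open>trunc n\<close> this operator is \<open>tail n\<close>.\<close>

lemma diagonal_defect_contraction:
  assumes D: "diagonal D"
  shows "norm (x - D (D x)) \<le> norm x"
proof (rule power2_le_imp_le)
  have "inner x (D (D x)) = inner (D x) (D x)" "inner (D (D x)) x = inner (D x) (D x)"
    using diagonalD(1)[OF D] by simp_all
  then have "(norm (x - D (D x)))\<^sup>2 = (norm x)\<^sup>2 - 2 * (norm (D x))\<^sup>2 + (norm (D (D x)))\<^sup>2"
    by (simp add: power2_norm_eq_inner inner_diff_left inner_diff_right)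
  also have "\<dots> \<le> (norm x)\<^sup>2"
    using power_mono[OF diagonalD(6)[OF D, of "D x"] norm_ge_zero, of 2] zero_le_power2[of "norm (D x)"]
    by linarith
  finally show "(norm (x - D (D x)))\<^sup>2 \<le> (norm x)\<^sup>2" .
qed simp

section \<open>Truncations and tails\<close>

definition trunc :: "nat \<Rightarrow> 'a \<Rightarrow>\<^sub>L 'a"
  where "trunc n = (\<Sum>k<n. coord_proj k)"

definition tail :: "nat \<Rightarrow> 'a \<Rightarrow>\<^sub>L 'a"
  where "tail n = id_blinfun - trunc n"

lemma tail_apply: "tail n x = x - trunc n x"
  by (simp add: tail_def blinfun.bilinear_simps)

lemma diagonal_trunc: "diagonal (trunc n)"
  using diagonal_coord_sum[of n "\<lambda>_. 1"] by (simp add: trunc_def)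

lemma trunc_apply: "trunc n x = (\<Sum>k<n. coord_proj k x)"
  by (simp add: trunc_def blinfun.bilinear_simps)

lemma coord_proj_trunc: "coord_proj k (trunc n x) = (if k < n then coord_proj k x else 0)"
  by (simp add: trunc_apply blinfun.bilinear_simps coord_proj_coord_proj)

lemma trunc_trunc: "trunc m (trunc n x) = trunc (min m n) x"
proof -
  have "trunc m (trunc n x) = (\<Sum>k<m. if k < n then coord_proj k x else 0)"
    unfolding trunc_apply[of m] by (simp add: coord_proj_trunc)
  also have "\<dots> = trunc (min m n) x"
    unfolding trunc_apply by (intro sum.mono_neutral_cong_right) auto
  finally show ?thesis .
qed

lemma trunc_e: "trunc n (e k) = (if k < n then e k else 0)" "trunc n (J (e k)) = (if k < n then J (e k) else 0)"
  by (simp_all add: trunc_apply coord_proj_apply e_ortho if_distrib[of "\<lambda>c. c *\<^sub>R _"] cong: if_cong)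

lemma diagonal_tail: "diagonal (tail n)"
proof -
  have "norm (tail n x) \<le> norm x" for x
    using diagonal_defect_contraction[OF diagonal_trunc, of x n] by (simp add: tail_apply trunc_trunc)
  then have "norm (tail n) \<le> 1" by (intro norm_blinfun_bound) auto
  then show ?thesis
    using diagonalD[OF diagonal_trunc[of n]] unfolding diagonal_def
    by (simp add: tail_apply blinfun.bilinear_simps inner_diff_left inner_diff_right)
qed

lemma tail_tail: "m \<le> n \<Longrightarrow> tail n (tail m x) = tail n x" "m \<le> n \<Longrightarrow> tail m (tail n x) = tail n x"
  by (simp_all add: tail_apply blinfun.bilinear_simps trunc_trunc min_def)

lemma norm_tail_antimono:
  assumes "m \<le> n" shows "norm (tail n o\<^sub>L B) \<le> norm (tail m o\<^sub>L B)"
proof (rule norm_blinfun_bound[OF norm_ge_zero])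
  fix x
  have "norm ((tail n o\<^sub>L B) x) = norm (tail n (tail m (B x)))" using assms by (simp add: tail_tail)
  also have "\<dots> \<le> norm ((tail m o\<^sub>L B) x)" using diagonalD(6)[OF diagonal_tail] by simp
  also have "\<dots> \<le> norm (tail m o\<^sub>L B) * norm x" by (rule norm_blinfun)
  finally show "norm ((tail n o\<^sub>L B) x) \<le> norm (tail m o\<^sub>L B) * norm x" .
qed

text \<open>The convergence is pointwise only. On the span of the basis the tails vanish eventually;
  the uniform bound 1 extends this to \<open>L\<^sub>0\<close>, and \<open>J\<close>, which commutes
  with the tails, to the rest.\<close>

lemma tail_tendsto_0: "(\<lambda>n. tail n x) \<longlonglongrightarrow> 0"
proof -
  have *: "(\<lambda>n. tail n x) \<longlonglongrightarrow> 0" if x: "P\<^sub>0 x = x" for x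
  proof (rule LIMSEQ_I)
    fix r :: real assume "r > 0"
    then obtain y where y: "y \<in> span (range e)" "dist y x < r"
      using e_dense[OF x] closure_approachable by blast
    have "\<exists>N. \<forall>n\<ge>N. tail n y = 0"
      using y(1)
    proof (induction rule: span_induct_alt)
      case (step c b z)
      then obtain N k where "\<And>n. n \<ge> N \<Longrightarrow> tail n z = 0" "b = e k" by auto
      then have "tail n (c *\<^sub>R b + z) = 0" if "n \<ge> max N (Suc k)" for n
        using that by (simp add: blinfun.bilinear_simps tail_apply trunc_e)
      then show ?case by blast
    qed (simp add: blinfun.bilinear_simps)
    then obtain N where N: "\<And>n. n \<ge> N \<Longrightarrow> tail n y = 0" by blast
    have "norm (tail n x - 0) < r" if "n \<ge> N" for n
    proof -
      have "tail n x = tail n (x - y)" using N[OF that] by (simp add: blinfun.bilinear_simps)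
      also have "norm \<dots> \<le> norm (x - y)" using diagonalD(6)[OF diagonal_tail] .
      also have "\<dots> < r" using y(2) by (simp add: dist_norm norm_minus_commute)
      finally show ?thesis by simp
    qed
    then show "\<exists>no. \<forall>n\<ge>no. norm (tail n x - 0) < r" by blast
  qed
  define y where "y = - J (x - P\<^sub>0 x)"
  have "P\<^sub>0 y = y" by (simp add: y_def blinfun.bilinear_simps P0_J)
  have x: "x = P\<^sub>0 x + J y" by (simp add: y_def blinfun.bilinear_simps)
  have "(\<lambda>n. tail n (P\<^sub>0 x) + J (tail n y)) \<longlonglongrightarrow> 0 + J 0"
    by (intro tendsto_intros * blinfun.tendsto) (simp_all add: \<open>P\<^sub>0 y = y\<close>)
  moreover have "tail n (P\<^sub>0 x) + J (tail n y) = tail n x" for n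
    by (subst (2) x) (simp add: blinfun.bilinear_simps diagonalD(2)[OF diagonal_tail])
  ultimately show ?thesis by (simp add: blinfun.bilinear_simps)
qed

text \<open>The orthogonal projection \<open>P\<close> onto a Lagrangian is encoded by \<open>B = P - (1 - P\<^sub>0)\<close>. The point of
  the shift is that the base point \<open>J L\<^sub>0\<close>, which is transversal to \<open>L\<^sub>0\<close>, becomes \<open>0\<close>. In terms of
  \<open>c = conjg\<close> the condition \<open>P\<^sup>2 = P\<close> reads \<open>2 B\<^sup>2 = B c + c B\<close>.\<close>

definition lag_ops :: "('a \<Rightarrow>\<^sub>L 'a) set"
  where "lag_ops = {B :: 'a \<Rightarrow>\<^sub>L 'a. (\<forall>x y. inner (B x) y = inner x (B y)) \<and> (\<forall>x. B (J x) = - J (B x)) \<and>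
    (\<forall>x y. 2 * inner (B x) (B y) = inner (B x) (conjg y) + inner (conjg x) (B y))}"

lemma lag_opsD:
  assumes "B \<in> lag_ops"
  shows "inner (B x) y = inner x (B y)" "B (J x) = - J (B x)"
    "2 * inner (B x) (B y) = inner (B x) (conjg y) + inner (conjg x) (B y)"
  using assms by (auto simp: lag_ops_def)

text \<open>Here c - B is the difference \<open>P\<^sub>0\<close> - P of the two projections. So B
  contracts strictly where this difference is bounded below, which is the link with Fredholm
  pairs.\<close>

lemma lag_ops_norm:
  assumes "B \<in> lag_ops"
  shows "(norm (B x))\<^sup>2 = (norm x)\<^sup>2 - (norm (conjg x - B x))\<^sup>2"
  using lag_opsD(3)[OF assms, of x x]
  by (simp add: power2_norm_eq_inner inner_diff_left inner_diff_right inner_commute)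

definition defect :: "('a \<Rightarrow>\<^sub>L 'a) \<Rightarrow> ('a \<Rightarrow>\<^sub>L 'a) \<Rightarrow> 'a \<Rightarrow>\<^sub>L 'a"
  where "defect D B = (id_blinfun - (D o\<^sub>L D)) o\<^sub>L (conjg o\<^sub>L B)"

text \<open>If the Lagrangian is the graph of a symmetric operator \<open>A\<close> from \<open>J L\<^sub>0\<close> to \<open>L\<^sub>0\<close>, its image
  under \<open>D\<close> is the graph of \<open>D A D\<close>; the formula stays meaningful when \<open>A\<close> has poles.\<close>

definition compress :: "('a \<Rightarrow>\<^sub>L 'a) \<Rightarrow> ('a \<Rightarrow>\<^sub>L 'a) \<Rightarrow> 'a \<Rightarrow>\<^sub>L 'a"
  where "compress D B = D o\<^sub>L (B o\<^sub>L (neumann (defect D B) o\<^sub>L D))"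

lemma defect_apply: "defect D B x = conjg (B x) - D (D (conjg (B x)))"
  by (simp add: defect_def blinfun.bilinear_simps)

lemma compress_apply: "compress D B x = D (B (neumann (defect D B) (D x)))"
  by (simp add: compress_def)

lemma compress_id [simp]: "compress id_blinfun B = B"
proof -
  have "defect id_blinfun B = 0" by (rule blinfun_eqI) (simp add: defect_apply)
  moreover have "neumann 0 x = x" for x :: 'a using neumann_right[of 0 x] by simp
  ultimately show ?thesis by (intro blinfun_eqI) (simp add: compress_apply)
qed

text \<open>With a = M x the inverse disappears: x = a - (1 - D^2) c B a. After this substitution,
  and the same one for y, symmetry and the quadratic identity become polynomial identities in B, c
  and D that follow from those of B.\<close>

lemma
  assumes D: "diagonal D" and B: "B \<in> lag_ops" and n: "norm (defect D B) < 1"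
  shows neumann_defect_sym:
      "inner (B (neumann (defect D B) x)) y = inner x (B (neumann (defect D B) y))"
    and compress_in_lag_ops: "compress D B \<in> lag_ops"
proof -
  let ?M = "neumann (defect D B)"
  note Dd = diagonalD[OF D]
  note Bd = lag_opsD[OF B]
  have M: "x = ?M x - (conjg (B (?M x)) - D (D (conjg (B (?M x)))))" for x
    using neumann_right[OF n, of x] by (simp add: defect_apply)
  have DD: "inner (D (D u)) v = inner u (D (D v))" for u v by (simp add: Dd(1))
  have sym: "inner (B (?M x)) y = inner x (B (?M y))" for x y
  proof -
    define a b where "a = ?M x" and "b = ?M y"
    have "inner (B a) (b - (conjg (B b) - D (D (conjg (B b))))) = inner (a - (conjg (B a) - D (D (conjg (B a))))) (B b)"
      by (simp add: inner_diff_left inner_diff_right Bd(1) conjg_sym DD Dd(4))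
    then show ?thesis using M[of x] M[of y] by (simp only: a_def b_def)
  qed
  then show "inner (B (?M x)) y = inner x (B (?M y))" .
  have comm: "?M (J x) = J (?M x)" for x
  proof -
    have "J x = J (?M x) - defect D B (J (?M x))"
      using arg_cong[OF neumann_right[OF n, of x], of J]
      by (simp add: defect_apply blinfun.bilinear_simps Bd conjg_J Dd)
    then show ?thesis using neumann_left[OF n, of "J (?M x)"] by simp
  qed
  \<comment> \<open>Not yet the identity of \<open>lag_ops\<close>: it will be applied to
    \<open>D x\<close> and \<open>D y\<close>, and the inner \<open>D\<close> is then moved across
    the inner product.\<close>
  have quad: "2 * inner (D (B (?M x))) (D (B (?M y))) = inner (B (?M x)) (conjg y) + inner (conjg x) (B (?M y))"
    for x y
  proof -
    define a b where "a = ?M x" and "b = ?M y"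
    have "inner (B a) (conjg (b - (conjg (B b) - D (D (conjg (B b)))))) +
        inner (conjg (a - (conjg (B a) - D (D (conjg (B a)))))) (B b)
      = (inner (B a) (conjg b) + inner (conjg a) (B b)) - 2 * inner (B a) (B b) + 2 * inner (B a) (D (D (B b)))"
      by (simp add: inner_diff_left inner_diff_right blinfun.bilinear_simps Dd(4) DD)
    also have "\<dots> = 2 * inner (D (B a)) (D (B b))"
      by (simp add: Bd(3)[symmetric] Dd(1))
    finally show ?thesis using M[of x] M[of y] by (simp only: a_def b_def)
  qed
  show "compress D B \<in> lag_ops"
    unfolding lag_ops_def
  proof (intro CollectI conjI allI)
    fix x y
    show "inner (compress D B x) y = inner x (compress D B y)"
      by (simp add: compress_apply Dd(1) sym)
    show "compress D B (J x) = - J (compress D B x)"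
      by (simp add: compress_apply Dd(2) comm Bd(2) blinfun.bilinear_simps)
    show "2 * inner (compress D B x) (compress D B y) =
        inner (compress D B x) (conjg y) + inner (conjg x) (compress D B y)"
      by (simp add: compress_apply quad) (simp add: Dd(1,4) Dd(1)[symmetric])
  qed
qed

text \<open>\<open>D\<close> is the identity on the first n coordinates, so 1 - D^2 sees only the
  tail of c B x, and there it is a contraction. This is what makes the inverse in the compression
  available.\<close>

lemma norm_defect_le:
  assumes D: "diagonal D" and "\<And>x. D (trunc n x) = trunc n x"
  shows "norm (defect D B) \<le> norm (tail n o\<^sub>L B)"
proof (rule norm_blinfun_bound[OF norm_ge_zero])
  fix x
  let ?y = "conjg (B x)"
  have "?y = tail n ?y + trunc n ?y" by (simp add: tail_apply)
  moreover have "D (D (trunc n ?y)) = trunc n ?y" by (simp add: assms(2))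
  ultimately have "defect D B x = tail n ?y - D (D (tail n ?y))"
    unfolding defect_apply by (smt (verit) add_diff_add blinfun.add_right diff_self add.right_neutral)
  also have "norm \<dots> \<le> norm (tail n ?y)" by (rule diagonal_defect_contraction[OF D])
  also have "\<dots> = norm ((tail n o\<^sub>L B) x)" by (simp add: diagonalD(4)[OF diagonal_tail])
  also have "\<dots> \<le> norm (tail n o\<^sub>L B) * norm x" by (rule norm_blinfun)
  finally show "norm (defect D B x) \<le> norm (tail n o\<^sub>L B) * norm x" .
qed

definition fredholm_ops :: "('a \<Rightarrow>\<^sub>L 'a) set"
  where "fredholm_ops = {B \<in> lag_ops. \<exists>n. norm (tail n o\<^sub>L B) < 1}"

text \<open>By \<open>lag_ops_norm\<close> the lower bound on the tail reads |B x|^2 \<le> (1 -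
  \<delta>^2) |x|^2 there; symmetry of B exchanges the order of B and \<open>tail n\<close>.\<close>

lemma fredholm_opsI:
  assumes B: "B \<in> lag_ops" and "\<delta> > 0"
    and bound: "\<And>x. tail n x = x \<Longrightarrow> \<delta> * norm x \<le> norm (conjg x - B x)"
  shows "B \<in> fredholm_ops"
proof -
  have \<delta>: "\<delta>\<^sup>2 * (norm x)\<^sup>2 \<le> (norm (conjg x - B x))\<^sup>2" if "tail n x = x" for x
    using power_mono[OF bound[OF that], of 2] \<open>\<delta> > 0\<close> by (simp add: power_mult_distrib)
  \<comment> \<open>The assumptions do not exclude \<delta> > 1, hence the maximum with 0.\<close>
  define q where "q = sqrt (max 0 (1 - \<delta>\<^sup>2))"
  have q: "q < 1" "q \<ge> 0" using \<open>\<delta> > 0\<close> by (auto simp: q_def)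
  have "norm (B o\<^sub>L tail n) \<le> q"
  proof (rule norm_blinfun_bound[OF q(2)])
    fix x
    let ?y = "tail n x"
    have y: "tail n ?y = ?y" by (simp add: tail_tail)
    have "(norm (B ?y))\<^sup>2 = (norm ?y)\<^sup>2 - (norm (conjg ?y - B ?y))\<^sup>2" by (rule lag_ops_norm[OF B])
    also have "\<dots> \<le> (1 - \<delta>\<^sup>2) * (norm ?y)\<^sup>2" using \<delta>[OF y] by (simp add: algebra_simps)
    also have "\<dots> \<le> max 0 (1 - \<delta>\<^sup>2) * (norm ?y)\<^sup>2" by (intro mult_right_mono) auto
    also have "\<dots> \<le> max 0 (1 - \<delta>\<^sup>2) * (norm x)\<^sup>2"
      using diagonalD(6)[OF diagonal_tail, of n x] by (intro mult_left_mono power_mono) auto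
    finally have "(norm (B ?y))\<^sup>2 \<le> (q * norm x)\<^sup>2" by (simp add: power_mult_distrib q_def)
    then show "norm ((B o\<^sub>L tail n) x) \<le> q * norm x"
      using q(2) by (auto intro: power2_le_imp_le)
  qed
  moreover have "norm (tail n o\<^sub>L B) \<le> norm (B o\<^sub>L tail n)"
    by (rule norm_le_of_adjoint) (simp add: lag_opsD(1)[OF B] diagonalD(1)[OF diagonal_tail])
  ultimately have "norm (tail n o\<^sub>L B) < 1" using q(1) by linarith
  then show ?thesis using B by (auto simp: fredholm_ops_def)
qed

text \<open>For s = 0, \<open>tail m\<close> annihilates the range of \<open>D\<close> and hence
  that of the compression. Otherwise put a = M D x; then D (c x - compress D B x) = c a - B a, which
  carries a lower bound for c - B over to the compression. That bound holds up to
  \<open>trunc k (B a)\<close>, which depends on x through an operator of finite rank and so is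
  small for x in a far tail.\<close>

lemma compress_in_fredholm_ops:
  assumes D: "diagonal D" and B: "B \<in> fredholm_ops" and n: "norm (defect D B) < 1"
    and s: "\<And>x. tail m x = x \<Longrightarrow> D x = s *\<^sub>R x"
  shows "compress D B \<in> fredholm_ops"
proof (cases "s = 0")
  case True
  have BL: "B \<in> lag_ops" using B by (simp add: fredholm_ops_def)
  have "D (tail m x) = 0" for x using s[of "tail m x"] True by (simp add: tail_tail)
  then have "inner (tail m (D x)) y = 0" for x y
    by (simp add: diagonalD(1)[OF diagonal_tail] diagonalD(1)[OF D])
  then have "tail m (D x) = 0" for x by (metis inner_eq_zero_iff)
  then have "tail m o\<^sub>L compress D B = 0" by (intro blinfun_eqI) (simp add: compress_apply)
  then have "norm (tail m o\<^sub>L compress D B) < 1" by simp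
  then show ?thesis using compress_in_lag_ops[OF D BL n] by (auto simp: fredholm_ops_def)
next
  case False
  obtain k where BL: "B \<in> lag_ops" and k: "norm (tail k o\<^sub>L B) < 1"
    using B by (auto simp: fredholm_ops_def)
  let ?M = "neumann (defect D B)"
  define q where "q = norm (tail k o\<^sub>L B)"
  \<comment> \<open>1 - q bounds c - B from below modulo finite rank, and |s| / 2 bounds |a| / |x|
    from below, since |D x| = |s| |x| is at most 2 |a|.\<close>
  define \<delta> where "\<delta> = (1 - q) * (\<bar>s\<bar> / 2)"
  have \<delta>: "\<delta> > 0" using k False by (simp add: \<delta>_def q_def)
  \<comment> \<open>By symmetry of B M and D the components of \<open>B a\<close> are inner products
    of x with fixed vectors; for x in the tail from i on, only the tails of these vectors
    count.\<close>
  define \<epsilon> where "\<epsilon> i = (\<Sum>j<k. norm (tail i (D (B (?M (e j))))) + norm (tail i (D (B (?M (J (e j)))))))" for i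
  have "\<epsilon> \<longlonglongrightarrow> (\<Sum>j<k. 0 + 0)"
    unfolding \<epsilon>_def by (intro tendsto_sum tendsto_add tendsto_norm_zero tail_tendsto_0)
  then have "\<forall>\<^sub>F i in sequentially. \<epsilon> i < \<delta> / 2"
    using \<delta> by (intro order_tendstoD(2)) auto
  then obtain i where i: "\<epsilon> i < \<delta> / 2" "i \<ge> m" "i \<ge> k"
    by (metis (mono_tags, lifting) eventually_sequentially linorder_linear order_trans)
  show ?thesis
  proof (rule fredholm_opsI[OF compress_in_lag_ops[OF D BL n], of "\<delta> / 2" i])
    show "0 < \<delta> / 2" using \<delta> by simp
    fix x assume x: "tail i x = x"
    then have "tail m x = x" using tail_tail(2)[OF i(2), of x] by simp
    then have Dx: "D x = s *\<^sub>R x" by (rule s)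
    define a where "a = ?M (D x)"
    have a: "D x = a - (conjg (B a) - D (D (conjg (B a))))"
      using neumann_right[OF n, of "D x"] by (simp add: defect_apply a_def)
    have key: "D (conjg x - compress D B x) = conjg a - B a"
    proof -
      have "D (conjg x - compress D B x) = conjg (D x) - D (D (B a))"
        by (simp add: blinfun.bilinear_simps diagonalD(4)[OF D] compress_apply a_def)
      also have "conjg (D x) = conjg a - B a + D (D (B a))"
        by (subst a) (simp add: blinfun.bilinear_simps diagonalD(4)[OF D, symmetric])
      finally show ?thesis by simp
    qed
    have small: "norm (trunc k (B a)) \<le> \<epsilon> i * norm x"
    proof -
      have f: "\<bar>inner v (B a)\<bar> \<le> norm (tail i (D (B (?M v)))) * norm x" for v
      proof -
        have "inner v (B a) = inner (D (B (?M v))) x"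
          unfolding a_def by (metis diagonalD(1)[OF D] neumann_defect_sym[OF D BL n])
        also have "\<dots> = inner (tail i (D (B (?M v)))) x"
          by (simp add: diagonalD(1)[OF diagonal_tail] x)
        finally show ?thesis by (simp add: Cauchy_Schwarz_ineq2)
      qed
      have "norm (trunc k (B a)) \<le> (\<Sum>j<k. norm (coord_proj j (B a)))"
        unfolding trunc_apply by (rule norm_sum)
      also have "\<dots> \<le> (\<Sum>j<k. (norm (tail i (D (B (?M (e j))))) + norm (tail i (D (B (?M (J (e j))))))) * norm x)"
      proof (rule sum_mono)
        fix j
        have "norm (coord_proj j (B a)) \<le> \<bar>inner (e j) (B a)\<bar> * norm (e j) + \<bar>inner (J (e j)) (B a)\<bar> * norm (J (e j))"
          unfolding coord_proj_apply by (rule order_trans[OF norm_triangle_ineq]) simp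
        also have "\<dots> = \<bar>inner (e j) (B a)\<bar> + \<bar>inner (J (e j)) (B a)\<bar>"
          by (simp add: norm_eq_sqrt_inner e_ortho)
        also have "\<dots> \<le> (norm (tail i (D (B (?M (e j))))) + norm (tail i (D (B (?M (J (e j))))))) * norm x"
          using f[of "e j"] f[of "J (e j)"] by (simp add: algebra_simps)
        finally show "norm (coord_proj j (B a)) \<le> \<dots>" .
      qed
      also have "\<dots> = \<epsilon> i * norm x" by (simp add: \<epsilon>_def sum_distrib_right)
      finally show ?thesis .
    qed
    have "\<bar>s\<bar> * norm x = norm (D x)" by (simp add: Dx)
    also have "\<dots> \<le> norm a + norm (defect D B a)"
      unfolding a defect_apply by (rule norm_triangle_ineq4)
    also have "\<dots> \<le> norm a + 1 * norm a"
      using norm_blinfun[of "defect D B" a] mult_right_mono[of "norm (defect D B)" 1 "norm a"] n by simp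
    finally have "\<bar>s\<bar> / 2 * norm x \<le> norm a" by simp
    then have "\<delta> * norm x \<le> (1 - q) * norm a"
      using k by (simp add: \<delta>_def q_def mult.assoc mult_left_mono)
    also have "\<dots> = norm a - q * norm a" by (simp add: algebra_simps)
    also have "\<dots> \<le> norm a - norm (tail k (B a))"
      using norm_blinfun[of "tail k o\<^sub>L B" a] by (simp add: q_def)
    also have "\<dots> \<le> norm (conjg a - B a) + norm (trunc k (B a))"
    proof -
      have "norm (conjg a) \<le> norm (conjg a - B a) + norm (B a)" by (metis diff_add_cancel norm_triangle_ineq)
      moreover have "norm (B a) \<le> norm (tail k (B a)) + norm (trunc k (B a))"
        by (metis tail_apply diff_add_cancel norm_triangle_ineq)
      ultimately show ?thesis by simp
    qed
    also have "\<dots> \<le> norm (conjg x - compress D B x) + \<epsilon> i * norm x"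
      using small diagonalD(6)[OF D, of "conjg x - compress D B x"] by (simp add: key)
    finally have "\<delta> * norm x - \<epsilon> i * norm x \<le> norm (conjg x - compress D B x)" by simp
    moreover have "\<epsilon> i * norm x \<le> \<delta> / 2 * norm x" using i(1) by (intro mult_right_mono) auto
    ultimately show "\<delta> / 2 * norm x \<le> norm (conjg x - compress D B x)" by (simp add: algebra_simps)
  qed
qed

section \<open>Deformation onto the finite stages\<close>

text \<open>The weights fall below \<open>1\<close> only from an index \<open>k\<close> with \<open>\<parallel>tail k \<circ> B\<parallel> < 1\<close> on, and they vanish
  eventually, although the limit of \<open>\<parallel>tail k \<circ> B\<parallel>\<close> can be any number below \<open>1\<close>.\<close>

definition weight :: "nat \<Rightarrow> ('a \<Rightarrow>\<^sub>L 'a) \<Rightarrow> real"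
  where "weight k B = min 1 (max 0 (real k * (norm (tail k o\<^sub>L B) - 1) + 2))"

text \<open>On this open set every weight from m on vanishes, which bounds the rank of the cutoff
  locally. The 2 is the constant in \<open>weight\<close>: the condition says that the m-th weight
  is negative before it is clamped.\<close>

definition patch :: "nat \<Rightarrow> ('a \<Rightarrow>\<^sub>L 'a) set"
  where "patch m = {B. 2 < real m * (1 - norm (tail m o\<^sub>L B))}"

text \<open>Summing over the nonzero weights avoids the choice of a patch. Only arguments in some
  patch matter, and for these the index set is finite.\<close>

definition cutoff :: "('a \<Rightarrow>\<^sub>L 'a) \<Rightarrow> 'a \<Rightarrow>\<^sub>L 'a"
  where "cutoff B = (\<Sum>k | weight k B \<noteq> 0. weight k B *\<^sub>R coord_proj k)"

definition cutoff_path :: "real \<Rightarrow> ('a \<Rightarrow>\<^sub>L 'a) \<Rightarrow> 'a \<Rightarrow>\<^sub>L 'a"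
  where "cutoff_path s B = (1 - s) *\<^sub>R cutoff B + s *\<^sub>R id_blinfun"

lemma continuous_on_norm_tail: "continuous_on A (\<lambda>B. norm (tail k o\<^sub>L B))"
  by (intro continuous_intros bounded_linear.continuous_on[OF
      bounded_bilinear.bounded_linear_right[OF bounded_bilinear_blinfun_compose]])

lemma open_patch: "open (patch m)"
  unfolding patch_def by (intro open_Collect_less continuous_intros continuous_on_norm_tail)

text \<open>The product of k with the gap \<open>1 - norm (tail k o\<^sub>L B)\<close> increases
  from m on, both factors being increasing and nonnegative.\<close>

lemma weight_0_of_patch:
  assumes B: "B \<in> patch m" and "m \<le> k"
  shows "weight k B = 0"
proof -
  have "1 - norm (tail m o\<^sub>L B) \<le> 1 - norm (tail k o\<^sub>L B)" using norm_tail_antimono[OF assms(2)] by simp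
  moreover have "0 \<le> 1 - norm (tail m o\<^sub>L B)"
    using B by (smt (verit) mem_Collect_eq mult_nonneg_nonpos of_nat_0_le_iff patch_def)
  ultimately have "real m * (1 - norm (tail m o\<^sub>L B)) \<le> real k * (1 - norm (tail k o\<^sub>L B))"
    using assms(2) by (intro mult_mono) auto
  then have "2 < real k * (1 - norm (tail k o\<^sub>L B))" using B by (simp add: patch_def)
  then show ?thesis by (simp add: weight_def algebra_simps)
qed

lemma cutoff_eq: "B \<in> patch m \<Longrightarrow> cutoff B = (\<Sum>k<m. weight k B *\<^sub>R coord_proj k)"
  unfolding cutoff_def using weight_0_of_patch
  by (intro sum.mono_neutral_left) (auto simp: not_less[symmetric])

lemma fredholm_ops_patch:
  assumes "B \<in> fredholm_ops"
  obtains m where "B \<in> patch m"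
proof -
  obtain n where n: "norm (tail n o\<^sub>L B) < 1" using assms by (auto simp: fredholm_ops_def)
  obtain m0 where m0: "2 / (1 - norm (tail n o\<^sub>L B)) < real m0" using reals_Archimedean2 by blast
  define m where "m = max m0 n"
  have "2 < real m0 * (1 - norm (tail n o\<^sub>L B))" using m0 n by (simp add: field_simps)
  also have "\<dots> \<le> real m * (1 - norm (tail m o\<^sub>L B))"
    using norm_tail_antimono[of n m B] n by (intro mult_mono) (auto simp: m_def)
  finally show thesis using that by (simp add: patch_def)
qed

lemma weight_le_1: "\<bar>weight k B\<bar> \<le> 1"
  by (auto simp: weight_def)

lemma continuous_on_cutoff: "continuous_on (\<Union>m. patch m) cutoff"
proof (rule continuous_on_open_UN)
  fix m
  have "continuous_on (patch m) (\<lambda>B. \<Sum>k<m. weight k B *\<^sub>R coord_proj k)"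
    unfolding weight_def by (intro continuous_intros continuous_on_norm_tail)
  then show "continuous_on (patch m) cutoff"
    by (rule continuous_on_eq) (simp add: cutoff_eq)
qed (rule open_patch)

lemma cutoff_path_0 [simp]: "cutoff_path 0 B = cutoff B"
  by (simp add: cutoff_path_def)

lemma cutoff_path_1 [simp]: "cutoff_path 1 B = id_blinfun"
  by (simp add: cutoff_path_def)

lemma cutoff_apply: "B \<in> patch m \<Longrightarrow> cutoff B x = (\<Sum>k<m. weight k B *\<^sub>R coord_proj k x)"
  by (simp add: cutoff_eq blinfun.bilinear_simps)

lemma diagonal_cutoff_path:
  assumes B: "B \<in> fredholm_ops" and s: "0 \<le> s" "s \<le> 1"
  shows "diagonal (cutoff_path s B)"
proof -
  obtain m where "B \<in> patch m" using fredholm_ops_patch[OF B] by blast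
  then have "diagonal (cutoff B)"
    using diagonal_coord_sum[of m "\<lambda>k. weight k B"] weight_le_1 by (simp add: cutoff_eq)
  then show ?thesis unfolding cutoff_path_def using s by (rule diagonal_convex)
qed

text \<open>Supplies the scalar that \<open>compress_in_fredholm_ops\<close> asks for.\<close>

lemma cutoff_path_tail:
  assumes "B \<in> patch m" "tail m x = x"
  shows "cutoff_path s B x = s *\<^sub>R x"
proof -
  have "coord_proj k x = 0" if "k < m" for k
    using that assms(2)[symmetric] coord_proj_trunc[of k m x]
    by (metis blinfun.diff_right diff_self tail_apply)
  then have "cutoff B x = 0" by (simp add: cutoff_apply[OF assms(1)])
  then show ?thesis by (simp add: cutoff_path_def blinfun.bilinear_simps)
qed

text \<open>Let i be the first index with weight below 1. All earlier weights are 1, so the cutoff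
  fixes the first i coordinates, and \<open>norm_defect_le\<close> reduces the claim to the tail
  from i on. There the weight itself certifies a norm below 1: otherwise it would be min 1 of a
  number that is at least 2.\<close>

lemma norm_defect_cutoff_path:
  assumes B: "B \<in> fredholm_ops" and s: "0 \<le> s" "s \<le> 1"
  shows "norm (defect (cutoff_path s B) B) < 1"
proof -
  obtain m where m: "B \<in> patch m" using fredholm_ops_patch[OF B] by blast
  define i where "i = (LEAST k. weight k B < 1)"
  have ex: "weight m B < 1" using weight_0_of_patch[OF m] by simp
  then have i: "weight i B < 1" "i \<le> m" unfolding i_def by (auto intro: LeastI Least_le)
  have one: "weight k B = 1" if "k < i" for k
    using not_less_Least[of k "\<lambda>k. weight k B < 1"] that weight_le_1[of k B] by (simp add: i_def)
  have "cutoff B (trunc i x) = trunc i x" for x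
  proof -
    have "cutoff B (trunc i x) = (\<Sum>k<m. if k < i then coord_proj k x else 0)"
      unfolding cutoff_apply[OF m] by (intro sum.cong) (auto simp: coord_proj_trunc one)
    also have "\<dots> = trunc i x"
      unfolding trunc_apply using i(2) by (intro sum.mono_neutral_cong_right) auto
    finally show ?thesis .
  qed
  then have "cutoff_path s B (trunc i x) = trunc i x" for x
    by (simp add: cutoff_path_def blinfun.bilinear_simps algebra_simps)
  then have "norm (defect (cutoff_path s B) B) \<le> norm (tail i o\<^sub>L B)"
    by (rule norm_defect_le[OF diagonal_cutoff_path[OF B s]])
  moreover have "norm (tail i o\<^sub>L B) < 1"
  proof (rule ccontr)
    assume "\<not> ?thesis"
    then have "0 \<le> real i * (norm (tail i o\<^sub>L B) - 1)" by simp
    then show False using i(1) by (simp add: weight_def)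
  qed
  ultimately show ?thesis by linarith
qed

text \<open>By symmetry such a B also kills the tail: the Lagrangian agrees with
  \<open>J L\<^sub>0\<close> outside the first n complex coordinates.\<close>

definition stage :: "nat \<Rightarrow> ('a \<Rightarrow>\<^sub>L 'a) set"
  where "stage n = {B \<in> lag_ops. \<forall>x. trunc n (B x) = B x}"

lemma stage_subset: "stage n \<subseteq> fredholm_ops"
proof
  fix B assume B: "B \<in> stage n"
  then have "tail n o\<^sub>L B = 0" by (intro blinfun_eqI) (simp add: stage_def tail_apply)
  then have "norm (tail n o\<^sub>L B) < 1" by simp
  then show "B \<in> fredholm_ops" using B by (auto simp: fredholm_ops_def stage_def)
qed

lemma compress_cutoff_path_fredholm:
  assumes B: "B \<in> fredholm_ops" and s: "0 \<le> s" "s \<le> 1"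
  shows "compress (cutoff_path s B) B \<in> fredholm_ops"
proof -
  obtain m where "B \<in> patch m" using fredholm_ops_patch[OF B] by blast
  from compress_in_fredholm_ops[OF diagonal_cutoff_path[OF B s] B norm_defect_cutoff_path[OF B s] cutoff_path_tail[OF this]]
  show ?thesis by blast
qed

lemma compress_cutoff_path_lag_ops:
  assumes B: "B \<in> fredholm_ops" and s: "0 \<le> s" "s \<le> 1"
  shows "compress (cutoff_path s B) B \<in> lag_ops"
  using compress_cutoff_path_fredholm[OF assms] by (simp add: fredholm_ops_def)

text \<open>\<open>cutoff_path\<close> commutes with truncations, so the homotopy preserves every
  stage; this gives its continuity in the colimit topology.\<close>

lemma compress_cutoff_path_stage:
  assumes B: "B \<in> stage n" and s: "0 \<le> s" "s \<le> 1"
  shows "compress (cutoff_path s B) B \<in> stage n"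
proof -
  have BF: "B \<in> fredholm_ops" using B stage_subset by blast
  obtain m where m: "B \<in> patch m" using fredholm_ops_patch[OF BF] by blast
  have "trunc n (cutoff B x) = cutoff B (trunc n x)" for x
  proof -
    have "trunc n (coord_proj k x) = coord_proj k (trunc n x)" for k
      by (simp add: trunc_apply blinfun.bilinear_simps coord_proj_coord_proj)
    then show ?thesis by (simp add: cutoff_apply[OF m] blinfun.bilinear_simps)
  qed
  then have "trunc n (cutoff_path s B x) = cutoff_path s B (trunc n x)" for x
    by (simp add: cutoff_path_def blinfun.bilinear_simps)
  then show ?thesis
    using compress_cutoff_path_lag_ops[OF BF s] B by (simp add: stage_def compress_apply)
qed

lemma compress_cutoff_stage:
  assumes B: "B \<in> fredholm_ops" "B \<in> patch m"
  shows "compress (cutoff B) B \<in> stage m"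
proof -
  have "trunc m (cutoff B x) = cutoff B x" for x
    by (simp add: cutoff_apply[OF B(2)] trunc_apply blinfun.bilinear_simps coord_proj_coord_proj
        if_distrib[of "\<lambda>z. _ *\<^sub>R z"] cong: if_cong)
  then show ?thesis
    using compress_cutoff_path_lag_ops[OF B(1), of 0] by (simp add: stage_def compress_apply)
qed

lemma continuous_on_compress_cutoff_path:
  "continuous_on ({0..1} \<times> fredholm_ops) (\<lambda>(s, B). compress (cutoff_path s B) B)"
proof -
  let ?S = "{0..1} \<times> fredholm_ops"
  note comp = bounded_bilinear.continuous_on[OF bounded_bilinear_blinfun_compose]
  have sub: "fredholm_ops \<subseteq> (\<Union>m. patch m)" using fredholm_ops_patch by blast
  have c: "continuous_on ?S (\<lambda>p. cutoff (snd p))"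
    by (rule continuous_on_compose2[OF continuous_on_cutoff continuous_on_snd[OF continuous_on_id]])
      (use sub in auto)
  then have p: "continuous_on ?S (\<lambda>p. cutoff_path (fst p) (snd p))"
    unfolding cutoff_path_def by (intro continuous_intros)
  have d: "continuous_on ?S (\<lambda>p. defect (cutoff_path (fst p) (snd p)) (snd p))"
    unfolding defect_def by (intro comp continuous_intros p)
  have n: "continuous_on ?S (\<lambda>p. neumann (defect (cutoff_path (fst p) (snd p)) (snd p)))"
    by (rule continuous_on_compose2[OF continuous_on_neumann d]) (auto simp: norm_defect_cutoff_path)
  have "continuous_on ?S (\<lambda>p. compress (cutoff_path (fst p) (snd p)) (snd p))"
    unfolding compress_def by (intro comp p n continuous_intros)
  then show ?thesis by (simp add: case_prod_unfold)
qed

abbreviation stages :: "('a \<Rightarrow>\<^sub>L 'a) topology"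
  where "stages \<equiv> colimit_topology (\<lambda>n. top_of_set (stage n))"

text \<open>Norm continuity alone is not enough for the finer colimit topology. But on the open set
  \<open>patch m\<close> the map lands in the single stage m, and an open set of the colimit meets
  that stage in a norm open subset of it.\<close>

lemma continuous_map_cutoff_stages:
  "continuous_map (top_of_set fredholm_ops) stages (\<lambda>B. compress (cutoff B) B)"
  unfolding continuous_map_def
proof (intro conjI allI impI)
  let ?g = "\<lambda>B. compress (cutoff B) B"
  show "?g \<in> topspace (top_of_set fredholm_ops) \<rightarrow> topspace stages"
  proof
    fix B assume "B \<in> topspace (top_of_set fredholm_ops)"
    then have B: "B \<in> fredholm_ops" by simp
    then obtain m where "B \<in> patch m" using fredholm_ops_patch by blast
    then have "?g B \<in> stage m" using B by (rule compress_cutoff_stage[rotated])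
    then show "?g B \<in> topspace stages" by (auto simp: topspace_colimit_topology)
  qed
  have cont: "continuous_on fredholm_ops ?g"
  proof -
    have "continuous_on fredholm_ops (\<lambda>B. (0 :: real, B))" by (intro continuous_intros)
    moreover have "Pair 0 ` fredholm_ops \<subseteq> {0..1::real} \<times> fredholm_ops" by auto
    ultimately show ?thesis
      using continuous_on_compose2[OF continuous_on_compress_cutoff_path, of fredholm_ops "Pair 0"] by simp
  qed
  fix W assume W: "openin stages W"
  let ?V = "{B \<in> topspace (top_of_set fredholm_ops). ?g B \<in> W}"
  show "openin (top_of_set fredholm_ops) ?V"
  proof (subst openin_subopen, clarify)
    fix B assume B: "B \<in> topspace (top_of_set fredholm_ops)" "?g B \<in> W"
    then obtain m where m: "B \<in> patch m" using fredholm_ops_patch by auto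
    let ?P = "fredholm_ops \<inter> patch m"
    have "openin (top_of_set (stage m)) (W \<inter> stage m)"
      using W by (auto simp: openin_colimit_topology)
    moreover have "continuous_on ?P ?g" using cont by (rule continuous_on_subset) simp
    moreover have "?g \<in> ?P \<rightarrow> stage m" using compress_cutoff_stage by blast
    ultimately have "openin (top_of_set ?P) (?P \<inter> ?g -` (W \<inter> stage m))"
      using continuous_openin_preimage by blast
    moreover have "openin (top_of_set fredholm_ops) ?P" by (simp add: open_patch openin_open_Int)
    ultimately have "openin (top_of_set fredholm_ops) (?P \<inter> ?g -` (W \<inter> stage m))"
      using openin_trans by blast
    moreover have "B \<in> ?P \<inter> ?g -` (W \<inter> stage m)"
      using B m compress_cutoff_stage by auto
    ultimately show "\<exists>T. openin (top_of_set fredholm_ops) T \<and> B \<in> T \<and> T \<subseteq> ?V" by auto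
  qed
qed

text \<open>One formula serves as homotopy for both composites, in norm on
  \<open>fredholm_ops\<close> and in the colimit topology on the stages; it ends at the identity by
  \<open>compress_id\<close>.\<close>

theorem fredholm_ops_homotopy_equivalent_stages:
  "top_of_set fredholm_ops homotopy_equivalent_space stages"
  unfolding homotopy_equivalent_space_def
proof (intro exI conjI)
  let ?X = "top_of_set fredholm_ops"
  let ?g = "\<lambda>B. compress (cutoff B) B"
  let ?h = "\<lambda>(s, B). compress (cutoff_path s B) B"
  show "continuous_map ?X stages ?g" by (rule continuous_map_cutoff_stages)
  show "continuous_map stages ?X id"
    by (intro continuous_map_from_colimit) (auto simp: continuous_on_id dest: subsetD[OF stage_subset])
  have "continuous_map (prod_topology (top_of_set {0..1}) ?X) ?X ?h"
    using continuous_on_compress_cutoff_path compress_cutoff_path_fredholm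
    by (auto simp: prod_topology_subtopology_eu)
  then show "homotopic_with (\<lambda>x. True) ?X ?X (id \<circ> ?g) id"
    unfolding homotopic_with_def by (intro exI[of _ ?h]) auto
  have "continuous_map (prod_topology (top_of_set {0..1}) stages) stages ?h"
  proof (rule continuous_map_homotopy_from_colimit)
    fix n
    have "continuous_on ({0..1} \<times> stage n) ?h"
      using continuous_on_compress_cutoff_path by (rule continuous_on_subset) (use stage_subset in auto)
    then have "continuous_map (prod_topology (top_of_set {0..1}) (top_of_set (stage n))) (top_of_set (stage n)) ?h"
      using compress_cutoff_path_stage by (auto simp: prod_topology_subtopology_eu)
    then show "continuous_map (prod_topology (top_of_set {0..1}) (top_of_set (stage n))) stages ?h"
      by (rule continuous_map_into_colimit)
  qed
  then show "homotopic_with (\<lambda>x. True) stages stages (?g \<circ> id) id"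
    unfolding homotopic_with_def by (intro exI[of _ ?h]) auto
qed

section \<open>Fredholm pairs\<close>

definition base :: "'a set"
  where "base = {x. P\<^sub>0 x = x}"

definition lag_op :: "'a set \<Rightarrow> 'a \<Rightarrow>\<^sub>L 'a"
  where "lag_op L = orth_proj L - (id_blinfun - P\<^sub>0)"

lemma lag_op_apply: "lag_op L x = orth_proj L x + P\<^sub>0 x - x"
  by (simp add: lag_op_def blinfun.bilinear_simps)

lemma orth_proj_eqI:
  fixes P :: "'b::{real_inner, complete_space} \<Rightarrow>\<^sub>L 'b"
  assumes "closed L" "subspace L" "\<And>x. P x \<in> L" "\<And>x. x - P x \<in> L\<^sup>\<bottom>"
  shows "orth_proj L = P"
  by (rule blinfun_eqI) (rule orthogonal_decomposition_unique[OF assms(2) orth_proj[OF assms(1,2)] assms(3,4)])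

lemma lag_op_in_lag_ops:
  assumes L: "lagrangian J L"
  shows "lag_op L \<in> lag_ops"
  unfolding lag_ops_def
proof (intro CollectI conjI allI)
  let ?P = "orth_proj L"
  note P = lagrangian_orth_proj[OF J_J L]
  fix x y
  show "inner (lag_op L x) y = inner x (lag_op L y)"
    by (simp add: lag_op_apply inner_diff_left inner_diff_right inner_add_left inner_add_right P(1) P0_sym)
  show "lag_op L (J x) = - J (lag_op L x)"
    by (simp add: lag_op_apply P(2) P0_J blinfun.bilinear_simps)
  have "inner (?P x) (?P y) = inner (?P x) y" "inner x (?P y) = inner (?P x) y"
    using P(1,3) by metis+
  moreover have "inner (P\<^sub>0 x) (P\<^sub>0 y) = inner x (P\<^sub>0 y)" "inner (P\<^sub>0 x) y = inner x (P\<^sub>0 y)"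
    using P0_sym[of x] by simp_all
  ultimately show "2 * inner (lag_op L x) (lag_op L y) = inner (lag_op L x) (conjg y) + inner (conjg x) (lag_op L y)"
    by (simp add: lag_op_apply conjg_apply inner_diff_left inner_diff_right inner_add_left
        inner_add_right algebra_simps)
qed

text \<open>The three conditions of \<open>lag_ops\<close> make B + 1 - \<open>P\<^sub>0\<close>
  symmetric, exchanged with its complement by \<open>J\<close>, and idempotent; its fixed space is
  the Lagrangian.\<close>

lemma lag_ops_projection:
  assumes B: "B \<in> lag_ops"
  obtains L where "lagrangian J L" "lag_op L = B"
proof -
  define P where "P = B + id_blinfun - P\<^sub>0"
  have P: "P x = B x + x - P\<^sub>0 x" for x by (simp add: P_def blinfun.bilinear_simps)
  note Bd = lag_opsD[OF B]
  have sym: "inner (P x) y = inner x (P y)" for x y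
    by (simp add: P inner_diff_left inner_diff_right inner_add_left inner_add_right Bd(1) P0_sym)
  have idem: "P (P x) = P x" for x
  proof -
    have "inner (P x) (P y) = inner (P x) y" for y
    proof -
      have "inner (P\<^sub>0 x) (P\<^sub>0 y) = inner x (P\<^sub>0 y)" "inner (P\<^sub>0 x) y = inner x (P\<^sub>0 y)"
        using P0_sym[of x] by simp_all
      then show ?thesis using Bd(3)[of x y] Bd(1)[of x y]
        by (simp add: P conjg_apply inner_diff_left inner_diff_right inner_add_left inner_add_right
            algebra_simps)
    qed
    then have "inner (P (P x) - P x) y = 0" for y by (simp add: inner_diff_left sym)
    then show ?thesis by (metis inner_eq_zero_iff right_minus_eq)
  qed
  have PJ: "P (J x) = J x - J (P x)" for x
    by (simp add: P Bd(2) P0_J blinfun.bilinear_simps)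
  define L where "L = {x. P x = x}"
  have sub: "subspace L"
    by (rule subspaceI) (auto simp: L_def blinfun.bilinear_simps)
  have cl: "closed L"
    unfolding L_def by (intro closed_Collect_eq continuous_intros)
  have perp: "y \<in> L\<^sup>\<bottom> \<longleftrightarrow> P y = 0" for y
  proof
    assume "y \<in> L\<^sup>\<bottom>"
    moreover have "P y \<in> L" by (simp add: L_def idem)
    ultimately have "inner (P y) y = 0" by (auto simp: orthogonal_comp_def orthogonal_def)
    then have "inner (P y) (P y) = 0" by (metis sym idem)
    then show "P y = 0" by simp
  next
    assume y: "P y = 0"
    have "inner z y = 0" if "P z = z" for z
      using sym[of z y] y that by simp
    then show "y \<in> L\<^sup>\<bottom>" by (auto simp: L_def orthogonal_comp_def orthogonal_def)
  qed
  have "J ` L = L\<^sup>\<bottom>"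
  proof (intro equalityI subsetI)
    fix y assume "y \<in> J ` L"
    then obtain x where "P x = x" "y = J x" by (auto simp: L_def)
    then show "y \<in> L\<^sup>\<bottom>" by (simp add: perp PJ)
  next
    fix y assume "y \<in> L\<^sup>\<bottom>"
    then have "P (- J y) = - J y" by (simp add: perp PJ blinfun.bilinear_simps)
    moreover have "y = J (- J y)" by (simp add: blinfun.bilinear_simps)
    ultimately show "y \<in> J ` L" unfolding L_def by blast
  qed
  then have L: "lagrangian J L" using sub cl by (simp add: lagrangian_def)
  have oP: "orth_proj L = P"
    by (rule orth_proj_eqI[OF cl sub]) (auto simp: L_def idem perp[unfolded L_def] blinfun.bilinear_simps)
  show thesis
    by (rule that[OF L]) (auto intro: blinfun_eqI simp: lag_op_apply oP P)
qed

lemma trunc_range: "trunc n x \<in> span (e ` {..<n} \<union> (\<lambda>k. J (e k)) ` {..<n})"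
  unfolding trunc_apply coord_proj_apply
  by (intro span_sum span_add span_scale span_base) auto

text \<open>A vector x of the intersection satisfies B x = x, so (1 - tail B) x is truncated, and
  inverting 1 - tail B gives finite dimension. Dually, 1 + B = P + \<open>P\<^sub>0\<close> has its
  range in the sum and differs by finite rank from the invertible 1 + tail B, so the sum contains a
  closed subspace of finite codimension.\<close>

lemma fredholm_pair_of_lag_op:
  assumes L: "lagrangian J L" and F: "lag_op L \<in> fredholm_ops"
  shows "fredholm_pair L base"
proof -
  let ?B = "lag_op L" and ?P = "orth_proj L"
  note P = lagrangian_orth_proj[OF J_J L]
  obtain n where n: "norm (tail n o\<^sub>L ?B) < 1" using F by (auto simp: fredholm_ops_def)
  let ?G = "e ` {..<n} \<union> (\<lambda>k. J (e k)) ` {..<n}"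
  have sL: "subspace L" using L by (simp add: lagrangian_def)
  have sb: "subspace base" by (rule subspaceI) (auto simp: base_def blinfun.bilinear_simps)
  have "fin_dim (L \<inter> base)"
  proof (rule finite_spanning_set_subspace[OF subspace_inter[OF sL sb]])
    let ?N = "neumann (tail n o\<^sub>L ?B)"
    have lin: "linear ?N" by (rule blinfun.bounded_linear_right[THEN bounded_linear.linear])
    show "L \<inter> base \<subseteq> span (?N ` ?G)"
    proof
      fix x assume x: "x \<in> L \<inter> base"
      then have "?B x = x" using P(4) by (auto simp: lag_op_apply base_def)
      then have "x - (tail n o\<^sub>L ?B) x = trunc n x" by (simp add: tail_apply)
      then have "x = ?N (trunc n x)" using neumann_left[OF n, of x] by simp
      also have "\<dots> \<in> span (?N ` ?G)" using trunc_range by (simp add: linear_span_image[OF lin])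
      finally show "x \<in> span (?N ` ?G)" .
    qed
  qed simp
  moreover
  let ?T = "- (tail n o\<^sub>L ?B)"
  let ?N = "neumann ?T"
  let ?M = "{x + y |x y. x \<in> L \<and> y \<in> base}"
  \<comment> \<open>On \<open>C\<close> the two operators agree: w = N z satisfies z = w + B
    w.\<close>
  define C where "C = {z. trunc n (?B (?N z)) = 0}"
  have T: "norm ?T < 1" using n by simp
  have lin: "linear (\<lambda>z. trunc n (?B (?N z)))"
    by (intro linearI) (simp_all add: blinfun.bilinear_simps)
  have cC: "closed C" unfolding C_def by (intro closed_Collect_eq continuous_intros)
  have sC: "subspace C" unfolding C_def by (rule subspaceI) (auto simp: blinfun.bilinear_simps)
  have fC: "fin_codim C" unfolding C_def by (rule fin_codim_kernel[OF lin, of ?G]) (use trunc_range in auto)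
  have CM: "C \<subseteq> ?M"
  proof
    fix z assume z: "z \<in> C"
    have "z = ?N z + tail n (?B (?N z))" using neumann_right[OF T, of z] by (simp add: blinfun.bilinear_simps)
    also have "tail n (?B (?N z)) = ?B (?N z)" using z by (simp add: C_def tail_apply)
    finally have "z = ?P (?N z) + P\<^sub>0 (?N z)" by (simp add: lag_op_apply)
    moreover have "P\<^sub>0 (?N z) \<in> base" by (simp add: base_def)
    ultimately show "z \<in> ?M" using P(5) by blast
  qed
  have "subspace ?M" using subspace_sums[OF sL sb] .
  then have "closed ?M" by (rule closed_of_fin_codim_subspace[OF cC sC fC CM])
  moreover have "fin_codim ?M" using fC CM by (rule fin_codim_mono)
  ultimately show ?thesis unfolding fredholm_pair_def by (intro conjI)
qed

text \<open>The operator T = P - \<open>P\<^sub>0\<close>, which is B - c, vanishes on the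
  intersection of the two Lagrangians and on its image under \<open>J\<close>; \<open>V\<close> is
  the orthogonal complement of both. Closedness of the sum makes every vector of \<open>V\<close>
  the image under T of one in \<open>V\<close>, so T is bounded below on \<open>V\<close>. Far tails
  are almost orthogonal to the finitely many directions removed, so the bound survives there with
  half the constant.\<close>

lemma lag_op_of_fredholm_pair:
  assumes L: "lagrangian J L" and F: "fredholm_pair L base"
  shows "lag_op L \<in> fredholm_ops"
proof -
  let ?B = "lag_op L" and ?P = "orth_proj L"
  note P = lagrangian_orth_proj[OF J_J L]
  let ?M = "{x + y |x y. x \<in> L \<and> y \<in> base}"
  obtain C where C: "finite C" "orthonormal C" "span C = L \<inter> base"
    using F unfolding fredholm_pair_def by (meson fin_dim_orthonormal_basis)
  have Cb: "?P b = b" "P\<^sub>0 b = b" if "b \<in> C" for b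
    using C(3) that P(4) span_superset[of C] by (auto simp: base_def)
  define V where "V = {x. \<forall>b\<in>C. inner x b = 0 \<and> inner x (J b) = 0}"
  have V_span: "inner x y = 0 \<and> inner x (J y) = 0" if "x \<in> V" "y \<in> span C" for x y
    using that(2)
    by (induction rule: span_induct_alt)
      (use that(1) in \<open>auto simp: V_def inner_add_right blinfun.bilinear_simps\<close>)
  have sV: "subspace V" unfolding V_def by (rule subspaceI) (auto simp: inner_add_left)
  have cV: "closed V"
  proof -
    have "V = (\<Inter>b\<in>C. {x. inner x b = 0} \<inter> {x. inner x (J b) = 0})" by (auto simp: V_def)
    also have "closed \<dots>" by (intro closed_INT ballI closed_Int closed_Collect_eq continuous_intros)
    finally show ?thesis .
  qed
  have PV: "?P x \<in> V" "J x \<in> V" if "x \<in> V" for x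
    using that Cb by (auto simp: V_def P(1,2) J_skew blinfun.bilinear_simps)
  have J_V: "J x \<in> V" if "x \<in> V" for x using PV that by blast
  have sL: "subspace L" and sb: "subspace base"
    using L by (auto simp: lagrangian_def base_def blinfun.bilinear_simps intro!: subspaceI)
  \<comment> \<open>The component w of v orthogonal to the sum is killed by both projections, so J w
    lies in both Lagrangians and v is orthogonal to w.\<close>
  have VM: "v \<in> ?M" if v: "v \<in> V" for v
  proof -
    have M: "closed ?M" "subspace ?M" using F subspace_sums[OF sL sb] by (auto simp: fredholm_pair_def)
    define w where "w = v - orth_proj ?M v"
    have w: "inner m w = 0" if "m \<in> ?M" for m
      using orth_proj(2)[OF M, of v] that by (auto simp: w_def orthogonal_comp_def orthogonal_def)
    have "L \<subseteq> ?M" "base \<subseteq> ?M"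
      using subspace_0[OF sL] subspace_0[OF sb] by force+
    moreover have "P\<^sub>0 w \<in> base" by (simp add: base_def)
    ultimately have PM: "?P w \<in> ?M" "P\<^sub>0 w \<in> ?M" using P(5)[of w] by (blast, blast)
    note z = w[OF PM(1)] w[OF PM(2)]
    have "inner (?P w) (?P w) = 0" using z(1) by (metis P(1,3))
    moreover have "inner (P\<^sub>0 w) (P\<^sub>0 w) = 0" using z(2) by (metis P0_sym P0_idem)
    ultimately have "?P w = 0" "P\<^sub>0 w = 0" by simp_all
    then have "J w \<in> L \<inter> base" using P(4)[of "J w"] by (auto simp: P(2) P0_J base_def blinfun.bilinear_simps)
    then have "inner v (J (J w)) = 0" using V_span[OF v, of "J w"] C(3) by simp
    then have "inner v w = 0" by simp
    moreover have "inner (orth_proj ?M v) w = 0" using orth_proj(1)[OF M] by (intro w)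
    ultimately have "inner w w = 0" by (subst (1) w_def) (simp add: inner_diff_left)
    then show ?thesis using orth_proj(1)[OF M, of v] by (simp add: w_def)
  qed
  define T where "T = ?P - P\<^sub>0"
  have T: "T x = ?P x - P\<^sub>0 x" for x by (simp add: T_def blinfun.bilinear_simps)
  have Tsym: "inner (T x) y = inner x (T y)" for x y
    by (simp add: T inner_diff_left inner_diff_right P(1) P0_sym)
  define pr where "pr x = (\<Sum>b\<in>C. inner x b *\<^sub>R b + inner x (J b) *\<^sub>R J b)" for x
  have Tpr: "T (pr x) = 0" for x
    by (simp add: pr_def blinfun.bilinear_simps T Cb P(2) P0_J)
  have prV: "x - pr x \<in> V" for x
  proof -
    have JC: "inner b (J b') = 0" "inner (J b') b = 0" if "b \<in> C" "b' \<in> C" for b b'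
      using P0_sym[of b "J b'"] that by (simp_all add: Cb P0_J inner_commute)
    have oC: "inner b b' = (if b = b' then 1 else 0)" if "b \<in> C" "b' \<in> C" for b b'
      using C(2) that by (simp add: orthonormal_def)
    have "inner (pr x) b = inner x b" "inner (pr x) (J b) = inner x (J b)" if "b \<in> C" for b
      using that C(1) by (simp_all add: pr_def inner_sum_left inner_add_left JC oC
          if_distrib[of "(*) _"] cong: sum.cong if_cong)
    then show ?thesis by (simp add: V_def inner_diff_left)
  qed
  \<comment> \<open>Split v into P v and v - P v. If J P v = l + l0, then P v = T (- J l0); if v - P
    v = k + k0, then it is T (- k0). Subtracting \<open>pr\<close>, which T kills, moves the
    preimage into \<open>V\<close>.\<close>
  have surj: "\<exists>y\<in>V. T y = v" if v: "v \<in> V" for v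
  proof -
    have "?P v \<in> V" "v - ?P v \<in> V" using PV v sV by (auto intro: subspace_diff)
    obtain l l0 where l: "l \<in> L" "l0 \<in> base" "J (?P v) = l + l0"
      using VM[OF J_V[OF \<open>?P v \<in> V\<close>]] by blast
    have "?P v = T (- J l0)"
    proof -
      have "- ?P v = J l + J l0" using arg_cong[OF l(3), of J] by (simp add: blinfun.add_right)
      then have "?P v = - (J l + J l0)" by (metis minus_minus)
      from arg_cong[OF this, of ?P]
      have "?P (?P v) = - ?P (J l) - ?P (J l0)" by (simp add: blinfun.minus_right blinfun.add_right blinfun.diff_right)
      moreover have "?P (J l) = 0" using l(1) P(4)[of l] by (simp add: P(2))
      moreover have "P\<^sub>0 (J l0) = 0" using l(2) by (simp add: base_def P0_J)
      ultimately show ?thesis by (simp add: T P(3) blinfun.bilinear_simps)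
    qed
    moreover obtain k k0 where k: "k \<in> L" "k0 \<in> base" "v - ?P v = k + k0"
      using VM[OF \<open>v - ?P v \<in> V\<close>] by blast
    have "v - ?P v = T (- k0)"
    proof -
      have "?P (v - ?P v) = 0" by (simp add: blinfun.bilinear_simps P(3))
      then have "k + ?P k0 = 0" using k(1) P(4)[of k] by (simp add: k(3) blinfun.bilinear_simps)
      then have "k = - ?P k0" by (simp add: eq_neg_iff_add_eq_0)
      moreover have "P\<^sub>0 k0 = k0" using k(2) by (simp add: base_def)
      ultimately show ?thesis unfolding k(3) by (simp add: T blinfun.bilinear_simps)
    qed
    moreover have "v = ?P v + (v - ?P v)" by simp
    ultimately have "v = T (- J l0) + T (- k0)" by metis
    then have "T (- J l0 - k0) = v" by (simp add: blinfun.diff_right blinfun.minus_right)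
    then have "T ((- J l0 - k0) - pr (- J l0 - k0)) = v" by (simp add: blinfun.diff_right[of T "- J l0 - k0"] Tpr)
    then show ?thesis using prV by blast
  qed
  obtain \<delta> where \<delta>: "\<delta> > 0" "\<And>x. x \<in> V \<Longrightarrow> \<delta> * norm x \<le> norm (T x)"
    using symmetric_surjection_bounded_below[OF cV sV Tsym surj] by blast
  define \<epsilon> where "\<epsilon> n = (\<Sum>b\<in>C. norm (tail n b) * norm b + norm (tail n (J b)) * norm (J b))" for n
  have "\<epsilon> \<longlonglongrightarrow> (\<Sum>b\<in>C. norm (0::'a) * norm b + norm (0::'a) * norm (J b))"
    unfolding \<epsilon>_def by (intro tendsto_intros tail_tendsto_0)
  then have "\<forall>\<^sub>F n in sequentially. \<epsilon> n < 1 / 2" by (intro order_tendstoD(2)) auto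
  then obtain n where n: "\<epsilon> n < 1 / 2" by (auto simp: eventually_sequentially)
  show ?thesis
  proof (rule fredholm_opsI[OF lag_op_in_lag_ops[OF L], of "\<delta> / 2" n])
    show "0 < \<delta> / 2" using \<delta>(1) by simp
    fix x assume x: "tail n x = x"
    have i: "\<bar>inner x b\<bar> \<le> norm x * norm (tail n b)" for b
      using Cauchy_Schwarz_ineq2[of x "tail n b"] by (simp add: diagonalD(1)[OF diagonal_tail, symmetric] x)
    have "norm (pr x) \<le> (\<Sum>b\<in>C. norm x * (norm (tail n b) * norm b + norm (tail n (J b)) * norm (J b)))"
      unfolding pr_def
    proof (rule sum_norm_le)
      fix b
      have "norm (inner x b *\<^sub>R b + inner x (J b) *\<^sub>R J b) \<le> \<bar>inner x b\<bar> * norm b + \<bar>inner x (J b)\<bar> * norm (J b)"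
        by (rule order_trans[OF norm_triangle_ineq]) simp
      also have "\<dots> \<le> (norm x * norm (tail n b)) * norm b + (norm x * norm (tail n (J b))) * norm (J b)"
        by (intro add_mono mult_right_mono i) auto
      finally show "norm (inner x b *\<^sub>R b + inner x (J b) *\<^sub>R J b) \<le>
          norm x * (norm (tail n b) * norm b + norm (tail n (J b)) * norm (J b))" by (simp add: algebra_simps)
    qed
    also have "\<dots> = norm x * \<epsilon> n" by (simp add: \<epsilon>_def sum_distrib_left)
    also have "\<dots> \<le> norm x * (1 / 2)" using n by (intro mult_left_mono) auto
    finally have "norm x / 2 \<le> norm (x - pr x)" using norm_triangle_ineq2[of x "pr x"] by simp
    then have "\<delta> / 2 * norm x \<le> \<delta> * norm (x - pr x)" using \<delta>(1) by (simp add: mult_left_mono)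
    also have "\<dots> \<le> norm (T (x - pr x))" by (rule \<delta>(2)[OF prV])
    also have "T (x - pr x) = T x" by (simp add: blinfun.diff_right Tpr)
    also have "norm (T x) = norm (conjg x - ?B x)"
    proof -
      have "conjg x - ?B x = - T x" by (simp add: conjg_apply lag_op_apply T algebra_simps scaleR_2)
      then show ?thesis by simp
    qed
    finally show "\<delta> / 2 * norm x \<le> norm (conjg x - ?B x)" .
  qed
qed

text \<open>The shift by 1 - \<open>P\<^sub>0\<close> cancels in differences, so
  \<open>lag_op\<close> is an isometry for \<open>proj_dist\<close>, and only the two subsets have
  to be matched.\<close>

theorem grassmannian_homeomorphic_fredholm_ops:
  "fredholm_lagrangian_grassmannian J base homeomorphic_space top_of_set fredholm_ops"
proof -
  let ?\<Lambda> = "{L. lagrangian J L}"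
  let ?F = "{L. lagrangian J L \<and> fredholm_pair L base}"
  interpret Metric_space ?\<Lambda> proj_dist by (rule Metric_space_lagrangian)
  interpret M: Metric_space12 ?\<Lambda> proj_dist "UNIV :: ('a \<Rightarrow>\<^sub>L 'a) set" dist
    by (intro Metric_space12.intro Metric_space_axioms Met_TC.Metric_space_axioms)
  have "embedding_map mtopology Met_TC.mtopology lag_op"
    by (rule M.isometry_imp_embedding_map) (auto simp: lag_op_def proj_dist_def dist_norm)
  then have hom: "homeomorphic_map mtopology (top_of_set (lag_op ` ?\<Lambda>)) lag_op"
    by (simp add: embedding_map_def)
  have im: "lag_op ` ?F = fredholm_ops"
  proof (intro equalityI subsetI)
    fix B assume "B \<in> lag_op ` ?F"
    then show "B \<in> fredholm_ops" using lag_op_of_fredholm_pair by auto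
  next
    fix B assume B: "B \<in> fredholm_ops"
    then obtain L where "lagrangian J L" "lag_op L = B"
      using lag_ops_projection unfolding fredholm_ops_def by blast
    then show "B \<in> lag_op ` ?F" using B fredholm_pair_of_lag_op by blast
  qed
  then have sub: "fredholm_ops \<subseteq> lag_op ` ?\<Lambda>" by blast
  have "homeomorphic_map (subtopology mtopology ?F)
      (subtopology (top_of_set (lag_op ` ?\<Lambda>)) fredholm_ops) lag_op"
  proof (rule homeomorphic_map_subtopologies[OF hom])
    have "topspace mtopology \<inter> ?F = ?F" by auto
    then show "lag_op ` (topspace mtopology \<inter> ?F) = topspace (top_of_set (lag_op ` ?\<Lambda>)) \<inter> fredholm_ops"
      using im sub by auto
  qed
  moreover have "subtopology (top_of_set (lag_op ` ?\<Lambda>)) fredholm_ops = top_of_set fredholm_ops"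
    using sub by (simp add: subtopology_subtopology Int_absorb1)
  ultimately have "subtopology mtopology ?F homeomorphic_space top_of_set fredholm_ops"
    using homeomorphic_map_imp_homeomorphic_space by metis
  then show ?thesis
    by (simp add: fredholm_lagrangian_grassmannian_def lagrangian_topology_def)
qed

end

section \<open>The finite stages and the unitary groups\<close>

definition adj :: "complex imat \<Rightarrow> complex imat"
  where "adj A = (\<lambda>i j. cnj (A j i))"

lemma stable_adj [simp]: "stable n (adj A) \<longleftrightarrow> stable n A"
proof -
  have "stable n (adj A)" if "stable n A" for A
    using that by (auto simp: stable_def adj_def imat_one_def)
  from this[of A] this[of "adj A"] show ?thesis by (auto simp: adj_def)
qed

lemma adj_adj [simp]: "adj (adj A) = A"
  by (simp add: adj_def)

lemma stable_imat_one [simp]: "stable n imat_one"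
  by (simp add: stable_def)

lemma stable_imat_mult:
  assumes A: "stable n A" and B: "stable n B"
  shows "stable n (imat_mult A B)"
  unfolding stable_def
proof (intro allI impI)
  fix i j assume "i \<ge> n \<or> j \<ge> n"
  then show "imat_mult A B i j = imat_one i j"
  proof
    assume i: "i \<ge> n"
    then have Ai: "A i k = (if i = k then 1 else 0)" for k using A by (simp add: stable_def imat_one_def)
    have "imat_mult A B i j = (\<Sum>k\<in>{i}. A i k * B k j)"
      unfolding imat_mult_def by (intro sum.mono_neutral_left) (auto simp: Ai)
    then show ?thesis using B i by (simp add: Ai stable_def)
  next
    assume j: "j \<ge> n"
    then have Bj: "B k j = (if k = j then 1 else 0)" for k using B by (simp add: stable_def imat_one_def)
    have "imat_mult A B i j = (\<Sum>k\<in>{j}. A i k * B k j)"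
      unfolding imat_mult_def by (intro sum.mono_neutral_left) (auto simp: Bj)
    then show ?thesis using A j by (simp add: Bj stable_def)
  qed
qed

lemma adj_imat_mult: "adj (imat_mult A B) = imat_mult (adj B) (adj A)"
  by (intro ext) (simp add: adj_def imat_mult_def mult.commute)

lemma imat_mult_of_real:
  "imat_mult (\<lambda>i j. complex_of_real (A i j)) (\<lambda>i j. complex_of_real (B i j)) =
    (\<lambda>i j. complex_of_real (imat_mult A B i j))"
  by (intro ext) (simp add: imat_mult_def flip: of_real_mult)

lemma unitary_group_iff:
  "A \<in> unitary_group n \<longleftrightarrow> stable n A \<and> imat_mult (adj A) A = imat_one \<and> imat_mult A (adj A) = imat_one"
  by (simp add: unitary_group_def adj_def)

text \<open>Lets cosets be handled among complex matrices only, with reality of the entries in place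
  of the embedding of real matrices.\<close>

lemma O_inf_iff: "D \<in> O_inf \<longleftrightarrow> (\<exists>n. D \<in> unitary_group n \<and> (\<forall>i j. cnj (D i j) = D i j))"
proof
  assume "D \<in> O_inf"
  then obtain n A where A: "A \<in> orthogonal_group n" and D: "D = (\<lambda>i j. complex_of_real (A i j))"
    by (auto simp: O_inf_def)
  have "(\<lambda>i j. complex_of_real (imat_one i j)) = imat_one" by (intro ext) (simp add: imat_one_def)
  then have "D \<in> unitary_group n"
    using A unfolding unitary_group_def orthogonal_group_def D
    by (auto simp: imat_mult_of_real stable_def imat_one_def)
  then show "\<exists>n. D \<in> unitary_group n \<and> (\<forall>i j. cnj (D i j) = D i j)" by (auto simp: D)
next
  assume "\<exists>n. D \<in> unitary_group n \<and> (\<forall>i j. cnj (D i j) = D i j)"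
  then obtain n where n: "D \<in> unitary_group n" and r: "\<And>i j. cnj (D i j) = D i j" by blast
  define A where "A = (\<lambda>i j. Re (D i j))"
  have D: "D = (\<lambda>i j. complex_of_real (A i j))"
  proof (intro ext)
    fix i j
    have "D i j \<in> \<real>" using r[of i j] by (simp add: Reals_cnj_iff)
    then show "D i j = complex_of_real (A i j)" by (simp add: A_def)
  qed
  have inj: "M = N" if "(\<lambda>i j. complex_of_real (M i j)) = (\<lambda>i j. complex_of_real (N i j))" for M N :: "real imat"
    using that by (auto simp: fun_eq_iff)
  have one: "(\<lambda>i j. complex_of_real (imat_one i j)) = imat_one" by (intro ext) (simp add: imat_one_def)
  have "stable n A" using n by (auto simp: unitary_group_def stable_def A_def imat_one_def)
  moreover have "imat_mult (\<lambda>i j. A j i) A = imat_one" "imat_mult A (\<lambda>i j. A j i) = imat_one"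
    by (rule inj, use n in \<open>simp add: unitary_group_def D one flip: imat_mult_of_real\<close>)+
  ultimately show "D \<in> O_inf" by (auto simp: O_inf_def orthogonal_group_def D)
qed

lemma continuous_on_entry: "continuous_on S (\<lambda>A :: complex imat. A i j)"
  by (rule continuous_on_product_then_coordinatewise, rule continuous_on_product_then_coordinatewise,
      rule continuous_on_id)

text \<open>Rows of norm 1 bound all entries by 1, so the group lies in a product of discs, compact
  by Tychonoff. For stable matrices unitarity amounts to finitely many equations between finite
  sums, a closed condition.\<close>

lemma compact_unitary_group: "compact (unitary_group n)"
proof -
  let ?K = "{A :: complex imat. \<forall>i j. A i j \<in> cball 0 1}"
  have "compact {f :: nat \<Rightarrow> complex. \<forall>j. f j \<in> cball 0 1}"
  proof -
    have "compactin (product_topology (\<lambda>_. euclidean) UNIV) (PiE UNIV (\<lambda>_ :: nat. cball (0::complex) 1))"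
      by (simp add: compactin_PiE)
    moreover have "PiE UNIV (\<lambda>_ :: nat. cball (0::complex) 1) = {f. \<forall>j. f j \<in> cball 0 1}" by auto
    ultimately show ?thesis by (simp add: euclidean_product_topology flip: compactin_euclidean_iff)
  qed
  moreover have "PiE UNIV (\<lambda>_ :: nat. {f :: nat \<Rightarrow> complex. \<forall>j. f j \<in> cball 0 1}) = ?K" by auto
  ultimately have "compactin (product_topology (\<lambda>_. euclidean) UNIV) ?K"
    by (metis compactin_PiE compactin_euclidean_iff)
  then have K: "compact ?K" by (simp add: euclidean_product_topology flip: compactin_euclidean_iff)
  let ?S = "{A :: complex imat. stable n A}"
  let ?U = "?K \<inter> (\<Inter>i. \<Inter>j. {A. i \<ge> n \<or> j \<ge> n \<longrightarrow> A i j = imat_one i j}) \<inter>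
    (\<Inter>i\<in>{..<n}. \<Inter>j\<in>{..<n}. {A. (\<Sum>k<n. cnj (A k i) * A k j) = imat_one i j} \<inter>
      {A. (\<Sum>k<n. A i k * cnj (A j k)) = imat_one i j})"
  have st: "imat_mult A B = imat_one \<longleftrightarrow> (\<forall>i<n. \<forall>j<n. (\<Sum>k<n. A i k * B k j) = imat_one i j)"
    if "stable n A" "stable n B" for A B :: "complex imat"
    using stable_imat_mult[OF that] imat_mult_stable[OF that]
    by (auto simp: fun_eq_iff stable_def) (metis linorder_not_le)
  have "unitary_group n = ?U"
  proof (intro equalityI subsetI)
    fix A assume A: "A \<in> unitary_group n"
    then have s: "stable n A" "stable n (adj A)" by (auto simp: unitary_group_iff)
    have e: "(\<Sum>k<n. cnj (A k i) * A k j) = imat_one i j" "(\<Sum>k<n. A i k * cnj (A j k)) = imat_one i j"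
      if "i < n" "j < n" for i j
      using A st[OF s(2,1)] st[OF s(1,2)] that by (auto simp: unitary_group_iff adj_def)
    have "norm (A i j) \<le> 1" for i j
    proof (cases "i < n \<and> j < n")
      case True
      have "complex_of_real (\<Sum>k<n. (norm (A i k))\<^sup>2) = (\<Sum>k<n. A i k * cnj (A i k))"
        unfolding of_real_sum by (intro sum.cong refl complex_norm_square)
      also have "\<dots> = 1" using e(2)[of i i] True by (simp add: imat_one_def)
      finally have "(\<Sum>k<n. (norm (A i k))\<^sup>2) = 1" by (metis of_real_eq_1_iff)
      moreover have "(norm (A i j))\<^sup>2 \<le> (\<Sum>k<n. (norm (A i k))\<^sup>2)"
        using True by (intro member_le_sum) auto
      ultimately show ?thesis by (simp add: abs_square_le_1)
    next
      case False
      then show ?thesis using s(1) by (auto simp: stable_def imat_one_def not_less)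
    qed
    then show "A \<in> ?U" using e s(1) by (auto simp: stable_def)
  next
    fix A assume A: "A \<in> ?U"
    then have s: "stable n A" "stable n (adj A)" by (auto simp: stable_def adj_def imat_one_def)
    show "A \<in> unitary_group n"
      using A s st[OF s(2,1)] st[OF s(1,2)] by (auto simp: unitary_group_iff adj_def)
  qed
  moreover have "closed {A :: complex imat. i \<ge> n \<or> j \<ge> n \<longrightarrow> A i j = imat_one i j}" for i j
    by (cases "i \<ge> n \<or> j \<ge> n") (auto intro!: closed_Collect_eq continuous_on_entry continuous_intros)
  ultimately show ?thesis
    using K by (auto intro!: compact_Int_closed closed_INT closed_Int closed_Collect_eq
        continuous_on_entry continuous_intros)
qed

context lagrangian_setting
begin

section \<open>Complex coordinates and matrices as operators\<close>

definition coord :: "nat \<Rightarrow> 'a \<Rightarrow> complex"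
  where "coord k x = Complex (inner (e k) x) (inner (J (e k)) x)"

definition cmul :: "complex \<Rightarrow> 'a \<Rightarrow> 'a"
  where "cmul z x = Re z *\<^sub>R x + Im z *\<^sub>R J x"

lemma coord_add: "coord k (x + y) = coord k x + coord k y"
  by (simp add: coord_def inner_add_right complex_eq_iff)

lemma coord_diff: "coord k (x - y) = coord k x - coord k y"
  by (simp add: coord_def inner_diff_right complex_eq_iff)

lemma coord_0 [simp]: "coord k 0 = 0"
  by (simp add: coord_def complex_eq_iff)

lemma coord_scaleR: "coord k (r *\<^sub>R x) = of_real r * coord k x"
  by (simp add: coord_def complex_eq_iff)

lemma coord_sum: "coord k (sum f I) = (\<Sum>i\<in>I. coord k (f i))"
  by (induction I rule: infinite_finite_induct) (simp_all add: coord_add)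

lemma coord_J: "coord k (J x) = \<i> * coord k x"
  using J_skew[of "e k" x] by (simp add: coord_def complex_eq_iff)

lemma coord_cmul: "coord k (cmul z x) = z * coord k x"
  by (simp add: cmul_def coord_add coord_scaleR coord_J complex_eq_iff)

lemma coord_conjg: "coord k (conjg x) = cnj (coord k x)"
  by (simp add: coord_def complex_eq_iff conjg_sym[symmetric] conjg_apply[of "e k"]
      conjg_apply[of "J (e k)"] scaleR_2)

lemma coord_e: "coord k (e i) = (if k = i then 1 else 0)"
  by (simp add: coord_def e_ortho complex_eq_iff)

lemma coord_proj_eq: "coord_proj k x = cmul (coord k x) (e k)"
  by (simp add: coord_proj_apply cmul_def coord_def)

lemma coord_trunc: "coord k (trunc n x) = (if k < n then coord k x else 0)"
  by (simp add: trunc_apply coord_sum coord_proj_eq coord_cmul coord_e if_distrib cong: if_cong)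

lemma coord_tail: "coord k (tail n x) = (if k < n then 0 else coord k x)"
  by (simp add: tail_apply coord_diff coord_trunc)

lemma coord_eqI:
  assumes "\<And>k. coord k x = coord k y"
  shows "x = y"
proof -
  have "trunc n (x - y) = 0" for n
    by (simp add: trunc_apply coord_proj_eq coord_diff assms cmul_def)
  then have "(\<lambda>n. x - y) \<longlonglongrightarrow> 0"
    using tail_tendsto_0[of "x - y"] by (simp add: tail_apply)
  then show ?thesis by (simp add: LIMSEQ_const_iff)
qed

lemma trunc_eq_iff: "trunc n x = x \<longleftrightarrow> (\<forall>k\<ge>n. coord k x = 0)"
  by (metis coord_eqI coord_trunc leD linorder_le_less_linear)

text \<open>The Hermitian form belonging to the inner product and \<open>J\<close>: the real part is
  Parseval's identity, and the imaginary part is the real part for \<open>J x\<close>.\<close>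

lemma inner_coord:
  assumes "trunc n x = x"
  shows "(\<Sum>k<n. cnj (coord k x) * coord k y) = Complex (inner x y) (inner (J x) y)"
proof -
  have r: "Re (\<Sum>k<n. cnj (coord k x) * coord k y) = inner x y" if "trunc n x = x" for x
  proof -
    have "inner x y = inner (trunc n x) y" using that by simp
    also have "\<dots> = (\<Sum>k<n. Re (cnj (coord k x) * coord k y))"
      by (simp add: trunc_apply inner_sum_left coord_proj_apply inner_add_left coord_def)
    finally show ?thesis by simp
  qed
  have "trunc n (J x) = J x" using assms diagonalD(2)[OF diagonal_trunc] by simp
  then have "Re (\<Sum>k<n. cnj (coord k (J x)) * coord k y) = inner (J x) y" by (rule r)
  then have "Im (\<Sum>k<n. cnj (coord k x) * coord k y) = inner (J x) y"
    by (simp add: coord_J)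
  then show ?thesis using r[OF assms] by (simp add: complex_eq_iff)
qed

text \<open>Being the identity on the tail matches the stabilisation of matrices by 1, so for stable
  \<open>A\<close> the operator does not depend on the size (\<open>mat_op_stable\<close>).\<close>

definition mat_op :: "nat \<Rightarrow> complex imat \<Rightarrow> 'a \<Rightarrow>\<^sub>L 'a"
  where "mat_op n A = (\<Sum>i<n. \<Sum>j<n.
      Re (A i j) *\<^sub>R (rank_one (e i) (e j) + rank_one (J (e i)) (J (e j))) +
      Im (A i j) *\<^sub>R (J o\<^sub>L (rank_one (e i) (e j) + rank_one (J (e i)) (J (e j))))) + tail n"

lemma mat_op_apply: "mat_op n A x = (\<Sum>i<n. \<Sum>j<n. cmul (A i j * coord j x) (e i)) + tail n x"
  by (simp add: mat_op_def blinfun.bilinear_simps cmul_def coord_def algebra_simps)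

lemma coord_mat_op:
  "coord k (mat_op n A x) = (if k < n then \<Sum>j<n. A k j * coord j x else coord k x)"
proof -
  have "coord k (\<Sum>i<n. \<Sum>j<n. cmul (A i j * coord j x) (e i)) =
      (\<Sum>i<n. if k = i then \<Sum>j<n. A i j * coord j x else 0)"
    unfolding coord_sum coord_cmul coord_e by (rule sum.cong[OF refl]) simp
  then show ?thesis by (simp add: mat_op_apply coord_add coord_tail)
qed

lemma mat_op_J: "mat_op n A (J x) = J (mat_op n A x)"
  by (rule coord_eqI) (simp add: coord_mat_op coord_J sum_distrib_left mult.left_commute)

lemma mat_op_one [simp]: "mat_op n imat_one x = x"
  by (rule coord_eqI) (simp add: coord_mat_op imat_one_def if_distrib[of "\<lambda>z. z * _"] cong: if_cong)

lemma mat_op_mult: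
  assumes "stable n A" "stable n B"
  shows "mat_op n (imat_mult A B) x = mat_op n A (mat_op n B x)"
proof (rule coord_eqI)
  fix k
  have "(\<Sum>j<n. (\<Sum>l<n. A k l * B l j) * coord j x) = (\<Sum>l<n. A k l * (\<Sum>j<n. B l j * coord j x))"
    unfolding sum_distrib_right sum_distrib_left
    by (subst sum.swap) (simp add: mult.assoc)
  then show "coord k (mat_op n (imat_mult A B) x) = coord k (mat_op n A (mat_op n B x))"
    by (simp add: coord_mat_op imat_mult_stable[OF assms])
qed

lemma mat_op_adj: "inner (mat_op n A x) y = inner x (mat_op n (adj A) y)"
proof -
  have 1: "inner (cmul z (e i)) y = Re (cnj z * coord i y)" for z i y
    by (simp add: cmul_def coord_def inner_add_left)
  have 2: "inner (mat_op n A x) y =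
      Re (\<Sum>i<n. \<Sum>j<n. cnj (A i j) * cnj (coord j x) * coord i y) + inner (tail n x) y" for A x y
    by (simp add: mat_op_apply inner_add_left inner_sum_left 1)
  note 2[of A x y]
  also have "(\<Sum>i<n. \<Sum>j<n. cnj (A i j) * cnj (coord j x) * coord i y)
      = cnj (\<Sum>i<n. \<Sum>j<n. cnj (adj A i j) * cnj (coord j y) * coord i x)"
    by (subst sum.swap) (simp add: adj_def mult_ac)
  also have "Re \<dots> + inner (tail n x) y = inner (mat_op n (adj A) y) x"
    unfolding 2[of "adj A" y x]
    by (simp only: cnj.simps(1) diagonalD(1)[OF diagonal_tail] inner_commute[of y])
  finally show ?thesis by (simp add: inner_commute)
qed

lemma mat_op_stable:
  assumes A: "stable n A" and "n \<le> m"
  shows "mat_op m A = mat_op n A"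
proof (rule blinfun_eqI, rule coord_eqI)
  fix x k
  have "(\<Sum>j<m. A k j * coord j x) = (\<Sum>j<n. A k j * coord j x)" if "k < n"
    using A \<open>n \<le> m\<close> that by (intro sum.mono_neutral_right) (auto simp: stable_def imat_one_def)
  moreover have "(\<Sum>j<m. A k j * coord j x) = coord k x" if "n \<le> k" "k < m"
  proof -
    have "A k j = (if k = j then 1 else 0)" for j using A that by (simp add: stable_def imat_one_def)
    then show ?thesis using that by (simp add: if_distrib[of "\<lambda>z. z * _"] cong: if_cong)
  qed
  ultimately show "coord k (mat_op m A x) = coord k (mat_op n A x)"
    using \<open>n \<le> m\<close> by (simp add: coord_mat_op)
qed

text \<open>Faithfulness transfers associativity, the unit laws and unitarity from operators to
  infinite matrices.\<close>

lemma mat_op_inject: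
  assumes A: "stable n A" and B: "stable n B" and eq: "\<And>x. mat_op n A x = mat_op n B x"
  shows "A = B"
proof (intro ext)
  fix i j
  show "A i j = B i j"
  proof (cases "i < n \<and> j < n")
    case True
    have "coord i (mat_op n M (e j)) = M i j" for M
      using True by (simp add: coord_mat_op coord_e if_distrib[of "\<lambda>z. _ * z"] cong: if_cong)
    then show ?thesis using eq by metis
  next
    case False
    then have "i \<ge> n \<or> j \<ge> n" by auto
    then show ?thesis using A B unfolding stable_def by metis
  qed
qed

lemma imat_mult_assoc:
  fixes A B C :: "complex imat"
  assumes "stable n A" "stable n B" "stable n C"
  shows "imat_mult (imat_mult A B) C = imat_mult A (imat_mult B C)"
  by (rule mat_op_inject[of n]) (simp_all add: assms stable_imat_mult mat_op_mult)

lemma imat_mult_one: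
  fixes A :: "complex imat"
  assumes "stable n A"
  shows "imat_mult A imat_one = A" "imat_mult imat_one A = A"
  by (rule mat_op_inject[of n]; simp add: assms stable_imat_mult mat_op_mult)+

lemma unitary_group_op:
  assumes "A \<in> unitary_group n"
  shows "stable n A" "mat_op n A (mat_op n (adj A) x) = x" "mat_op n (adj A) (mat_op n A x) = x"
  using assms mat_op_mult[of n A "adj A" x] mat_op_mult[of n "adj A" A x]
  by (auto simp: unitary_group_iff)

lemma unitary_groupI:
  assumes s: "stable n A" and l: "\<And>x. mat_op n A (mat_op n (adj A) x) = x"
    and r: "\<And>x. mat_op n (adj A) (mat_op n A x) = x"
  shows "A \<in> unitary_group n"
proof -
  have "imat_mult A (adj A) = imat_one"
    by (rule mat_op_inject[of n]) (simp_all add: s stable_imat_mult mat_op_mult l)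
  moreover have "imat_mult (adj A) A = imat_one"
    by (rule mat_op_inject[of n]) (simp_all add: s stable_imat_mult mat_op_mult r)
  ultimately show ?thesis using s by (simp add: unitary_group_iff)
qed

lemma unitary_group_adj: "A \<in> unitary_group n \<Longrightarrow> adj A \<in> unitary_group n"
  by (simp add: unitary_group_iff)

lemma unitary_group_mult:
  assumes A: "A \<in> unitary_group n" and B: "B \<in> unitary_group n"
  shows "imat_mult A B \<in> unitary_group n"
  by (rule unitary_groupI)
    (simp_all add: adj_imat_mult unitary_group_op[OF A] unitary_group_op[OF B] stable_imat_mult mat_op_mult)

text \<open>The operator of the Lagrangian \<open>A (J L\<^sub>0)\<close>, whose reflection is \<open>- A c A\<^sup>*\<close>.\<close>

definition stage_op :: "nat \<Rightarrow> complex imat \<Rightarrow> 'a \<Rightarrow>\<^sub>L 'a"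
  where "stage_op n A = (1 / 2) *\<^sub>R (conjg - (mat_op n A o\<^sub>L (conjg o\<^sub>L mat_op n (adj A))))"

text \<open>The least size is just one admissible choice; by \<open>lag_of_unitary_eq\<close> all
  others give the same operator. This yields a single map on the union of the groups.\<close>

definition lag_of_unitary :: "complex imat \<Rightarrow> 'a \<Rightarrow>\<^sub>L 'a"
  where "lag_of_unitary A = stage_op (LEAST n. stable n A) A"

lemma stage_op_apply:
  "stage_op n A x = (1 / 2) *\<^sub>R (conjg x - mat_op n A (conjg (mat_op n (adj A) x)))"
  by (simp add: stage_op_def blinfun.bilinear_simps)

lemma lag_of_unitary_eq: "stable n A \<Longrightarrow> lag_of_unitary A = stage_op n A"
proof -
  assume A: "stable n A"
  let ?m = "LEAST n. stable n A"
  have m: "stable ?m A" "?m \<le> n" using A by (auto intro: LeastI Least_le)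
  then have "mat_op n A = mat_op ?m A" "mat_op n (adj A) = mat_op ?m (adj A)"
    by (auto intro: mat_op_stable)
  then show ?thesis by (simp add: lag_of_unitary_def stage_op_def)
qed

text \<open>W = A c A^-1 is again an antilinear symmetric involution. With 2 B = c - W the quadratic
  condition reduces to W^2 = c^2 = 1, and B has no coordinates from n on because W and c agree
  there.\<close>

lemma stage_op_in_stage:
  assumes A: "A \<in> unitary_group n"
  shows "stage_op n A \<in> stage n"
proof -
  let ?U = "mat_op n A" and ?V = "mat_op n (adj A)"
  define W where "W x = ?U (conjg (?V x))" for x
  note U = unitary_group_op[OF A]
  have S: "stage_op n A x = (1 / 2) *\<^sub>R (conjg x - W x)" for x by (simp add: stage_op_apply W_def)
  have Wsym: "inner (W x) y = inner x (W y)" for x y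
    by (simp add: W_def mat_op_adj conjg_sym)
  have WW: "W (W x) = x" for x by (simp add: W_def U)
  have WJ: "W (J x) = - J (W x)" for x
    by (simp add: W_def mat_op_J conjg_J blinfun.bilinear_simps)
  have "stage_op n A \<in> lag_ops"
    unfolding lag_ops_def
  proof (intro CollectI conjI allI)
    fix x y
    show "inner (stage_op n A x) y = inner x (stage_op n A y)"
      by (simp add: S inner_diff_left inner_diff_right Wsym conjg_sym)
    show "stage_op n A (J x) = - J (stage_op n A x)"
      by (simp add: S WJ conjg_J blinfun.bilinear_simps scaleR_diff_right)
    have "inner (W x) (W y) = inner x y" by (simp add: Wsym WW)
    then show "2 * inner (stage_op n A x) (stage_op n A y) =
        inner (stage_op n A x) (conjg y) + inner (conjg x) (stage_op n A y)"
      by (simp add: S inner_diff_left inner_diff_right algebra_simps)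
  qed
  moreover have "trunc n (stage_op n A x) = stage_op n A x" for x
    unfolding trunc_eq_iff by (simp add: S W_def coord_scaleR coord_diff coord_conjg coord_mat_op)
  ultimately show ?thesis by (simp add: stage_def)
qed

lemma span_doubled:
  assumes "trunc n x = x"
  shows "x \<in> span (e ` {..<n} \<union> (\<lambda>k. J (e k)) ` {..<n})"
  using trunc_range[of n x] assms by simp

text \<open>Takagi's factorisation: an orthonormal basis of the real subspace fixed by the antilinear
  involution \<open>c - 2 B\<close> gives the columns of the unitary matrix.\<close>

lemma stage_op_surj:
  assumes B: "B \<in> stage n"
  obtains A where "A \<in> unitary_group n" "stage_op n A = B"
proof -
  have BL: "B \<in> lag_ops" and Bt: "\<And>x. trunc n (B x) = B x" using B by (auto simp: stage_def)
  note Bd = lag_opsD[OF BL]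
  define W where "W = conjg - 2 *\<^sub>R B"
  have W: "W x = conjg x - 2 *\<^sub>R B x" for x by (simp add: W_def blinfun.bilinear_simps)
  have Wsym: "inner (W x) y = inner x (W y)" for x y
    by (simp add: W inner_diff_left inner_diff_right conjg_sym Bd(1))
  have "inner (W x) (W y) = inner x y" for x y
    using Bd(3)[of x y] by (simp add: W inner_diff_left inner_diff_right algebra_simps)
  then have "inner (W (W x) - x) y = 0" for x y by (simp add: inner_diff_left Wsym)
  then have WW: "W (W x) = x" for x by (metis inner_eq_zero_iff right_minus_eq)
  have WJ: "W (J x) = - J (W x)" for x by (simp add: W Bd(2) conjg_J blinfun.bilinear_simps)
  have tB: "B (tail n x) = 0" for x
  proof -
    have "inner (B (tail n x)) y = inner x (tail n (B y))" for y
      by (simp add: Bd(1) diagonalD(1)[OF diagonal_tail])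
    then have "inner (B (tail n x)) y = 0" for y by (simp add: tail_apply Bt)
    then show ?thesis by (metis inner_eq_zero_iff)
  qed
  have Wt: "trunc n (W x) = W (trunc n x)" for x
  proof -
    have "B x = B (trunc n x)" using tB[of x] by (simp add: tail_apply blinfun.diff_right)
    then show ?thesis by (simp add: W blinfun.bilinear_simps Bt diagonalD(4)[OF diagonal_trunc])
  qed
  let ?G = "e ` {..<n} \<union> (\<lambda>k. J (e k)) ` {..<n}"
  let ?V = "{x. trunc n x = x}"
  let ?F = "{x. trunc n x = x \<and> W x = x}"
  have tJ: "trunc n (J x) = J x" if "trunc n x = x" for x
    using that diagonalD(2)[OF diagonal_trunc] by simp
  have "subspace ?F" by (rule subspaceI) (auto simp: blinfun.bilinear_simps)
  then have "fin_dim ?F"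
    by (rule finite_spanning_set_subspace[of _ ?G]) (use span_doubled in auto)
  then obtain C where C: "finite C" "orthonormal C" "span C = ?F" by (rule fin_dim_orthonormal_basis)
  have CF: "trunc n v = v" "W v = v" if "v \<in> C" for v
    using C(3) span_superset[of C] that by auto
  \<comment> \<open>The symmetric \<open>W\<close> has eigenvalue 1 at \<open>v\<close> and -1 at
    \<open>J w\<close>.\<close>
  have CJ: "inner v (J w) = 0" "inner (J w) v = 0" if "v \<in> C" "w \<in> C" for v w
  proof -
    have "W (J w) = - J w" using CF that by (simp add: WJ)
    then have "inner (W v) (J w) = - inner v (J w)" unfolding Wsym by simp
    moreover have "W v = v" using CF that by simp
    ultimately have "inner v (J w) = - inner v (J w)" by simp
    then
    show "inner v (J w) = 0" by simp
    then show "inner (J w) v = 0" by (simp add: inner_commute)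
  qed
  have CC: "inner v w = (if v = w then 1 else 0)" if "v \<in> C" "w \<in> C" for v w
    using C(2) that by (simp add: orthonormal_def)
  have spanV: "span (C \<union> J ` C) = ?V"
  proof (intro equalityI subsetI)
    have "subspace ?V" by (rule subspaceI) (auto simp: blinfun.bilinear_simps)
    moreover have "C \<union> J ` C \<subseteq> ?V" using CF tJ by auto
    ultimately show "x \<in> ?V" if "x \<in> span (C \<union> J ` C)" for x
      using that span_minimal by blast
  next
    fix x assume "x \<in> ?V"
    then have x: "trunc n x = x" by simp
    \<comment> \<open>An antilinear involution splits the space into its fixed part and
      \<open>J\<close> times it: u is the symmetric part of x, and - J carries the antisymmetric
      part into the fixed space.\<close>
    define u v where "u = (1 / 2) *\<^sub>R (x + W x)" and "v = - (1 / 2) *\<^sub>R J (x - W x)"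
    have "u \<in> span C" unfolding C(3)
      using x by (simp add: u_def blinfun.bilinear_simps Wt WW add.commute)
    moreover have "v \<in> span C" unfolding C(3)
      using x by (simp add: v_def blinfun.bilinear_simps Wt WW WJ diagonalD(2)[OF diagonal_trunc])
    then have "J v \<in> span (J ` C)"
      by (simp add: linear_span_image blinfun.bounded_linear_right[THEN bounded_linear.linear])
    moreover have "x = u + J v"
      by (simp add: u_def v_def blinfun.bilinear_simps algebra_simps flip: scaleR_add_left)
    ultimately show "x \<in> span (C \<union> J ` C)"
      using span_mono[of C "C \<union> J ` C"] span_mono[of "J ` C" "C \<union> J ` C"] by (auto intro: span_add)
  qed
  have "orthonormal (C \<union> J ` C)"
    unfolding orthonormal_def
  proof (intro ballI)
    have Jinj: "J v = J w \<longleftrightarrow> v = w" for v w by (metis J_J neg_equal_iff_equal)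
    have ne: "v \<noteq> J w" if "v \<in> C" "w \<in> C" for v w using CJ(1)[OF that] CC[OF that(1,1)] by auto
    fix x y assume "x \<in> C \<union> J ` C" "y \<in> C \<union> J ` C"
    then show "inner x y = (if x = y then 1 else 0)"
      using ne by (auto simp: CC CJ Jinj)
  qed
  then have ind: "independent (C \<union> J ` C)" by (rule orthonormal_independent)
  have e_inj: "e i = e j \<longleftrightarrow> i = j" "J (e i) = J (e j) \<longleftrightarrow> i = j" "e i \<noteq> J (e j)" "J (e j) \<noteq> e i" for i j
  proof -
    have "inner (e i) (e i) = 1" "inner (e i) (J (e j)) = 0" by (simp_all add: e_ortho)
    then show "e i \<noteq> J (e j)" "J (e j) \<noteq> e i" by (metis inner_e_J_e(1) zero_neq_one)+
    show "e i = e j \<longleftrightarrow> i = j" using e_ortho[of i j] e_ortho[of i i] by (metis zero_neq_one)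
    then show "J (e i) = J (e j) \<longleftrightarrow> i = j" by (metis J_J neg_equal_iff_equal)
  qed
  have "orthonormal ?G" by (auto simp: orthonormal_def e_ortho e_inj)
  then have indG: "independent ?G" by (rule orthonormal_independent)
  have "span ?G = ?V"
  proof (intro equalityI subsetI)
    have "subspace ?V" by (rule subspaceI) (auto simp: blinfun.bilinear_simps)
    moreover have "?G \<subseteq> ?V" by (auto simp: trunc_e)
    ultimately show "x \<in> ?V" if "x \<in> span ?G" for x
      using that span_minimal by blast
  qed (use span_doubled in auto)
  \<comment> \<open>Both sets are bases of the same space; counting gives \<open>card C = n\<close>,
    one vector for each column.\<close>
  then have "card ?G = card (C \<union> J ` C)"
    using dim_eq_card[OF _ indG] dim_eq_card[OF _ ind] spanV by metis
  moreover have "card ?G = 2 * n"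
    by (subst card_Un_disjoint) (auto simp: e_inj card_image inj_on_def)
  moreover have "card (C \<union> J ` C) = 2 * card C"
  proof -
    have "C \<inter> J ` C = {}"
    proof (rule ccontr)
      assume "C \<inter> J ` C \<noteq> {}"
      then obtain v w where "v \<in> C" "w \<in> C" "v = J w" by auto
      then show False using CJ(1)[of v w] CC[of v v] by simp
    qed
    moreover have "inj_on J C" by (rule inj_onI) (metis J_J neg_equal_iff_equal)
    ultimately show ?thesis using C(1) by (simp add: card_Un_disjoint card_image)
  qed
  ultimately have "card C = n" by simp
  then obtain v where v: "bij_betw v {..<n} C"
    using ex_bij_betw_nat_finite[OF C(1)] by (auto simp: lessThan_atLeast0)
  have vC: "v j \<in> C" if "j < n" for j using v that by (auto simp: bij_betw_def)
  have vv: "v i = v j \<longleftrightarrow> i = j" if "i < n" "j < n" for i j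
    using v that by (auto simp: bij_betw_def inj_on_def)
  define A where "A i j = (if i < n \<and> j < n then coord i (v j) else imat_one i j)" for i j
  let ?U = "mat_op n A" and ?V = "mat_op n (adj A)"
  have sA: "stable n A" by (auto simp: stable_def A_def)
  have Ue: "?U (e j) = v j" if "j < n" for j
  proof (rule coord_eqI)
    fix k
    have "\<forall>k\<ge>n. coord k (v j) = 0" using CF(1)[OF vC[OF that]] by (simp add: trunc_eq_iff)
    then show "coord k (?U (e j)) = coord k (v j)"
      using that by (auto simp: coord_mat_op coord_e A_def if_distrib[of "\<lambda>z. _ * z"] cong: if_cong)
  qed
  have UJe: "?U (J (e j)) = J (v j)" if "j < n" for j using Ue[OF that] by (simp add: mat_op_J)
  have Ut: "?U (tail n x) = tail n x" for x
    by (rule coord_eqI) (simp add: coord_mat_op coord_tail)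
  have VU: "?V (?U x) = x" for x
  proof -
    have "imat_mult (adj A) A = imat_one"
    proof (intro ext)
      fix i j
      show "imat_mult (adj A) A i j = imat_one i j"
      proof (cases "i < n \<and> j < n")
        case True
        then have "imat_mult (adj A) A i j = (\<Sum>k<n. adj A i k * A k j)"
          using imat_mult_stable[of n "adj A" A i j] sA by simp
        also have "\<dots> = (\<Sum>k<n. cnj (coord k (v i)) * coord k (v j))"
          using True by (intro sum.cong) (simp_all add: adj_def A_def)
        also have "\<dots> = Complex (inner (v i) (v j)) (inner (J (v i)) (v j))"
          using True by (intro inner_coord CF vC) simp
        also have "\<dots> = imat_one i j"
          using True by (simp add: CC CJ vC vv imat_one_def complex_eq_iff)
        finally show ?thesis .
      next
        case False
        moreover have "stable n (imat_mult (adj A) A)" using sA by (simp add: stable_imat_mult)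
        ultimately show ?thesis unfolding stable_def by (meson linorder_not_le)
      qed
    qed
    then show ?thesis using mat_op_mult[of n "adj A" A x] sA by simp
  qed
  have Usurj: "\<exists>x. ?U x = y" for y
  proof -
    have lin: "linear ?U" by (rule blinfun.bounded_linear_right[THEN bounded_linear.linear])
    have "C \<union> J ` C \<subseteq> range ?U"
    proof
      fix y assume "y \<in> C \<union> J ` C"
      then obtain j where "j < n" "y = v j \<or> y = J (v j)"
        using v by (auto simp: bij_betw_def)
      then show "y \<in> range ?U" using Ue UJe by (metis rangeI)
    qed
    then have "span (C \<union> J ` C) \<subseteq> range ?U"
      using linear_subspace_image[OF lin subspace_UNIV] by (rule span_minimal)
    then have "trunc n y \<in> range ?U" unfolding spanV by (auto simp: trunc_trunc)
    then obtain x where "?U x = trunc n y" by auto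
    then have "?U (x + tail n y) = y" by (simp add: blinfun.add_right Ut) (simp add: tail_apply)
    then show ?thesis by blast
  qed
  have UV: "?U (?V y) = y" for y using Usurj[of y] VU by metis
  have AU: "A \<in> unitary_group n" using sA UV VU by (rule unitary_groupI)
  \<comment> \<open>Checked on \<open>e k\<close> and \<open>J (e k)\<close>, where c acts as 1 and
    -1 and \<open>W\<close> acts likewise on the images; on the tail \<open>W\<close> is c and the
    matrix operator is the identity.\<close>
  have key: "?U (conjg y) = W (?U y)" for y
  proof -
    have "?U (conjg (coord_proj k y)) = W (?U (coord_proj k y))" if "k < n" for k
    proof -
      have "conjg (e k) = e k" "conjg (J (e k)) = - J (e k)" by (simp_all add: conjg_apply scaleR_2)
      then show ?thesis
        using that by (simp add: coord_proj_apply blinfun.bilinear_simps Ue UJe CF vC WJ)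
    qed
    then have "?U (conjg (trunc n y)) = W (?U (trunc n y))"
      by (simp add: trunc_apply blinfun.bilinear_simps)
    moreover have "?U (conjg (tail n y)) = W (?U (tail n y))"
      unfolding Ut by (simp add: W tB Ut flip: diagonalD(4)[OF diagonal_tail])
    moreover have "y = trunc n y + tail n y" by (simp add: tail_apply)
    ultimately show ?thesis by (metis blinfun.add_right)
  qed
  have "stage_op n A = B"
    by (rule blinfun_eqI) (simp add: stage_op_apply key UV W)
  with AU show thesis by (rule that)
qed

text \<open>Equality of A c A^-1 for the two matrices says that the quotient A^-1 A' commutes with
  c, that is, has real entries.\<close>

lemma stage_op_eq_iff:
  assumes A: "A \<in> unitary_group n" and A': "A' \<in> unitary_group n"
  shows "stage_op n A = stage_op n A' \<longleftrightarrow>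
    (\<forall>i j. cnj (imat_mult (adj A) A' i j) = imat_mult (adj A) A' i j)"
proof -
  let ?C = "imat_mult (adj A) A'"
  let ?U = "mat_op n A" and ?V = "mat_op n (adj A)" and ?U' = "mat_op n A'" and ?V' = "mat_op n (adj A')"
  let ?X = "mat_op n ?C"
  note U = unitary_group_op[OF A] and U' = unitary_group_op[OF A']
  have X: "?X x = ?V (?U' x)" for x by (rule mat_op_mult) (simp_all add: U U')
  have sC: "stable n ?C" by (intro stable_imat_mult) (simp_all add: U U')
  have "stage_op n A = stage_op n A' \<longleftrightarrow> (\<forall>x. ?U (conjg (?V x)) = ?U' (conjg (?V' x)))"
    by (auto simp: stage_op_apply dest: arg_cong[of _ _ blinfun_apply] fun_cong intro!: blinfun_eqI)
      (metis (no_types, lifting) stage_op_apply scaleR_left_imp_eq diff_left_imp_eq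
        divide_eq_0_iff zero_neq_numeral zero_neq_one)
  also have "\<dots> \<longleftrightarrow> (\<forall>x. ?X (conjg x) = conjg (?X x))"
  proof
    assume *: "\<forall>x. ?U (conjg (?V x)) = ?U' (conjg (?V' x))"
    show "\<forall>x. ?X (conjg x) = conjg (?X x)"
    proof
      fix x
      have "?U (conjg (?V (?U' x))) = ?U' (conjg x)" using * by (simp add: U')
      then have "?V (?U (conjg (?V (?U' x)))) = ?V (?U' (conjg x))" by simp
      then show "?X (conjg x) = conjg (?X x)" by (simp add: X U)
    qed
  next
    assume *: "\<forall>x. ?X (conjg x) = conjg (?X x)"
    show "\<forall>x. ?U (conjg (?V x)) = ?U' (conjg (?V' x))"
    proof
      fix x
      have "?V (?U' (conjg (?V' x))) = conjg (?V (?U' (?V' x)))" using * by (simp add: X)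
      then have "?U (?V (?U' (conjg (?V' x)))) = ?U (conjg (?V x))" by (simp add: U')
      then show "?U (conjg (?V x)) = ?U' (conjg (?V' x))" by (simp add: U)
    qed
  qed
  also have "\<dots> \<longleftrightarrow> (\<forall>i j. cnj (?C i j) = ?C i j)"
  proof
    assume *: "\<forall>x. ?X (conjg x) = conjg (?X x)"
    show "\<forall>i j. cnj (?C i j) = ?C i j"
    proof (intro allI)
      fix i j
      show "cnj (?C i j) = ?C i j"
      proof (cases "i < n \<and> j < n")
        case True
        have "conjg (e j) = e j" by (simp add: conjg_apply scaleR_2)
        then have "coord i (?X (e j)) = cnj (coord i (?X (e j)))"
          using * by (metis coord_conjg)
        moreover have "coord i (?X (e j)) = ?C i j"
          using True by (simp add: coord_mat_op coord_e if_distrib[of "\<lambda>z. _ * z"] cong: if_cong)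
        ultimately show ?thesis by simp
      next
        case False
        then have "?C i j = imat_one i j" using sC by (auto simp: stable_def not_less)
        then show ?thesis by (simp add: imat_one_def)
      qed
    qed
  next
    assume "\<forall>i j. cnj (?C i j) = ?C i j"
    then show "\<forall>x. ?X (conjg x) = conjg (?X x)"
      by (intro allI coord_eqI) (simp add: coord_mat_op coord_conjg)
  qed
  finally show ?thesis .
qed

text \<open>Both sides say that A^-1 A' is real. Elements of \<open>O_inf\<close> have arbitrary
  size, so all matrices are first brought to a common size \<open>N\<close>.\<close>

lemma coset_eq_iff:
  assumes A: "A \<in> unitary_group m" and A': "A' \<in> unitary_group m"
  shows "imat_mult A ` O_inf = imat_mult A' ` O_inf \<longleftrightarrow> lag_of_unitary A = lag_of_unitary A'"
proof
  assume "lag_of_unitary A = lag_of_unitary A'"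
  have sub: "imat_mult A' ` O_inf \<subseteq> imat_mult A ` O_inf"
    if A: "A \<in> unitary_group m" and A': "A' \<in> unitary_group m"
      and eq: "lag_of_unitary A = lag_of_unitary A'" for A A'
  proof clarify
    fix D assume "D \<in> O_inf"
    then obtain n where D: "D \<in> unitary_group n" "\<And>i j. cnj (D i j) = D i j"
      by (auto simp: O_inf_iff)
    define N where "N = max m n"
    have N: "A \<in> unitary_group N" "A' \<in> unitary_group N" "D \<in> unitary_group N"
      using A A' D(1) unitary_group_mono[of m N] unitary_group_mono[of n N] by (auto simp: N_def)
    then have s: "stable N A" "stable N A'" "stable N D" by (auto simp: unitary_group_iff)
    let ?C = "imat_mult (adj A) A'"
    have sC: "stable N ?C" using s by (simp add: stable_imat_mult)
    have C: "cnj (?C i j) = ?C i j" for i j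
      using eq stage_op_eq_iff[OF N(1,2)] s by (simp add: lag_of_unitary_eq)
    have "?C \<in> unitary_group N" using N by (simp add: unitary_group_mult unitary_group_adj)
    then have "imat_mult ?C D \<in> unitary_group N" using N(3) by (rule unitary_group_mult)
    moreover have "cnj (imat_mult ?C D i j) = imat_mult ?C D i j" for i j
      unfolding imat_mult_def[of ?C D] by (simp add: C D(2))
    ultimately have "imat_mult ?C D \<in> O_inf" by (auto simp: O_inf_iff)
    moreover have "imat_mult A (imat_mult ?C D) = imat_mult A' D"
    proof -
      have "imat_mult A (imat_mult ?C D) = imat_mult (imat_mult A ?C) D"
        using s sC by (simp add: imat_mult_assoc[of N])
      also have "imat_mult A ?C = imat_mult (imat_mult A (adj A)) A'"
        using s by (simp add: imat_mult_assoc[of N])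
      also have "\<dots> = A'" using N(1) s(2) by (simp add: unitary_group_iff imat_mult_one)
      finally show ?thesis .
    qed
    ultimately show "imat_mult A' D \<in> imat_mult A ` O_inf" by (metis imageI)
  qed
  show "imat_mult A ` O_inf = imat_mult A' ` O_inf"
    using sub[OF A A'] sub[OF A' A] \<open>lag_of_unitary A = lag_of_unitary A'\<close> by auto
next
  assume eq: "imat_mult A ` O_inf = imat_mult A' ` O_inf"
  \<comment> \<open>The identity matrix belongs to \<open>O_inf\<close>, so \<open>A'\<close> itself
    lies in the coset of \<open>A\<close>.\<close>
  have "adj imat_one = imat_one" by (intro ext) (simp add: adj_def imat_one_def)
  then have "imat_one \<in> unitary_group 0" by (intro unitary_groupI) simp_all
  then have "imat_one \<in> O_inf" by (auto simp: O_inf_iff imat_one_def)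
  moreover have "imat_mult A' imat_one = A'" using A' by (auto simp: unitary_group_iff imat_mult_one)
  ultimately have "A' \<in> imat_mult A ` O_inf" using eq by (metis imageI)
  then obtain D where D: "D \<in> O_inf" "A' = imat_mult A D" by auto
  then obtain n where n: "D \<in> unitary_group n" "\<And>i j. cnj (D i j) = D i j" by (auto simp: O_inf_iff)
  define N where "N = max m n"
  have N: "A \<in> unitary_group N" "A' \<in> unitary_group N" "D \<in> unitary_group N"
    using A A' n(1) unitary_group_mono[of m N] unitary_group_mono[of n N] by (auto simp: N_def)
  then have s: "stable N A" "stable N A'" "stable N D" by (auto simp: unitary_group_iff)
  have "imat_mult (adj A) A' = imat_mult (imat_mult (adj A) A) D"
    using s by (simp add: D(2) imat_mult_assoc[of N])
  also have "\<dots> = D" using N(1) s(3) by (simp add: unitary_group_iff imat_mult_one)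
  finally have "stage_op N A = stage_op N A'"
    using stage_op_eq_iff[OF N(1,2)] n(2) by simp
  then show "lag_of_unitary A = lag_of_unitary A'" using s by (simp add: lag_of_unitary_eq)
qed

lemma continuous_on_stage_op: "continuous_on S (stage_op n)"
proof -
  have m: "continuous_on S (\<lambda>A. mat_op n A)" for S
    unfolding mat_op_def by (intro continuous_intros continuous_on_entry)
  have a: "continuous_on S (\<lambda>A. mat_op n (adj A))"
    unfolding mat_op_def adj_def by (intro continuous_intros continuous_on_entry)
  show ?thesis
    unfolding stage_op_def
    by (intro continuous_intros m a bounded_bilinear.continuous_on[OF bounded_bilinear_blinfun_compose])
qed

text \<open>Compactness of the unitary group does the work: a continuous surjection from a compact
  onto a Hausdorff space is a quotient map.\<close>

lemma quotient_map_stage: "quotient_map (top_of_set (unitary_group n)) (top_of_set (stage n)) lag_of_unitary"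
proof (rule continuous_imp_quotient_map)
  have eq: "lag_of_unitary A = stage_op n A" if "A \<in> unitary_group n" for A
    using that by (simp add: unitary_group_iff lag_of_unitary_eq)
  have im: "lag_of_unitary ` unitary_group n = stage n"
  proof (intro equalityI subsetI)
    fix B assume "B \<in> stage n"
    then obtain A where "A \<in> unitary_group n" "stage_op n A = B" by (rule stage_op_surj)
    then show "B \<in> lag_of_unitary ` unitary_group n" using eq by (metis imageI)
  qed (auto simp: eq stage_op_in_stage)
  then show "lag_of_unitary ` topspace (top_of_set (unitary_group n)) = topspace (top_of_set (stage n))"
    by simp
  have "continuous_on (unitary_group n) lag_of_unitary"
    using continuous_on_stage_op by (rule continuous_on_eq) (simp add: eq)
  then show "continuous_map (top_of_set (unitary_group n)) (top_of_set (stage n)) lag_of_unitary"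
    using im by auto
  show "compact_space (top_of_set (unitary_group n))"
    by (simp add: compact_space_subtopology compact_unitary_group)
  show "Hausdorff_space (top_of_set (stage n))" by (simp add: Hausdorff_space_subtopology)
qed

text \<open>Openness in either colimit is tested stage by stage, and \<open>unitary_group n\<close>
  is mapped onto \<open>stage n\<close>, which reduces the claim to
  \<open>quotient_map_stage\<close>.\<close>

lemma quotient_map_stages: "quotient_map U_inf stages lag_of_unitary"
  unfolding quotient_map_def
proof (intro conjI allI impI)
  have top: "topspace U_inf = (\<Union>n. unitary_group n)" "topspace stages = (\<Union>n. stage n)"
    by (simp_all add: U_inf_def topspace_colimit_topology)
  have im: "lag_of_unitary ` unitary_group n = stage n" for n
    using quotient_map_stage[of n] by (simp add: quotient_map_def)
  show "lag_of_unitary ` topspace U_inf = topspace stages" by (simp add: top image_UN im)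
  fix W assume W: "W \<subseteq> topspace stages"
  let ?V = "{A \<in> topspace U_inf. lag_of_unitary A \<in> W}"
  have "openin (top_of_set (unitary_group n)) (?V \<inter> unitary_group n) \<longleftrightarrow>
      openin (top_of_set (stage n)) (W \<inter> stage n)" for n
  proof -
    have "openin (top_of_set (unitary_group n)) {A \<in> topspace (top_of_set (unitary_group n)). lag_of_unitary A \<in> W \<inter> stage n}
        \<longleftrightarrow> openin (top_of_set (stage n)) (W \<inter> stage n)"
      by (rule quotient_map_stage[of n, unfolded quotient_map_def, THEN conjunct2, rule_format]) simp
    moreover have "{A \<in> topspace (top_of_set (unitary_group n)). lag_of_unitary A \<in> W \<inter> stage n} = ?V \<inter> unitary_group n"
      using im[of n] by (auto simp: top)
    ultimately show ?thesis by simp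
  qed
  moreover have "openin U_inf ?V \<longleftrightarrow> (\<forall>n. openin (top_of_set (unitary_group n)) (?V \<inter> unitary_group n))"
    unfolding U_inf_def openin_colimit_topology by (auto simp: topspace_colimit_topology)
  moreover have "openin stages W \<longleftrightarrow> (\<forall>n. openin (top_of_set (stage n)) (W \<inter> stage n))"
    using W unfolding openin_colimit_topology by (auto simp: top)
  ultimately show "openin U_inf ?V \<longleftrightarrow> openin stages W" by blast
qed

theorem U_inf_mod_O_inf_homeomorphic_stages: "U_inf_mod_O_inf homeomorphic_space stages"
  unfolding U_inf_mod_O_inf_def
proof (rule homeomorphic_space_of_quotient_maps[OF quotient_map_quotient_topology quotient_map_stages])
  fix A A' assume "A \<in> topspace U_inf" "A' \<in> topspace U_inf"
  then obtain m n where "A \<in> unitary_group m" "A' \<in> unitary_group n"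
    by (auto simp: U_inf_def topspace_colimit_topology)
  then have "A \<in> unitary_group (max m n)" "A' \<in> unitary_group (max m n)"
    using unitary_group_mono[of m "max m n"] unitary_group_mono[of n "max m n"] by auto
  then show "imat_mult A ` O_inf = imat_mult A' ` O_inf \<longleftrightarrow> lag_of_unitary A = lag_of_unitary A'"
    by (rule coset_eq_iff)
qed

end

theorem theorem2p7:
  fixes J :: "'a::{real_inner, complete_space} \<Rightarrow> 'a"
    and L\<^sub>0 :: "'a set"
  assumes separable: "separable_space (euclidean :: 'a topology)"
    and infinite_dimensional: "\<not> fin_dim (UNIV :: 'a set)"
    and bounded: "bounded_linear J"
    and J_squared: "\<And>x. J (J x) = - x"
    and J_skew_adjoint: "\<And>x y. inner (J x) y = inner x (- J y)"
    and L\<^sub>0: "lagrangian J L\<^sub>0"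
  shows "fredholm_lagrangian_grassmannian J L\<^sub>0 homotopy_equivalent_space U_inf_mod_O_inf"
proof -
  define K where "K = Blinfun J"
  have K: "blinfun_apply K = J" using bounded by (simp add: K_def bounded_linear_Blinfun_apply)
  have KK: "K (K x) = - x" for x by (simp add: K J_squared)
  have L: "lagrangian K L\<^sub>0" using L\<^sub>0 by (simp add: K)
  note P = lagrangian_orth_proj[OF KK L]
  have cs: "closed L\<^sub>0" "subspace L\<^sub>0" using L\<^sub>0 by (auto simp: lagrangian_def)
  \<comment> \<open>H is the sum of \<open>L\<^sub>0\<close> and \<open>J L\<^sub>0\<close>, so it
    would be finite-dimensional together with \<open>L\<^sub>0\<close>.\<close>
  have nf: "\<not> fin_dim L\<^sub>0"
  proof
    assume "fin_dim L\<^sub>0"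
    then obtain B where B: "finite B" "span B = L\<^sub>0" by (auto simp: fin_dim_def)
    have "x \<in> span (B \<union> J ` B)" for x
    proof -
      have "x - orth_proj L\<^sub>0 x \<in> J ` L\<^sub>0" using orth_proj(2)[OF cs] L\<^sub>0 by (simp add: lagrangian_def)
      also have "J ` L\<^sub>0 = span (J ` B)"
        using linear_span_image[OF bounded_linear.linear[OF bounded], of B] B(2) by simp
      finally have "x - orth_proj L\<^sub>0 x \<in> span (B \<union> J ` B)" using span_mono[of "J ` B" "B \<union> J ` B"] by blast
      moreover have "orth_proj L\<^sub>0 x \<in> span (B \<union> J ` B)"
        using orth_proj(1)[OF cs, of x] B(2) span_mono[of B "B \<union> J ` B"] by blast
      ultimately show ?thesis using span_add by fastforce
    qed
    then have "span (B \<union> J ` B) = UNIV" by auto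
    then have "fin_dim (UNIV :: 'a set)"
      unfolding fin_dim_def using B(1) by (intro exI[of _ "B \<union> J ` B"]) simp
    with infinite_dimensional show False ..
  qed
  obtain e :: "nat \<Rightarrow> 'a" where e: "\<And>i j. inner (e i) (e j) = (if i = j then 1 else 0)"
    "closure (span (range e)) = L\<^sub>0"
    by (rule orthonormal_basis_sequence[OF separable cs nf]) (assumption | rule that)+
  have eL: "e i \<in> L\<^sub>0" for i
    using e(2) closure_subset[of "span (range e)"] span_base[of "e i" "range e"] by auto
  interpret lagrangian_setting K "orth_proj L\<^sub>0" e
  proof
    show "inner (K x) y = - inner x (K y)" for x y by (simp add: K J_skew_adjoint)
    show "orth_proj L\<^sub>0 x = x \<Longrightarrow> x \<in> closure (span (range e))" for x
      unfolding e(2) by (simp add: P(4))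
    show "orth_proj L\<^sub>0 (e i) = e i" for i unfolding P(4) by (rule eL)
  qed (use KK P(1,2,3) e(1) in auto)
  have "base = L\<^sub>0" by (simp add: base_def P(4))
  then have "fredholm_lagrangian_grassmannian J L\<^sub>0 homotopy_equivalent_space top_of_set fredholm_ops"
    using homeomorphic_imp_homotopy_equivalent_space[OF grassmannian_homeomorphic_fredholm_ops] by (simp add: K)
  moreover have "stages homotopy_equivalent_space U_inf_mod_O_inf"
    using homeomorphic_imp_homotopy_equivalent_space[OF U_inf_mod_O_inf_homeomorphic_stages]
    by (rule homotopy_equivalent_space_sym[THEN iffD1])
  ultimately show ?thesis
    using fredholm_ops_homotopy_equivalent_stages by (meson homotopy_eqv_trans)
qed

end
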